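(* Let $n\in\mathbb Z$ and $g\in\mathbb N_{\ge1}$. 1) $M^{h,h'}(n,g)$ is a representation of infinite rank of $U_{h,h'}(\mathfrak{sl}_2,g)$. 2) $M^{h,h'}(n,g)$ is a formal deformation of the Verma module $M(n)$ of $U(\mathfrak{sl}_2)$ along $h$ and $h'$. 3) $M^{h,h'}(n,g)$ is a formal deformation of the Verma module $M^h(n)$ of $U_h(\mathfrak{sl}_2)$ along $h'$. 4) The Verma module $M^{h,h'}(n,g)$ is a weight representation. 5) The action of $U_{h,h'}(\mathfrak{sl}_2,g)$ on $M^{h,h'}(n,g)$ is given in the topological basis $(m_j)_{j\in\mathbb N}$ by $$H.m_j=(n-2j)\,m_j,\qquad C.m_j=(n+1)^2\,m_j,\qquad X^-.m_j=m_{j+1},$$ $$X^+.m_j=[j]_{QT^{\{j\}}}\,[n-j+1]_{QT^{\{n-j+1\}}}\,m_{j-1}$$ (with $m_{-1}:=0$).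
   Context: $\mathbb N=\{0,1,2,\dots\}$. For a vector space $V$, $V[[\bar h]]$ is the space of formal power series in the parameters $\bar h$ with coefficients in $V$. The $\mathbb C[[\bar h]]$-algebra topologically generated by a set $X$ with relations $\mathcal R$ is $\mathbb C\langle X\rangle[[\bar h]]$ modulo the $\bar h$-adic closure of the two-sided ideal generated by $\mathcal R$, where $\mathbb C\langle X\rangle$ is the free associative unital algebra on $X$. Definition of $U_{h,h'}(\mathfrak{sl}_2,g)$. Let $\varepsilon=\exp(i\pi/g)$, $Q=\exp(h)$, $T=\exp(h')$, $$P(u)=\tfrac12\left(u^{g-1}+u^{1-g}\right)\prod_{k=1}^{g-1}\frac{\varepsilon^k u-\varepsilon^{-k}u^{-1}}{\varepsilon^k-\varepsilon^{-k}}.$$ $U_{h,h'}(\mathfrak{sl}_2,g)$ is the $\mathbb C[[h,h']]$-algebra topologically generated by $X^+,X^-,H,C$ with relations $[C,X^\pm]=[C,H]=0$, $[H,X^\pm]=\pm2X^\pm$, $$X^\pm X^\mp=\prod_{e=1,-1}\frac{\left(Q\,T^{\{H_e^\pm\}_Q}\right)^{H_e^\pm}-\left(Q\,T^{\{H_e^\pm\}_Q}\right)^{-H_e^\pm}}{Q\,T^{\{H_e^\pm\}_Q}-Q^{-1}T^{-\{H_e^\pm\}_Q}},$$ where $H_e^\pm=\frac12(\sqrt C+eH\mp e)$, $\{H_e^\pm\}_Q=P(Q^{H_e^\pm})$. Numerator and denominator are series in $\mathbb C[H,\sqrt C][[h,h']]$, each divided by $h+h'\{H_e^\pm\}_Q$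 before the quotient is taken; the product over $e$ is invariant under $\sqrt C\mapsto-\sqrt C$, and $(\sqrt C)^2$ is replaced by $C$. $U=U(\mathfrak{sl}_2)$ has generators $\bar X^\pm,\bar H$ with $[\bar H,\bar X^\pm]=\pm2\bar X^\pm$, $[\bar X^+,\bar X^-]=\bar H$. $U^h=U_h(\mathfrak{sl}_2)$ is the $\mathbb C[[h]]$-algebra topologically generated by $\tilde X^\pm,\tilde H$ with $[\tilde H,\tilde X^\pm]=\pm2\tilde X^\pm$, $[\tilde X^+,\tilde X^-]=\sinh(h\tilde H)/\sinh(h)$. Matching the (topological) bases $(\bar X^-)^a\bar H^b(\bar X^+)^c$, $(\tilde X^-)^a\tilde H^b(\tilde X^+)^c$, $(X^-)^aH^b(X^+)^c$ ($a,b,c\in\mathbb N$), one identifies $U^h=U[[h]]$ and $U^{h,h'}:=U_{h,h'}(\mathfrak{sl}_2,g)=U[[h,h']]=U^h[[h']]$ as modules; these are formal deformations (products reducing to those of $U$, resp. $U^h$, modulo $(h,h')$, resp. $h'$). Verma modules: $M(n)=U/\big(U\bar X^++U(\bar H-n1)\big)$, $M^h(n)=U^h/\big(U^h\tilde X^++U^h(\tilde H-n1)\big)$, $M^{h,h'}(n,g)=U^{h,h'}/\big(U^{h,h'}X^++U^{h,h'}(H-n1)\big)$. In each, $m_0$ is the class of $1$ and $m_j=(X^-)^jm_0$ (resp. with $\bar X^-,\tilde X^-$). Identifying the $m_j$, one has $M^h(n)=M(n)[[h]]$ and $M^{h,h'}(n,g)=M(n)[[h,h']]$ as modules. A representation of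 $U_{h,h'}(\mathfrak{sl}_2,g)$ is an action by $\mathbb C[[h,h']]$-linear operators on $V[[h,h']]$ for a $\mathbb C$-vector space $V$; its rank is $\dim V$. It is a formal deformation along $h,h'$ (resp. along $h'$) of the representation of $U(\mathfrak{sl}_2)$ on $V$ (resp. of $U_h(\mathfrak{sl}_2)$ on $V[[h]]$) which it induces modulo $(h,h')$ (resp. modulo $h'$). A representation $V^{h,h'}$ is a weight representation if the $\mathbb C[[h,h']]$-module $V^{h,h'}$ admits the direct sum decomposition $V^{h,h'}=\bigoplus_{m\in\mathbb Z}V^{h,h'}_m$, where $V^{h,h'}_m=\{f\in V^{h,h'}: H.f=mf\}$. For $a\in\mathbb Z$: $\{a\}=P(Q^a)$ and $[a]_{QT^{\{a\}}}=\frac{(QT^{\{a\}})^a-(QT^{\{a\}})^{-a}}{QT^{\{a\}}-Q^{-1}T^{-\{a\}}}\in\mathbb C[[h,h']]$.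
   Formalization: In 4) the direct sum of weight spaces is taken as the completed (topological) one: each element is uniquely an adically convergent sum of weight vectors; the algebraic direct sum fails, since the sum of all h^j m_j is not a finite sum of weight vectors. *)

theory Defs
  imports
    Complex_Main
    "HOL-Library.Poly_Mapping"
    "HOL-Computational_Algebra.Polynomial"
    "HOL-Computational_Algebra.Formal_Power_Series"
    "HOL-Algebra.QuotRing"
    "HOL-Algebra.Module"
begin

unbundle fps_syntax

section \<open>Free algebras and formal power series over them\<close>

text \<open>
  The ring \<open>\<complex>[[h,h']]\<close> is the type \<^typ>\<open>complex fps fps\<close>, and \<open>A[[h,h']]\<close> is \<open>'a fps fps\<close>. The inner
  variable is \<open>h\<close> and the outer variable is \<open>h'\<close>: the coefficient of \<open>h\<^sup>i h'\<^sup>j\<close> in \<open>f\<close> is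
  \<open>f $ j $ i\<close>. The free algebra \<open>\<complex>\<langle>X\<rangle>\<close> is the monoid algebra of the monoid of words in \<open>X\<close>.
\<close>

datatype 'x free_monoid = Word (letters: "'x list")

instantiation free_monoid :: (type) monoid_add
begin

definition zero_free_monoid :: "'a free_monoid" where
  "0 = Word []"

definition plus_free_monoid :: "'a free_monoid \<Rightarrow> 'a free_monoid \<Rightarrow> 'a free_monoid" where
  "v + w = Word (letters v @ letters w)"

instance
  by standard (simp_all add: zero_free_monoid_def plus_free_monoid_def)

end

type_synonym 'x free_algebra = "'x free_monoid \<Rightarrow>\<^sub>0 complex"

definition var :: "'x \<Rightarrow> 'x free_algebra" where
  "var x = Poly_Mapping.single (Word [x]) 1"

definition scal :: "complex \<Rightarrow> 'x free_algebra" where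
  "scal c = Poly_Mapping.single 0 c"

definition scal1 :: "complex fps \<Rightarrow> 'x free_algebra fps" where
  "scal1 c = Abs_fps (\<lambda>i. scal (c $ i))"

definition scal2 :: "complex fps fps \<Rightarrow> 'x free_algebra fps fps" where
  "scal2 c = Abs_fps (\<lambda>j. scal1 (c $ j))"

abbreviation const2 :: "'a::zero \<Rightarrow> 'a fps fps" where
  "const2 a \<equiv> fps_const (fps_const a)"

definition hbar :: "'a::{zero,one} fps fps" where
  "hbar = fps_const fps_X"

definition hbar' :: "'a::{zero,one} fps fps" where
  "hbar' = fps_X"

definition adic_closure1 :: "'a fps set \<Rightarrow> 'a fps set" where
  "adic_closure1 S = {f. \<forall>N. \<exists>s\<in>S. \<forall>i<N. f $ i = s $ i}"

definition adic_closure2 :: "'a fps fps set \<Rightarrow> 'a fps fps set" where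
  "adic_closure2 S = {f. \<forall>N. \<exists>s\<in>S. \<forall>i j. i + j < N \<longrightarrow> f $ j $ i = s $ j $ i}"


section \<open>The structure functions\<close>

text \<open>
  Everything in this section is done over a commutative \<open>\<complex>\<close>-algebra whose structure map is
  \<open>\<iota>\<close>. It is used for \<open>\<complex>\<close> itself, for \<open>\<complex>[H]\<close> and for \<open>\<complex>[H,\<surd>C]\<close>. \<open>exact_quot a b\<close> is the quotient
  \<open>a/b\<close> in an integral domain, when \<open>b\<close> is nonzero and divides \<open>a\<close>.
\<close>

definition exact_quot :: "'a::idom \<Rightarrow> 'a \<Rightarrow> 'a" where
  "exact_quot a b = (THE q. q * b = a)"

definition exp1 :: "(complex \<Rightarrow> 'a::comm_ring_1) \<Rightarrow> 'a fps \<Rightarrow> 'a fps" where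
  "exp1 \<iota> w = Abs_fps (\<lambda>k. \<iota> (1 / fact k)) oo w"

definition sinh1 :: "(complex \<Rightarrow> 'a::comm_ring_1) \<Rightarrow> 'a fps \<Rightarrow> 'a fps" where
  "sinh1 \<iota> w = fps_const (\<iota> (1/2)) * (exp1 \<iota> w - exp1 \<iota> (- w))"

text \<open>
  The exponential of a series \<open>w\<close> in \<open>h,h'\<close> without constant term. The terms \<open>w\<^sup>k\<close> with
  \<open>k > i + j\<close> do not contribute to the coefficient of \<open>h\<^sup>i h'\<^sup>j\<close>. (The library's composition
  would require \<open>w\<close> to be divisible by \<open>h'\<close>.)
\<close>
definition exp2 :: "(complex \<Rightarrow> 'a::comm_ring_1) \<Rightarrow> 'a fps fps \<Rightarrow> 'a fps fps" where
  "exp2 \<iota> w = Abs_fps (\<lambda>j. Abs_fps (\<lambda>i. \<Sum>k\<le>i + j. \<iota> (1 / fact k) * (w ^ k) $ j $ i))"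

text \<open>\<open>P(u)\<close>, where \<open>v\<close> stands for \<open>u\<inverse>\<close>.\<close>
definition P_fun ::
  "(complex \<Rightarrow> 'a::comm_ring_1) \<Rightarrow> nat \<Rightarrow> 'a fps fps \<Rightarrow> 'a fps fps \<Rightarrow> 'a fps fps" where
  "P_fun \<iota> g u v =
     (let \<epsilon> = exp (\<i> * of_real pi / of_nat g) :: complex in
      const2 (\<iota> (1/2)) * (u ^ (g - 1) + v ^ (g - 1)) *
      (\<Prod>k=1..g - 1. const2 (\<iota> (1 / (\<epsilon> ^ k - inverse \<epsilon> ^ k))) *
         (const2 (\<iota> (\<epsilon> ^ k)) * u - const2 (\<iota> (inverse \<epsilon> ^ k)) * v)))"

text \<open>\<open>{x}\<^sub>Q = P(Q\<^sup>x)\<close> with \<open>Q\<^sup>x = exp(hx)\<close>.\<close>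
definition curly :: "(complex \<Rightarrow> 'a::comm_ring_1) \<Rightarrow> nat \<Rightarrow> 'a \<Rightarrow> 'a fps fps" where
  "curly \<iota> g x = P_fun \<iota> g (exp2 \<iota> (const2 x * hbar)) (exp2 \<iota> (- (const2 x * hbar)))"

text \<open>
  With \<open>z = h + h'{x}\<^sub>Q\<close> one has \<open>Q T\<^bsup>{x}\<^esup> = exp z\<close> and \<open>(Q T\<^bsup>{x}\<^esup>)\<^sup>x = exp(xz)\<close>. So \<open>qt_bracket\<close> is
  \<open>((Q T\<^bsup>{x}\<^esup>)\<^sup>x - (Q T\<^bsup>{x}\<^esup>)\<^bsup>-x\<^esup>) / (Q T\<^bsup>{x}\<^esup> - Q\<^bsup>-1\<^esup> T\<^bsup>-{x}\<^esup>)\<close>. The numerator and the denominator are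
  not invertible; each is divided by \<open>z\<close> before the quotient is taken.
\<close>
definition qt_bracket :: "(complex \<Rightarrow> 'a::idom) \<Rightarrow> nat \<Rightarrow> 'a \<Rightarrow> 'a fps fps" where
  "qt_bracket \<iota> g x =
     (let z = hbar + hbar' * curly \<iota> g x;
          num = exp2 \<iota> (const2 x * z) - exp2 \<iota> (- (const2 x * z));
          den = exp2 \<iota> z - exp2 \<iota> (- z)
      in exact_quot (exact_quot num z) (exact_quot den z))"

text \<open>\<open>[a]\<close> with base \<open>Q T\<^bsup>{a}\<^esup>\<close>, for an integer \<open>a\<close>.\<close>
definition qt_int :: "nat \<Rightarrow> int \<Rightarrow> complex fps fps" where
  "qt_int g a = qt_bracket (\<lambda>c. c) g (of_int a)"

text \<open>
  \<open>\<complex>[H,\<surd>C]\<close> is \<^typ>\<open>complex poly poly\<close>, with inner variable \<open>H\<close> and outer variable \<open>\<surd>C\<close>.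
  \<open>H_pm s e\<close> is \<open>(\<surd>C + eH - se)/2\<close>; it is \<open>H\<^sub>e\<^sup>+\<close> for \<open>s = 1\<close> and \<open>H\<^sub>e\<^sup>-\<close> for \<open>s = -1\<close>.
\<close>
definition H_pm :: "complex \<Rightarrow> complex \<Rightarrow> complex poly poly" where
  "H_pm s e = [: [: - (s * e) / 2, e / 2 :], [: 1/2 :] :]"

definition XX_series :: "nat \<Rightarrow> complex \<Rightarrow> complex poly poly fps fps" where
  "XX_series g s = (\<Prod>e\<in>{1, -1}. qt_bracket (\<lambda>c. [:[:c:]:]) g (H_pm s e))"

text \<open>\<open>sinh(hH)/sinh(h)\<close> in \<open>\<complex>[H][[h]]\<close>.\<close>
definition sinh_quot :: "complex poly fps" where
  "sinh_quot = exact_quot (sinh1 (\<lambda>c. [:c:]) (fps_const [:0, 1:] * fps_X))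
                          (sinh1 (\<lambda>c. [:c:]) fps_X)"


section \<open>The three algebras\<close>

definition type_ring :: "'a::ring_1 ring" where
  "type_ring = \<lparr>carrier = UNIV, mult = (*), one = 1, zero = 0, add = (+)\<rparr>"

text \<open>Algebras over a commutative ring (a type \<open>'k\<close>) with three distinguished elements.\<close>
record ('k, 'u) sl2_algebra = "('k, 'u) module" +
  Xp :: 'u
  Xm :: 'u
  Hw :: 'u

definition quotient_algebra ::
  "('k \<Rightarrow> 'a::ring_1) \<Rightarrow> 'a set \<Rightarrow> 'a \<Rightarrow> 'a \<Rightarrow> 'a \<Rightarrow> ('k, 'a set) sl2_algebra" where
  "quotient_algebra \<iota> I x y h =
     (let Q = type_ring Quot I; cls = (\<lambda>a. I +>\<^bsub>type_ring\<^esub> a) in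
      \<lparr>carrier = carrier Q, mult = mult Q, one = one Q, zero = zero Q, add = add Q,
       smult = (\<lambda>c u. cls (\<iota> c) \<otimes>\<^bsub>Q\<^esub> u), Xp = cls x, Xm = cls y, Hw = cls h\<rparr>)"

datatype gen3 = Xp3 | Xm3 | H3

datatype gen4 = Xp4 | Xm4 | H4 | C4

definition U_rels :: "gen3 free_algebra set" where
  "U_rels =
     {var H3 * var Xp3 - var Xp3 * var H3 - 2 * var Xp3,
      var H3 * var Xm3 - var Xm3 * var H3 + 2 * var Xm3,
      var Xp3 * var Xm3 - var Xm3 * var Xp3 - var H3}"

definition U_sl2 :: "(complex, gen3 free_algebra set) sl2_algebra" where
  "U_sl2 = quotient_algebra scal (Idl\<^bsub>type_ring\<^esub> U_rels) (var Xp3) (var Xm3) (var H3)"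

definition eval_H :: "complex poly \<Rightarrow> gen3 free_algebra" where
  "eval_H p = (\<Sum>k\<le>degree p. scal (coeff p k) * var H3 ^ k)"

definition Uh_rels :: "gen3 free_algebra fps set" where
  "Uh_rels =
     (let v = (\<lambda>x. fps_const (var x)) in
      {v H3 * v Xp3 - v Xp3 * v H3 - 2 * v Xp3,
       v H3 * v Xm3 - v Xm3 * v H3 + 2 * v Xm3,
       v Xp3 * v Xm3 - v Xm3 * v Xp3 - Abs_fps (\<lambda>i. eval_H (sinh_quot $ i))})"

definition Uh_sl2 :: "(complex fps, gen3 free_algebra fps set) sl2_algebra" where
  "Uh_sl2 = quotient_algebra scal1 (adic_closure1 (Idl\<^bsub>type_ring\<^esub> Uh_rels))
     (fps_const (var Xp3)) (fps_const (var Xm3)) (fps_const (var H3))"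

text \<open>
  Replaces \<open>(\<surd>C)\<^bsup>2b\<^esup>\<close> by \<open>C\<^sup>b\<close> in a polynomial that is even in \<open>\<surd>C\<close>. The order of the factors
  \<open>H\<close> and \<open>C\<close> is immaterial because \<open>[C,H] = 0\<close> is among the relations.
\<close>
definition eval_HC :: "complex poly poly \<Rightarrow> gen4 free_algebra" where
  "eval_HC q = (\<Sum>b\<le>degree q div 2. \<Sum>a\<le>degree (coeff q (2 * b)).
      scal (coeff (coeff q (2 * b)) a) * var H4 ^ a * var C4 ^ b)"

definition Uhh_rels :: "nat \<Rightarrow> gen4 free_algebra fps fps set" where
  "Uhh_rels g =
     (let v = (\<lambda>x. const2 (var x));
          R = (\<lambda>s. Abs_fps (\<lambda>j. Abs_fps (\<lambda>i. eval_HC (XX_series g s $ j $ i)))) in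
      {v C4 * v Xp4 - v Xp4 * v C4,
       v C4 * v Xm4 - v Xm4 * v C4,
       v C4 * v H4 - v H4 * v C4,
       v H4 * v Xp4 - v Xp4 * v H4 - 2 * v Xp4,
       v H4 * v Xm4 - v Xm4 * v H4 + 2 * v Xm4,
       v Xp4 * v Xm4 - R 1,
       v Xm4 * v Xp4 - R (-1)})"

definition Uhh_ideal :: "nat \<Rightarrow> gen4 free_algebra fps fps set" where
  "Uhh_ideal g = adic_closure2 (Idl\<^bsub>type_ring\<^esub> (Uhh_rels g))"

definition Uhh_sl2 :: "nat \<Rightarrow> (complex fps fps, gen4 free_algebra fps fps set) sl2_algebra" where
  "Uhh_sl2 g = quotient_algebra scal2 (Uhh_ideal g)
     (const2 (var Xp4)) (const2 (var Xm4)) (const2 (var H4))"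

definition Uhh_C :: "nat \<Rightarrow> gen4 free_algebra fps fps set" where
  "Uhh_C g = Uhh_ideal g +>\<^bsub>type_ring\<^esub> const2 (var C4)"

definition pbw :: "('k, 'u) sl2_algebra \<Rightarrow> nat \<times> nat \<times> nat \<Rightarrow> 'u" where
  "pbw U = (\<lambda>(a, b, c). Xm U [^]\<^bsub>U\<^esub> a \<otimes>\<^bsub>U\<^esub> Hw U [^]\<^bsub>U\<^esub> b \<otimes>\<^bsub>U\<^esub> Xp U [^]\<^bsub>U\<^esub> c)"


section \<open>Verma modules\<close>

definition verma_sub :: "('k::ring_1, 'u) sl2_algebra \<Rightarrow> int \<Rightarrow> 'u set" where
  "verma_sub U n =
     {a \<otimes>\<^bsub>U\<^esub> Xp U \<oplus>\<^bsub>U\<^esub> b \<otimes>\<^bsub>U\<^esub> (Hw U \<ominus>\<^bsub>U\<^esub> (of_int n \<odot>\<^bsub>U\<^esub> \<one>\<^bsub>U\<^esub>)) | a b.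
        a \<in> carrier U \<and> b \<in> carrier U}"

definition verma_act :: "('k::ring_1, 'u) sl2_algebra \<Rightarrow> int \<Rightarrow> 'u \<Rightarrow> 'u set \<Rightarrow> 'u set" where
  "verma_act U n u m = (\<Union>y\<in>m. verma_sub U n +>\<^bsub>U\<^esub> (u \<otimes>\<^bsub>U\<^esub> y))"

text \<open>The fields \<open>mult\<close> and \<open>one\<close> of the library's module record carry no meaning here.\<close>
definition verma :: "('k::ring_1, 'u) sl2_algebra \<Rightarrow> int \<Rightarrow> ('k, 'u set) module" where
  "verma U n =
     \<lparr>carrier = a_rcosets\<^bsub>U\<^esub> (verma_sub U n), mult = undefined, one = undefined,
      zero = verma_sub U n, add = set_add U,
      smult = (\<lambda>c m. \<Union>y\<in>m. verma_sub U n +>\<^bsub>U\<^esub> (c \<odot>\<^bsub>U\<^esub> y))\<rparr>"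

definition verma_vec :: "('k::ring_1, 'u) sl2_algebra \<Rightarrow> int \<Rightarrow> nat \<Rightarrow> 'u set" where
  "verma_vec U n j = verma_act U n (Xm U [^]\<^bsub>U\<^esub> j) (verma_sub U n +>\<^bsub>U\<^esub> \<one>\<^bsub>U\<^esub>)"


section \<open>Modules of formal power series and identifications along bases\<close>

text \<open>
  \<open>series_module M\<close> is \<open>M[[t]]\<close>, a module over \<open>K[[t]]\<close> if \<open>M\<close> is one over \<open>K\<close>. Iterating it on a
  complex vector space \<open>V\<close> gives \<open>V[[h,h']]\<close>, over \<^typ>\<open>complex fps fps\<close>.
\<close>
definition series_module :: "('k, 'v, 'e) module_scheme \<Rightarrow> ('k fps, nat \<Rightarrow> 'v) module" where
  "series_module M =
     \<lparr>carrier = {f. \<forall>i. f i \<in> carrier M}, mult = undefined, one = undefined,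
      zero = (\<lambda>i. \<zero>\<^bsub>M\<^esub>), add = (\<lambda>f f' i. f i \<oplus>\<^bsub>M\<^esub> f' i),
      smult = (\<lambda>c f i. \<Oplus>\<^bsub>M\<^esub>k\<in>{..i}. (c $ k) \<odot>\<^bsub>M\<^esub> f (i - k))\<rparr>"

definition series_const :: "('k, 'v, 'e) module_scheme \<Rightarrow> 'v \<Rightarrow> nat \<Rightarrow> 'v" where
  "series_const M v = (\<lambda>i. if i = 0 then v else \<zero>\<^bsub>M\<^esub>)"

abbreviation series_module2 ::
  "('k, 'v, 'e) module_scheme \<Rightarrow> ('k fps fps, nat \<Rightarrow> nat \<Rightarrow> 'v) module" where
  "series_module2 M \<equiv> series_module (series_module M)"

abbreviation series_const2 :: "('k, 'v, 'e) module_scheme \<Rightarrow> 'v \<Rightarrow> nat \<Rightarrow> nat \<Rightarrow> 'v" where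
  "series_const2 M v \<equiv> series_const (series_module M) (series_const M v)"

definition module_iso ::
  "('k, 'v, 'd) module_scheme \<Rightarrow> ('k, 'w, 'e) module_scheme \<Rightarrow> ('v \<Rightarrow> 'w) \<Rightarrow> bool" where
  "module_iso M N \<phi> \<longleftrightarrow>
     bij_betw \<phi> (carrier M) (carrier N) \<and>
     (\<forall>x\<in>carrier M. \<forall>y\<in>carrier M. \<phi> (x \<oplus>\<^bsub>M\<^esub> y) = \<phi> x \<oplus>\<^bsub>N\<^esub> \<phi> y) \<and>
     (\<forall>c. \<forall>x\<in>carrier M. \<phi> (c \<odot>\<^bsub>M\<^esub> x) = c \<odot>\<^bsub>N\<^esub> \<phi> x)"

text \<open>
  The identification of \<open>M\<close> with \<open>N\<close> that matches two (topological) bases. A linear map between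
  modules of formal power series is automatically continuous for the adic topologies, so that
  \<open>\<phi>\<close> is determined by its values on a topological basis.
\<close>
definition identification ::
  "('k, 'v, 'd) module_scheme \<Rightarrow> ('i \<Rightarrow> 'v) \<Rightarrow> ('k, 'w, 'e) module_scheme \<Rightarrow> ('i \<Rightarrow> 'w) \<Rightarrow>
   ('v \<Rightarrow> 'w) \<Rightarrow> bool" where
  "identification M b N b' \<phi> \<longleftrightarrow> module_iso M N \<phi> \<and> (\<forall>i. \<phi> (b i) = b' i)"


section \<open>Representations and their deformations\<close>

definition representation ::
  "('k::comm_ring_1, 'u) sl2_algebra \<Rightarrow> ('k, 'm) module \<Rightarrow> ('u \<Rightarrow> 'm \<Rightarrow> 'm) \<Rightarrow> bool" where
  "representation U M act \<longleftrightarrow>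
     module type_ring M \<and>
     (\<forall>u\<in>carrier U. \<forall>x\<in>carrier M. act u x \<in> carrier M) \<and>
     (\<forall>u\<in>carrier U. \<forall>x\<in>carrier M. \<forall>y\<in>carrier M. act u (x \<oplus>\<^bsub>M\<^esub> y) = act u x \<oplus>\<^bsub>M\<^esub> act u y) \<and>
     (\<forall>u\<in>carrier U. \<forall>c. \<forall>x\<in>carrier M. act u (c \<odot>\<^bsub>M\<^esub> x) = c \<odot>\<^bsub>M\<^esub> act u x) \<and>
     (\<forall>u\<in>carrier U. \<forall>w\<in>carrier U. \<forall>x\<in>carrier M.
        act (u \<oplus>\<^bsub>U\<^esub> w) x = act u x \<oplus>\<^bsub>M\<^esub> act w x) \<and>
     (\<forall>c. \<forall>u\<in>carrier U. \<forall>x\<in>carrier M. act (c \<odot>\<^bsub>U\<^esub> u) x = c \<odot>\<^bsub>M\<^esub> act u x) \<and>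
     (\<forall>u\<in>carrier U. \<forall>w\<in>carrier U. \<forall>x\<in>carrier M. act (u \<otimes>\<^bsub>U\<^esub> w) x = act u (act w x)) \<and>
     (\<forall>x\<in>carrier M. act \<one>\<^bsub>U\<^esub> x = x)"

definition finite_dimensional :: "(complex, 'v) module \<Rightarrow> bool" where
  "finite_dimensional V \<longleftrightarrow>
     (\<exists>S. finite S \<and> S \<subseteq> carrier V \<and>
        (\<forall>x\<in>carrier V. \<exists>c. x = (\<Oplus>\<^bsub>V\<^esub>s\<in>S. c s \<odot>\<^bsub>V\<^esub> s)))"

text \<open>A representation on a module \<open>M\<close> isomorphic to \<open>V[[h,h']]\<close>, with \<open>dim V = \<infinity>\<close>.\<close>
definition infinite_rank_representation ::
  "(complex fps fps, 'u) sl2_algebra \<Rightarrow> (complex fps fps, 'm) module \<Rightarrow> ('u \<Rightarrow> 'm \<Rightarrow> 'm) \<Rightarrow>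
   (complex, 'v) module \<Rightarrow> bool" where
  "infinite_rank_representation U M act V \<longleftrightarrow>
     representation U M act \<and> module type_ring V \<and>
     (\<exists>\<phi>. module_iso (series_module2 V) M \<phi>) \<and> \<not> finite_dimensional V"

text \<open>
  The representation \<open>act\<close> of \<open>U\<close> on \<open>M\<close> is a formal deformation along \<open>h,h'\<close> of the representation
  \<open>act0\<close> of \<open>U0\<close> on \<open>V\<close>, relative to identifications \<open>\<theta>\<close> of \<open>U0[[h,h']]\<close> with \<open>U\<close> and \<open>\<phi>\<close> of
  \<open>V[[h,h']]\<close> with \<open>M\<close>: modulo \<open>(h,h')\<close> it induces \<open>act0\<close>.
\<close>
definition deformation_along_hh' ::
  "(complex, 'a) sl2_algebra \<Rightarrow> (complex, 'v) module \<Rightarrow> ('a \<Rightarrow> 'v \<Rightarrow> 'v) \<Rightarrow>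
   (complex fps fps, 'u) sl2_algebra \<Rightarrow> (complex fps fps, 'm) module \<Rightarrow> ('u \<Rightarrow> 'm \<Rightarrow> 'm) \<Rightarrow>
   ((nat \<Rightarrow> nat \<Rightarrow> 'a) \<Rightarrow> 'u) \<Rightarrow> ((nat \<Rightarrow> nat \<Rightarrow> 'v) \<Rightarrow> 'm) \<Rightarrow> bool" where
  "deformation_along_hh' U0 V act0 U M act \<theta> \<phi> \<longleftrightarrow>
     representation U0 V act0 \<and> representation U M act \<and>
     (\<forall>f\<in>carrier (series_module2 U0). \<forall>v\<in>carrier (series_module2 V).
        \<exists>w\<in>carrier (series_module2 V).
          act (\<theta> f) (\<phi> v) = \<phi> w \<and> w 0 0 = act0 (f 0 0) (v 0 0))"

text \<open>The same along \<open>h'\<close> only, with \<open>U0\<close> and \<open>V\<close> over \<open>\<complex>[[h]]\<close>.\<close>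
definition deformation_along_h' ::
  "(complex fps, 'a) sl2_algebra \<Rightarrow> (complex fps, 'v) module \<Rightarrow> ('a \<Rightarrow> 'v \<Rightarrow> 'v) \<Rightarrow>
   (complex fps fps, 'u) sl2_algebra \<Rightarrow> (complex fps fps, 'm) module \<Rightarrow> ('u \<Rightarrow> 'm \<Rightarrow> 'm) \<Rightarrow>
   ((nat \<Rightarrow> 'a) \<Rightarrow> 'u) \<Rightarrow> ((nat \<Rightarrow> 'v) \<Rightarrow> 'm) \<Rightarrow> bool" where
  "deformation_along_h' U0 V act0 U M act \<theta> \<phi> \<longleftrightarrow>
     representation U0 V act0 \<and> representation U M act \<and>
     (\<forall>f\<in>carrier (series_module U0). \<forall>v\<in>carrier (series_module V).
        \<exists>w\<in>carrier (series_module V).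
          act (\<theta> f) (\<phi> v) = \<phi> w \<and> w 0 = act0 (f 0) (v 0))"


section \<open>Topological bases and weight representations\<close>

text \<open>The submodule \<open>(h,h')\<^sup>N M\<close>.\<close>
definition adic_submodule :: "(complex fps fps, 'm) module \<Rightarrow> nat \<Rightarrow> 'm set" where
  "adic_submodule M N =
     {\<Oplus>\<^bsub>M\<^esub>a\<in>{..N}. (hbar ^ a * hbar' ^ (N - a)) \<odot>\<^bsub>M\<^esub> x a | x. \<forall>a. x a \<in> carrier M}"

definition adic_has_sum ::
  "(complex fps fps, 'm) module \<Rightarrow> ('i \<Rightarrow> 'm) \<Rightarrow> 'm \<Rightarrow> bool" where
  "adic_has_sum M f x \<longleftrightarrow>
     (\<forall>N. \<exists>F. finite F \<and>
        (\<forall>S. finite S \<and> F \<subseteq> S \<longrightarrow> x \<ominus>\<^bsub>M\<^esub> (\<Oplus>\<^bsub>M\<^esub>i\<in>S. f i) \<in> adic_submodule M N))"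

definition topological_basis :: "(complex fps fps, 'm) module \<Rightarrow> ('i \<Rightarrow> 'm) \<Rightarrow> bool" where
  "topological_basis M b \<longleftrightarrow>
     (\<forall>i. b i \<in> carrier M) \<and>
     (\<forall>x\<in>carrier M. \<exists>!c. adic_has_sum M (\<lambda>i. c i \<odot>\<^bsub>M\<^esub> b i) x)"

definition weight_space ::
  "(complex fps fps, 'u) sl2_algebra \<Rightarrow> (complex fps fps, 'm) module \<Rightarrow> ('u \<Rightarrow> 'm \<Rightarrow> 'm) \<Rightarrow>
   int \<Rightarrow> 'm set" where
  "weight_space U M act m = {x \<in> carrier M. act (Hw U) x = of_int m \<odot>\<^bsub>M\<^esub> x}"

text \<open>
  The direct sum is the one of topological modules, that is the adic completion of the algebraic
  direct sum: every element is in a unique way the sum of an adically summable family of weight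
  vectors. For infinite rank the algebraic direct sum is a proper submodule: it does not contain
  \<open>\<Sum>\<^sub>j h\<^sup>j m\<^sub>j\<close> in the case of a Verma module. For finite rank there is no difference.
\<close>
definition weight_representation ::
  "(complex fps fps, 'u) sl2_algebra \<Rightarrow> (complex fps fps, 'm) module \<Rightarrow> ('u \<Rightarrow> 'm \<Rightarrow> 'm) \<Rightarrow> bool" where
  "weight_representation U M act \<longleftrightarrow>
     representation U M act \<and>
     (\<forall>x\<in>carrier M. \<exists>!f. (\<forall>m. f m \<in> weight_space U M act m) \<and> adic_has_sum M f x)"

end

theory Submission
  imports Defs "HOL-Library.Product_Plus"
begin

text \<open>
  Everything is reduced to one explicit model. Let \<open>V\<close> be the complex vector space with basis
  \<open>m\<^sub>0, m\<^sub>1, \<dots>\<close>. The formulas \<open>H m\<^sub>k = (n - 2k) m\<^sub>k\<close>, \<open>C m\<^sub>k = (n + 1)\<^sup>2 m\<^sub>k\<close>,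
  \<open>X\<^sup>- m\<^sub>k = m\<^bsub>k+1\<^esub>\<close>, \<open>X\<^sup>+ m\<^sub>k = [k] [n-k+1] m\<^bsub>k-1\<^esub>\<close> let the free algebra over \<open>\<complex>[[h,h']]\<close> act on
  \<open>V[[h,h']]\<close>. They respect the defining relations: at the weight \<open>n - 2k\<close> and for \<open>\<surd>C = n + 1\<close>
  the numbers \<open>H\<^sub>e\<^sup>+\<close> are \<open>n - k\<close> and \<open>k + 1\<close>, and the numbers \<open>H\<^sub>e\<^sup>-\<close> are \<open>n - k + 1\<close> and \<open>k\<close>, so that the
  right-hand sides of the relations are the eigenvalues of \<open>X\<^sup>+ X\<^sup>-\<close> and \<open>X\<^sup>- X\<^sup>+\<close>
  (\<open>R4_kills_relations\<close>). That \<open>\<surd>C\<close> may be given a value at all uses that the product over \<open>e\<close> is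
  even in \<open>\<surd>C\<close> (\<open>XX_series_even\<close>), which comes from \<open>P(u) = P(u\<inverse>)\<close>.

  The action shows that the presented algebra is large enough; it is small enough because of the
  ordered monomials \<open>(X\<^sup>-)\<^sup>a H\<^sup>b (X\<^sup>+)\<^sup>c\<close>. Modulo \<open>(h,h')\<close> the relations are those of \<open>U(sl\<^sub>2)\<close>
  together with \<open>C = 4 X\<^sup>- X\<^sup>+ + (H + 1)\<^sup>2\<close>, and reordering shows that the monomials span
  (\<open>span_U\<close>, \<open>span_Uhh\<close>). By successive approximation every series is then a series in the ordered
  monomials up to the closed ideal (\<open>complement_lift1\<close>, \<open>complement_lift2\<close>). They are independent:
  the lowest coefficient of a relation between them would be a relation on all
  classical Verma modules \<open>M(n)\<close>, \<open>n \<in> \<int>\<close>, and there is none (\<open>adic_ext_separates\<close>,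
  \<open>pbw_independent_on_vermas\<close>).

  Hence the algebra is \<open>\<Lambda>[[h,h']]\<close> for the span \<open>\<Lambda>\<close> of the ordered monomials, and the map
  \<open>f \<mapsto> f m\<^sub>0\<close> identifies \<open>M\<^bsup>h,h'\<^esup>(n,g)\<close> with \<open>V[[h,h']]\<close>: its kernel is exactly the left ideal
  that defines the Verma module, because every ordered monomial is a power of \<open>X\<^sup>-\<close> modulo the
  left multiples of \<open>X\<^sup>+\<close> and \<open>H - n\<close> (\<open>pbw_lin_split\<close>, \<open>verma_ideal_iff\<close>). The formulas for the
  action, the weight decomposition and the topological basis can be read off from the model.

  The same construction applies to \<open>U\<close> and \<open>U\<^sub>h\<close> with the coefficients \<open>[k] [n-k+1]\<close> reduced modulo
  \<open>(h,h')\<close> and modulo \<open>h'\<close>; for \<open>U\<^sub>h\<close> this rests on the identity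
  \<open>[k+1] [n-k] - [k] [n-k+1] = sinh (h(n-2k)) / sinh h\<close> modulo \<open>h'\<close> (\<open>ladder_sinh_quot\<close>). As the
  three models are reductions of one another, so are the actions, which is what a deformation is.
\<close>


section \<open>Coefficientwise maps and scalars\<close>

locale ring_morphism =
  fixes \<phi> :: "'a::ring_1 \<Rightarrow> 'b::ring_1"
  assumes add: "\<phi> (a + b) = \<phi> a + \<phi> b"
    and mult: "\<phi> (a * b) = \<phi> a * \<phi> b"
    and one: "\<phi> 1 = 1"
begin

lemma additive: "Modules.additive \<phi>"
  by unfold_locales (rule add)

lemma zero: "\<phi> 0 = 0"
  using Modules.additive.zero[OF additive] .

lemma uminus: "\<phi> (- a) = - \<phi> a"
  using Modules.additive.minus[OF additive] .

lemma diff: "\<phi> (a - b) = \<phi> a - \<phi> b"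
  using Modules.additive.diff[OF additive] .

lemma sum: "\<phi> (sum f A) = (\<Sum>x\<in>A. \<phi> (f x))"
  using Modules.additive.sum[OF additive] .

lemma power: "\<phi> (a ^ k) = \<phi> a ^ k"
  by (induction k) (simp_all add: one mult)

lemma of_nat: "\<phi> (of_nat k) = of_nat k"
  by (induction k) (simp_all add: zero one add)

lemma of_int: "\<phi> (of_int k) = of_int k"
  by (cases k) (simp_all add: of_nat uminus one add diff)

lemma numeral: "\<phi> (numeral k) = numeral k"
  using of_nat[of "numeral k"] by simp

lemmas hom_simps = add mult one zero uminus diff sum power of_nat of_int numeral

end

lemma ring_morphism_prod:
  fixes \<phi> :: "'a::comm_ring_1 \<Rightarrow> 'b::comm_ring_1"
  assumes "ring_morphism \<phi>"
  shows "\<phi> (prod f A) = (\<Prod>x\<in>A. \<phi> (f x))"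
proof -
  interpret ring_morphism \<phi> by fact
  show ?thesis by (induction A rule: infinite_finite_induct) (simp_all add: one mult)
qed

text \<open>
  The structure map of an algebra over \<open>'k\<close>. Free modules are also given by such a map: a type of
  finitely supported families is a ring as soon as its index set is a monoid, and the scalars act
  by multiplication with the families supported at \<open>0\<close>. This spares a separate notion of vector space.
\<close>

locale central_hom = ring_morphism \<phi> for \<phi> :: "'k::comm_ring_1 \<Rightarrow> 'a::ring_1" +
  assumes central: "\<phi> c * f = f * \<phi> c"

definition fps_map :: "('a \<Rightarrow> 'b) \<Rightarrow> 'a fps \<Rightarrow> 'b fps" where
  "fps_map \<phi> f = Abs_fps (\<lambda>n. \<phi> (f $ n))"

lemma fps_map_nth [simp]: "fps_map \<phi> f $ n = \<phi> (f $ n)"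
  by (simp add: fps_map_def)

lemma fps_map_const: "\<phi> 0 = 0 \<Longrightarrow> fps_map \<phi> (fps_const a) = fps_const (\<phi> a)"
  by (auto simp: fps_eq_iff)

lemma additive_fps_map: "Modules.additive \<phi> \<Longrightarrow> Modules.additive (fps_map \<phi>)"
  by unfold_locales (simp add: fps_eq_iff additive.add)

lemma ring_morphism_fps_map: "ring_morphism \<phi> \<Longrightarrow> ring_morphism (fps_map \<phi>)"
  by unfold_locales (auto simp: fps_eq_iff fps_mult_nth fps_one_nth ring_morphism.hom_simps)

lemma ring_morphism_fps_const: "ring_morphism fps_const"
  by unfold_locales auto

lemma ring_morphism_fps_nth_0: "ring_morphism (\<lambda>f. f $ 0)"
  by unfold_locales auto

lemma ring_morphism_comp:
  "ring_morphism \<phi> \<Longrightarrow> ring_morphism \<psi> \<Longrightarrow> ring_morphism (\<lambda>x. \<phi> (\<psi> x))"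
  by unfold_locales (simp_all add: ring_morphism.hom_simps)

lemma ring_morphism_id: "ring_morphism (\<lambda>x. x)"
  by unfold_locales auto

lemma central_hom_fps_map:
  assumes "central_hom \<iota>"
  shows "central_hom (fps_map \<iota>)"
proof -
  interpret central_hom \<iota> by fact
  interpret m: ring_morphism "fps_map \<iota>" by (rule ring_morphism_fps_map) unfold_locales
  show ?thesis
  proof unfold_locales
    fix c :: "'a fps" and f :: "'b fps"
    show "fps_map \<iota> c * f = f * fps_map \<iota> c"
    proof (rule fps_ext)
      fix n
      have "(fps_map \<iota> c * f) $ n = (\<Sum>i=0..n. f $ (n - i) * \<iota> (c $ i))"
        unfolding fps_mult_nth fps_map_nth by (intro sum.cong refl central)
      also have "\<dots> = (\<Sum>i=0..n. f $ i * \<iota> (c $ (n - i)))"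
        by (rule sum.reindex_bij_witness[of _ "\<lambda>i. n - i" "\<lambda>i. n - i"]) auto
      finally show "(fps_map \<iota> c * f) $ n = (f * fps_map \<iota> c) $ n"
        by (simp add: fps_mult_nth)
    qed
  qed
qed

lemma central_hom_fps_const:
  assumes "central_hom \<iota>"
  shows "central_hom (\<lambda>c. fps_const (\<iota> c))"
proof -
  interpret central_hom \<iota> by fact
  show ?thesis
  proof unfold_locales
    show "fps_const (\<iota> c) * f = f * fps_const (\<iota> c)" for c f
      by (rule fps_ext) (simp, rule central)
  qed (simp_all add: add mult one)
qed

lemma fps_map_scalar:
  assumes "Modules.additive P" and "\<And>c f. P (\<iota> c * f) = \<iota>' c * P f"
  shows "fps_map P (fps_map \<iota> c * f) = fps_map \<iota>' c * fps_map P f"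
  by (simp add: fps_eq_iff fps_mult_nth additive.sum[OF assms(1)] assms(2))


section \<open>Quotients of a ring and their Verma modules\<close>

lemma type_ring_simps [simp]:
  "carrier type_ring = UNIV" "mult type_ring = (*)" "one type_ring = 1"
  "zero type_ring = 0" "add type_ring = (+)"
  by (simp_all add: type_ring_def)

lemma ring_type_ring: "ring (type_ring :: 'a::ring_1 ring)"
proof (rule ringI)
  show "abelian_group (type_ring :: 'a ring)"
    by (rule abelian_groupI) (auto simp: add_ac intro!: exI[of _ "- x" for x :: 'a])
  show "monoid (type_ring :: 'a ring)"
    by (rule monoidI) (auto simp: mult.assoc)
qed (auto simp: algebra_simps)

lemma cring_type_ring: "cring (type_ring :: 'a::comm_ring_1 ring)"
proof (rule cringI)
  show "abelian_group (type_ring :: 'a ring)"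
    by (rule abelian_groupI) (auto simp: add_ac intro!: exI[of _ "- x" for x :: 'a])
  show "comm_monoid (type_ring :: 'a ring)"
    by (rule comm_monoidI) (auto simp: mult_ac)
qed (auto simp: algebra_simps)

lemma type_ring_a_inv [simp]: "\<ominus>\<^bsub>type_ring\<^esub> a = - a"
proof -
  interpret ring "type_ring :: 'a ring" by (rule ring_type_ring)
  show ?thesis by (rule minus_equality) auto
qed

lemma ideal_type_ring_iff:
  "ideal I (type_ring :: 'a::ring_1 ring) \<longleftrightarrow>
     0 \<in> I \<and> (\<forall>a\<in>I. \<forall>b\<in>I. a - b \<in> I) \<and> (\<forall>a\<in>I. \<forall>r. r * a \<in> I \<and> a * r \<in> I)"
proof
  assume "ideal I (type_ring :: 'a ring)"
  then interpret ideal I "type_ring :: 'a ring" .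
  have neg: "- b \<in> I" if "b \<in> I" for b using additive_subgroup.a_inv_closed[OF is_additive_subgroup that] by simp
  have add: "a + b \<in> I" if "a \<in> I" "b \<in> I" for a b using additive_subgroup.a_closed[OF is_additive_subgroup that] by simp
  show "0 \<in> I \<and> (\<forall>a\<in>I. \<forall>b\<in>I. a - b \<in> I) \<and> (\<forall>a\<in>I. \<forall>r. r * a \<in> I \<and> a * r \<in> I)"
    using additive_subgroup.zero_closed[OF is_additive_subgroup] I_l_closed I_r_closed add[OF _ neg] by (auto simp del: add_uminus_conv_diff simp: diff_conv_add_uminus)
next
  assume *: "0 \<in> I \<and> (\<forall>a\<in>I. \<forall>b\<in>I. a - b \<in> I) \<and> (\<forall>a\<in>I. \<forall>r. r * a \<in> I \<and> a * r \<in> I)"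
  interpret ring "type_ring :: 'a ring" by (rule ring_type_ring)
  have neg: "- b \<in> I" if "b \<in> I" for b using * that by (metis diff_0)
  have add: "a + b \<in> I" if "a \<in> I" "b \<in> I" for a b
    using * that neg by (metis diff_minus_eq_add)
  show "ideal I (type_ring :: 'a ring)"
  proof (rule idealI)
    show "ring (type_ring :: 'a ring)" by (rule ring_type_ring)
    show "subgroup I (add_monoid (type_ring :: 'a ring))"
      by (rule add.subgroupI) (use * neg add in \<open>auto simp: a_inv_def[symmetric]\<close>)
  qed (use * in auto)
qed

lemma ideal_type_ringD:
  assumes "ideal I (type_ring :: 'a::ring_1 ring)"
  shows "0 \<in> I" "a \<in> I \<Longrightarrow> b \<in> I \<Longrightarrow> a - b \<in> I" "a \<in> I \<Longrightarrow> b \<in> I \<Longrightarrow> a + b \<in> I"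
    "a \<in> I \<Longrightarrow> r * a \<in> I" "a \<in> I \<Longrightarrow> a * r \<in> I" "a \<in> I \<Longrightarrow> - a \<in> I"
proof -
  have *: "0 \<in> I" "\<And>a b. a \<in> I \<Longrightarrow> b \<in> I \<Longrightarrow> a - b \<in> I"
    using assms by (auto simp: ideal_type_ring_iff)
  show "0 \<in> I" "a \<in> I \<Longrightarrow> b \<in> I \<Longrightarrow> a - b \<in> I" "a \<in> I \<Longrightarrow> r * a \<in> I" "a \<in> I \<Longrightarrow> a * r \<in> I"
    using assms by (auto simp: ideal_type_ring_iff)
  have neg: "- a \<in> I" if "a \<in> I" for a using *(2)[OF *(1) that] by simp
  show "a \<in> I \<Longrightarrow> - a \<in> I" by (rule neg)
  show "a \<in> I \<Longrightarrow> b \<in> I \<Longrightarrow> a + b \<in> I" using *(2)[of a "- b"] neg[of b] by simp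
qed

lemma ring_morphism_kernel_ideal:
  "ring_morphism \<phi> \<Longrightarrow> ideal {a. \<phi> a = 0} type_ring"
  by (auto simp: ideal_type_ring_iff ring_morphism.hom_simps)

lemma ring_morphism_image_ideal:
  assumes "ring_morphism \<phi>" "surj \<phi>" "ideal I type_ring"
  shows "ideal (\<phi> ` I) type_ring"
proof -
  interpret ring_morphism \<phi> by fact
  note I = ideal_type_ringD[OF assms(3)]
  show ?thesis unfolding ideal_type_ring_iff
  proof (intro conjI ballI allI)
    show "0 \<in> \<phi> ` I" using I(1) zero by (metis image_eqI)
  next
    fix a b assume "a \<in> \<phi> ` I" "b \<in> \<phi> ` I"
    then show "a - b \<in> \<phi> ` I" using I(2) by (auto simp flip: diff)
  next
    fix a r assume "a \<in> \<phi> ` I"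
    moreover obtain s where "r = \<phi> s" using assms(2) by (metis surjD)
    ultimately show "r * a \<in> \<phi> ` I" "a * r \<in> \<phi> ` I"
      using I(4,5) by (auto simp flip: mult)
  qed
qed

lemma genideal_type_ring:
  fixes S :: "'a::ring_1 set"
  shows "ideal (Idl\<^bsub>type_ring\<^esub> S) type_ring" "S \<subseteq> Idl\<^bsub>type_ring\<^esub> S"
    "ideal J type_ring \<Longrightarrow> S \<subseteq> J \<Longrightarrow> Idl\<^bsub>type_ring\<^esub> S \<subseteq> J"
proof -
  interpret ring "type_ring :: 'a ring" by (rule ring_type_ring)
  show "ideal (Idl\<^bsub>type_ring\<^esub> S) type_ring" "S \<subseteq> Idl\<^bsub>type_ring\<^esub> S"
    "ideal J type_ring \<Longrightarrow> S \<subseteq> J \<Longrightarrow> Idl\<^bsub>type_ring\<^esub> S \<subseteq> J"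
    using genideal_ideal[of S] genideal_minimal[of J S] genideal_self[of S] by simp_all
qed

text \<open>
  The quotient of a ring by an ideal, as in \<^const>\<open>quotient_algebra\<close>. Computations in it and in its
  Verma modules are done with representatives in the ring: \<open>cls f\<close> is the class of \<open>f\<close>
  in the algebra, and \<open>vcls n f\<close> is the class of \<open>f\<close> in the Verma module, that is \<open>f m\<^sub>0\<close>.
\<close>

locale presentation =
  scalars: central_hom \<iota> for \<iota> :: "'k::comm_ring_1 \<Rightarrow> 'a::ring_1" +
  fixes I :: "'a set" and x y h :: 'a
  assumes I_ideal: "ideal I type_ring"
begin

lemmas I_closed = ideal_type_ringD[OF I_ideal]

abbreviation U :: "('k, 'a set) sl2_algebra" where
  "U \<equiv> quotient_algebra \<iota> I x y h"

definition cls :: "'a \<Rightarrow> 'a set" where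
  "cls f = I +>\<^bsub>type_ring\<^esub> f"

lemma mem_cls: "g \<in> cls f \<longleftrightarrow> g - f \<in> I"
  unfolding cls_def a_r_coset_def' by (auto intro: bexI[of _ "g - f"])

lemma cls_eq_iff: "cls f = cls g \<longleftrightarrow> f - g \<in> I"
proof
  assume "cls f = cls g"
  moreover have "f \<in> cls f" by (simp add: mem_cls I_closed)
  ultimately show "f - g \<in> I" by (simp add: mem_cls)
next
  assume *: "f - g \<in> I"
  have "a - f \<in> I \<longleftrightarrow> a - g \<in> I" for a
    using I_closed(3)[of "a - f" "f - g"] I_closed(2)[of "a - g" "f - g"] *
    by (auto simp: algebra_simps)
  then show "cls f = cls g" by (auto simp: mem_cls)
qed

lemma U_carrier: "carrier U = range cls"
  by (auto simp: quotient_algebra_def FactRing_def A_RCOSETS_def' cls_def a_r_coset_def' Let_def)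

lemma cls_carrier [simp]: "cls f \<in> carrier U"
  by (simp add: U_carrier)

lemma U_zero: "\<zero>\<^bsub>U\<^esub> = cls 0"
  by (auto simp: quotient_algebra_def FactRing_def cls_def a_r_coset_def' Let_def)

lemma U_one: "\<one>\<^bsub>U\<^esub> = cls 1"
  by (simp add: quotient_algebra_def FactRing_def cls_def Let_def)

lemma U_add: "cls f \<oplus>\<^bsub>U\<^esub> cls g = cls (f + g)"
proof -
  have "\<exists>i\<in>I. \<exists>j\<in>I. i + f + (j + g) = a" if "a - (f + g) \<in> I" for a
    by (rule bexI[OF _ that], rule bexI[OF _ I_closed(1)]) simp
  moreover have "i + f + (j + g) - (f + g) \<in> I" if "i \<in> I" "j \<in> I" for i j
    using I_closed(3)[OF that] by (simp add: algebra_simps)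
  ultimately have "a \<in> cls f \<oplus>\<^bsub>U\<^esub> cls g \<longleftrightarrow> a \<in> cls (f + g)" for a
    unfolding mem_cls
    by (force simp: quotient_algebra_def FactRing_def cls_def a_r_coset_def' set_add_def' Let_def)
  then show ?thesis by blast
qed

lemma U_mult: "cls f \<otimes>\<^bsub>U\<^esub> cls g = cls (f * g)"
proof -
  interpret ideal I type_ring by (rule I_ideal)
  show ?thesis
    using rcoset_mult_add[of f g]
    by (simp add: quotient_algebra_def FactRing_def cls_def Let_def)
qed

lemma U_smult: "c \<odot>\<^bsub>U\<^esub> cls f = cls (\<iota> c * f)"
  using U_mult[of "\<iota> c" f]
  by (simp add: quotient_algebra_def cls_def Let_def)

lemma U_generators: "Xp U = cls x" "Xm U = cls y" "Hw U = cls h"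
  by (simp_all add: quotient_algebra_def cls_def Let_def)

lemma abelian_group_U: "abelian_group U"
proof (rule abelian_groupI)
  show "\<exists>b\<in>carrier U. b \<oplus>\<^bsub>U\<^esub> a = \<zero>\<^bsub>U\<^esub>" if "a \<in> carrier U" for a
  proof -
    from that obtain f where "a = cls f" by (auto simp: U_carrier)
    then show ?thesis by (intro bexI[of _ "cls (- f)"]) (simp_all add: U_add U_zero)
  qed
qed (auto simp: U_carrier U_add U_zero add_ac)

lemma ring_U: "ring U"
proof (rule ringI)
  show "monoid U"
    by (rule monoidI) (auto simp: U_carrier U_mult U_one mult.assoc)
qed (auto simp: abelian_group_U U_carrier U_mult U_add algebra_simps)

lemma U_minus: "cls f \<ominus>\<^bsub>U\<^esub> cls g = cls (f - g)"
proof -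
  interpret ring U by (rule ring_U)
  have "\<ominus>\<^bsub>U\<^esub> cls g = cls (- g)"
    by (rule minus_equality) (auto simp: U_add U_zero)
  then show ?thesis by (simp add: a_minus_def U_add)
qed

lemma U_pow: "cls f [^]\<^bsub>U\<^esub> (k::nat) = cls (f ^ k)"
proof -
  interpret ring U by (rule ring_U)
  show ?thesis by (induction k) (simp_all add: U_one U_mult power_commutes)
qed

lemma U_pbw: "pbw U (a, b, c) = cls (y ^ a * h ^ b * x ^ c)"
  by (simp add: pbw_def U_generators U_pow U_mult)

text \<open>The preimage of \<^const>\<open>verma_sub\<close> in the ring that is being divided.\<close>

definition verma_ideal :: "int \<Rightarrow> 'a set" where
  "verma_ideal n = {f. \<exists>a b. f - (a * x + b * (h - \<iota> (of_int n))) \<in> I}"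

lemma verma_idealI: "f - (a * x + b * (h - \<iota> (of_int n))) \<in> I \<Longrightarrow> f \<in> verma_ideal n"
  by (auto simp: verma_ideal_def)

lemma verma_ideal_closed:
  "0 \<in> verma_ideal n"
  "f \<in> verma_ideal n \<Longrightarrow> g \<in> verma_ideal n \<Longrightarrow> f - g \<in> verma_ideal n"
  "f \<in> verma_ideal n \<Longrightarrow> r * f \<in> verma_ideal n"
  "f \<in> I \<Longrightarrow> f \<in> verma_ideal n"
proof -
  show "0 \<in> verma_ideal n"
    using I_closed(1) by (intro verma_idealI[of _ 0 0]) simp
  show "f \<in> I \<Longrightarrow> f \<in> verma_ideal n"
    by (intro verma_idealI[of _ 0 0]) simp
  let ?k = "h - \<iota> (of_int n)"
  show "f - g \<in> verma_ideal n" if fg: "f \<in> verma_ideal n" "g \<in> verma_ideal n"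
  proof -
    from fg obtain a b a' b'
      where *: "f - (a * x + b * ?k) \<in> I" "g - (a' * x + b' * ?k) \<in> I"
      by (auto simp: verma_ideal_def)
    have "f - g - ((a - a') * x + (b - b') * ?k) \<in> I"
      using I_closed(2)[OF *] by (simp add: algebra_simps)
    then show ?thesis by (rule verma_idealI)
  qed
  show "r * f \<in> verma_ideal n" if f: "f \<in> verma_ideal n"
  proof -
    from f obtain a b where *: "f - (a * x + b * ?k) \<in> I" by (auto simp: verma_ideal_def)
    have "r * f - ((r * a) * x + (r * b) * ?k) \<in> I"
      using I_closed(4)[OF *, of r] by (simp add: algebra_simps)
    then show ?thesis by (rule verma_idealI)
  qed
qed

lemma verma_ideal_closed':
  "f \<in> verma_ideal n \<Longrightarrow> - f \<in> verma_ideal n"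
  "f \<in> verma_ideal n \<Longrightarrow> g \<in> verma_ideal n \<Longrightarrow> f + g \<in> verma_ideal n"
proof -
  show neg: "- f \<in> verma_ideal n" if "f \<in> verma_ideal n" for f
    using verma_ideal_closed(2)[OF verma_ideal_closed(1) that] by simp
  show "f \<in> verma_ideal n \<Longrightarrow> g \<in> verma_ideal n \<Longrightarrow> f + g \<in> verma_ideal n"
    using verma_ideal_closed(2)[of f n "- g"] neg[of g] by simp
qed

lemma verma_sub_eq: "verma_sub U n = cls ` verma_ideal n"
proof
  show "verma_sub U n \<subseteq> cls ` verma_ideal n"
  proof
    fix u assume "u \<in> verma_sub U n"
    then obtain a b where "u = cls a \<otimes>\<^bsub>U\<^esub> Xp U \<oplus>\<^bsub>U\<^esub> cls b \<otimes>\<^bsub>U\<^esub> (Hw U \<ominus>\<^bsub>U\<^esub> (of_int n \<odot>\<^bsub>U\<^esub> \<one>\<^bsub>U\<^esub>))"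
      by (auto simp: verma_sub_def U_carrier)
    then have "u = cls (a * x + b * (h - \<iota> (of_int n)))"
      by (simp add: U_generators U_one U_smult U_minus U_mult U_add)
    moreover have "a * x + b * (h - \<iota> (of_int n)) \<in> verma_ideal n"
      using I_closed(1) by (intro verma_idealI[of _ a b]) simp
    ultimately show "u \<in> cls ` verma_ideal n" by blast
  qed
  show "cls ` verma_ideal n \<subseteq> verma_sub U n"
  proof
    fix u assume "u \<in> cls ` verma_ideal n"
    then obtain f a b where u: "u = cls f" and *: "f - (a * x + b * (h - \<iota> (of_int n))) \<in> I"
      by (auto simp: verma_ideal_def)
    have "u = cls a \<otimes>\<^bsub>U\<^esub> Xp U \<oplus>\<^bsub>U\<^esub> cls b \<otimes>\<^bsub>U\<^esub> (Hw U \<ominus>\<^bsub>U\<^esub> (of_int n \<odot>\<^bsub>U\<^esub> \<one>\<^bsub>U\<^esub>))"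
      using * unfolding u cls_eq_iff[symmetric]
      by (simp add: U_generators U_one U_smult U_minus U_mult U_add)
    then show "u \<in> verma_sub U n"
      unfolding verma_sub_def using cls_carrier by blast
  qed
qed

definition vcls :: "int \<Rightarrow> 'a \<Rightarrow> 'a set set" where
  "vcls n f = verma_sub U n +>\<^bsub>U\<^esub> cls f"

lemma vcls_eq: "vcls n f = {cls g | g. g - f \<in> verma_ideal n}"
proof -
  have "vcls n f = {cls (a + f) | a. a \<in> verma_ideal n}"
    unfolding vcls_def verma_sub_eq a_r_coset_def' by (auto simp: U_add)
  also have "\<dots> = {cls g | g. g - f \<in> verma_ideal n}"
    by (metis (no_types, opaque_lifting) add_diff_cancel_right' diff_add_cancel)
  finally show ?thesis .
qed

lemma vcls_eq_iff: "vcls n f = vcls n g \<longleftrightarrow> f - g \<in> verma_ideal n"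
proof
  assume "vcls n f = vcls n g"
  moreover have "cls f \<in> vcls n f"
    by (auto simp: vcls_eq verma_ideal_closed intro!: exI[of _ f])
  ultimately obtain a where a: "cls f = cls a" "a - g \<in> verma_ideal n" by (auto simp: vcls_eq)
  then have "f - a \<in> verma_ideal n" by (simp add: cls_eq_iff verma_ideal_closed)
  from verma_ideal_closed'(2)[OF this a(2)] show "f - g \<in> verma_ideal n" by simp
next
  assume *: "f - g \<in> verma_ideal n"
  have "a - f \<in> verma_ideal n \<longleftrightarrow> a - g \<in> verma_ideal n" for a
    using verma_ideal_closed'(2)[of "a - f" n "f - g"] verma_ideal_closed(2)[of "a - g" n "f - g"] *
    by (auto simp: algebra_simps)
  then show "vcls n f = vcls n g" by (simp add: vcls_eq)
qed

lemma verma_carrier: "carrier (verma U n) = range (vcls n)"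
  by (auto simp: verma_def A_RCOSETS_def' U_carrier vcls_def a_r_coset_def')

lemma vcls_carrier [simp]: "vcls n f \<in> carrier (verma U n)"
  by (simp add: verma_carrier)

lemma verma_zero: "\<zero>\<^bsub>verma U n\<^esub> = vcls n 0"
  by (auto simp: verma_def vcls_eq verma_sub_eq)

lemma verma_add: "vcls n f \<oplus>\<^bsub>verma U n\<^esub> vcls n g = vcls n (f + g)"
proof -
  have "vcls n f \<oplus>\<^bsub>verma U n\<^esub> vcls n g =
      {cls a \<oplus>\<^bsub>U\<^esub> cls b | a b. a - f \<in> verma_ideal n \<and> b - g \<in> verma_ideal n}"
    by (auto simp: verma_def set_add_def' vcls_eq)
  also have "\<dots> = vcls n (f + g)"
  proof -
    have "a + b - (f + g) \<in> verma_ideal n"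
      if "a - f \<in> verma_ideal n" "b - g \<in> verma_ideal n" for a b
      using verma_ideal_closed'(2)[OF that] by (simp add: algebra_simps)
    moreover have "\<exists>a b. c = a + b \<and> a - f \<in> verma_ideal n \<and> b - g \<in> verma_ideal n"
      if "c - (f + g) \<in> verma_ideal n" for c
      using that by (intro exI[of _ "c - g"] exI[of _ g]) (simp add: algebra_simps verma_ideal_closed)
    ultimately show ?thesis unfolding vcls_eq U_add by blast
  qed
  finally show ?thesis .
qed

lemma verma_act_vcls: "verma_act U n (cls f) (vcls n g) = vcls n (f * g)"
proof -
  have "vcls n (f * a) = vcls n (f * g)" if "a - g \<in> verma_ideal n" for a
    using verma_ideal_closed(3)[OF that, of f] by (simp add: vcls_eq_iff algebra_simps)
  then have *: "verma_sub U n +>\<^bsub>U\<^esub> (cls f \<otimes>\<^bsub>U\<^esub> cls a) = vcls n (f * g)" if "a - g \<in> verma_ideal n" for a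
    using that by (simp add: U_mult vcls_def)
  have "cls g \<in> vcls n g" by (auto simp: vcls_eq verma_ideal_closed intro!: exI[of _ g])
  then show ?thesis unfolding verma_act_def using * by (auto simp: vcls_eq)
qed

lemma verma_smult: "c \<odot>\<^bsub>verma U n\<^esub> vcls n g = vcls n (\<iota> c * g)"
proof -
  have "c \<odot>\<^bsub>verma U n\<^esub> vcls n g = verma_act U n (cls (\<iota> c)) (vcls n g)"
    by (auto simp: verma_def verma_act_def vcls_eq U_smult U_mult)
  then show ?thesis by (simp add: verma_act_vcls)
qed

lemma verma_vec_eq: "verma_vec U n j = vcls n (y ^ j)"
  by (simp add: verma_vec_def U_generators U_pow U_one vcls_def[symmetric] verma_act_vcls)

lemma module_verma: "module type_ring (verma U n)"
proof (rule moduleI)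
  show "abelian_group (verma U n)"
  proof (rule abelian_groupI)
    show "\<exists>b\<in>carrier (verma U n). b \<oplus>\<^bsub>verma U n\<^esub> a = \<zero>\<^bsub>verma U n\<^esub>"
      if a: "a \<in> carrier (verma U n)" for a
    proof -
      from a obtain f where "a = vcls n f" by (auto simp: verma_carrier)
      then show ?thesis by (intro bexI[of _ "vcls n (- f)"]) (simp_all add: verma_add verma_zero)
    qed
  qed (auto simp: verma_carrier verma_add verma_zero add_ac)
qed (auto simp: cring_type_ring verma_carrier verma_add verma_smult algebra_simps
      scalars.hom_simps)

lemma representation_verma: "representation U (verma U n) (verma_act U n)"
proof -
  have commute: "u * (\<iota> c * w) = \<iota> c * (u * w)" for u c w
    by (metis scalars.central mult.assoc)
  show ?thesis
  unfolding representation_def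
  by (auto simp: module_verma U_carrier verma_carrier verma_act_vcls verma_add verma_smult
      U_add U_smult U_mult U_one distrib_left distrib_right mult.assoc commute)
qed

end

section \<open>Modules in coordinates\<close>

text \<open>
  An isomorphism \<open>\<alpha>\<close> onto \<open>M\<close> of a type on which the scalars act through \<open>\<iota>\<close>. The library's
  sums in \<open>M\<close> become ordinary sums of a type; the module axioms for \<open>M\<close> come for free.
\<close>

locale coordinates =
  scalars: central_hom \<iota> for \<iota> :: "'k::comm_ring_1 \<Rightarrow> 'v::ring_1" +
  fixes M :: "('k, 'm, 'e) module_scheme" and \<alpha> :: "'v \<Rightarrow> 'm"
  assumes bij: "bij_betw \<alpha> UNIV (carrier M)"
    and add: "\<alpha> (v + w) = \<alpha> v \<oplus>\<^bsub>M\<^esub> \<alpha> w"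
    and smult: "\<alpha> (\<iota> c * v) = c \<odot>\<^bsub>M\<^esub> \<alpha> v"
    and zero: "\<alpha> 0 = \<zero>\<^bsub>M\<^esub>"
begin

lemma carrier: "carrier M = range \<alpha>"
  using bij by (auto simp: bij_betw_def)

lemma closed [simp]: "\<alpha> v \<in> carrier M"
  by (simp add: carrier)

lemma eq_iff [simp]: "\<alpha> v = \<alpha> w \<longleftrightarrow> v = w"
  using bij by (auto simp: bij_betw_def inj_on_def)

lemma abelian_group: "abelian_group M"
proof (rule abelian_groupI)
  show "\<exists>b\<in>carrier M. b \<oplus>\<^bsub>M\<^esub> a = \<zero>\<^bsub>M\<^esub>" if a: "a \<in> carrier M" for a
  proof -
    from a obtain f where "a = \<alpha> f" by (auto simp: carrier)
    then show ?thesis by (intro bexI[of _ "\<alpha> (- f)"]) (simp_all flip: add zero)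
  qed
qed (use add zero in \<open>auto simp: carrier add_ac simp flip: add zero\<close>)

lemma minus: "\<alpha> v \<ominus>\<^bsub>M\<^esub> \<alpha> w = \<alpha> (v - w)"
proof -
  interpret abelian_group M by (rule abelian_group)
  have "\<ominus>\<^bsub>M\<^esub> \<alpha> w = \<alpha> (- w)"
    by (rule minus_equality) (auto simp flip: add zero)
  then show ?thesis by (simp add: a_minus_def flip: add)
qed

lemma finsum: "finite A \<Longrightarrow> (\<Oplus>\<^bsub>M\<^esub>i\<in>A. \<alpha> (f i)) = \<alpha> (\<Sum>i\<in>A. f i)"
proof (induction A rule: finite_induct)
  case empty
  interpret abelian_group M by (rule abelian_group)
  show ?case by (simp add: zero)
next
  case (insert a A)
  interpret abelian_group M by (rule abelian_group)
  show ?case using insert by (simp add: finsum_insert Pi_iff add)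
qed

lemma module: "module type_ring M"
  by (rule moduleI)
    (auto simp: cring_type_ring abelian_group carrier scalars.hom_simps algebra_simps
       simp flip: add smult)

text \<open>
  The multiplication of \<open>M[[t]]\<close> by scalars is the Cauchy product, which on the side of the
  coordinates is the product of power series.
\<close>

lemma series: "coordinates (fps_map \<iota>) (series_module M) (\<lambda>F i. \<alpha> (F $ i))"
proof -
  interpret fs: central_hom "fps_map \<iota>" by (rule central_hom_fps_map) unfold_locales
  show ?thesis
  proof unfold_locales
    show "bij_betw (\<lambda>F i. \<alpha> (F $ i)) UNIV (carrier (series_module M))"
      unfolding bij_betw_def
    proof
      show "inj (\<lambda>F i. \<alpha> (F $ i))"
        by (rule injI) (simp add: fun_eq_iff fps_eq_iff)
      have "\<exists>F. f = (\<lambda>i. \<alpha> (F $ i))" if "\<forall>i. f i \<in> carrier M" for f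
      proof -
        have "\<forall>i. \<exists>v. f i = \<alpha> v" using that by (auto simp: carrier)
        then obtain F where "\<forall>i. f i = \<alpha> (F i)" by metis
        then show ?thesis by (intro exI[of _ "Abs_fps F"]) auto
      qed
      then show "range (\<lambda>F i. \<alpha> (F $ i)) = carrier (series_module M)"
        by (auto simp: series_module_def image_iff)
    qed
  qed (auto simp: series_module_def add zero smult[symmetric] finsum fps_mult_nth atLeast0AtMost)
qed

lemma series_const: "series_const M (\<alpha> v) = (\<lambda>i. \<alpha> (fps_const v $ i))"
  by (auto simp: series_const_def zero)

end

lemma coordinatesI:
  assumes "central_hom \<iota>" "inj \<alpha>" "range \<alpha> = carrier M"
    "\<And>v w. \<alpha> (v + w) = \<alpha> v \<oplus>\<^bsub>M\<^esub> \<alpha> w" "\<And>c v. \<alpha> (\<iota> c * v) = c \<odot>\<^bsub>M\<^esub> \<alpha> v" "\<alpha> 0 = \<zero>\<^bsub>M\<^esub>"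
  shows "coordinates \<iota> M \<alpha>"
  using assms by (simp add: coordinates_def coordinates_axioms_def bij_betw_def)

text \<open>
  Both modules are compared with the type of their coordinates. The values at all coordinate
  vectors, not only at a basis, are recorded because the deformation statements speak of them.
\<close>

lemma identification_of_coordinates:
  assumes "coordinates \<iota> M \<alpha>" "coordinates \<iota> N \<beta>"
    "\<And>i. b i = \<alpha> (e i)" "\<And>i. b' i = \<beta> (e i)"
  obtains \<theta> where "identification M b N b' \<theta>" "\<And>v. \<theta> (\<alpha> v) = \<beta> v"
proof -
  interpret M: coordinates \<iota> M \<alpha> by fact
  interpret N: coordinates \<iota> N \<beta> by fact
  define \<theta> where "\<theta> m = \<beta> (inv_into UNIV \<alpha> m)" for m
  have inj: "inj \<alpha>" by (rule injI) simp
  have \<theta>: "\<theta> (\<alpha> v) = \<beta> v" for v by (simp add: \<theta>_def inv_f_f[OF inj])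
  have "module_iso M N \<theta>"
    unfolding module_iso_def
  proof (intro conjI)
    show "bij_betw \<theta> (carrier M) (carrier N)"
      unfolding bij_betw_def M.carrier N.carrier
      by (auto simp: inj_on_def \<theta> image_iff)
  qed (auto simp: M.carrier \<theta> N.add N.smult simp flip: M.add M.smult)
  moreover have "\<theta> (b i) = b' i" for i by (simp add: assms(3,4) \<theta>)
  ultimately show ?thesis using that \<theta> by (auto simp: identification_def)
qed


section \<open>Finitely supported families of complex numbers\<close>

abbreviation "single \<equiv> Poly_Mapping.single"
abbreviation "lookup \<equiv> Poly_Mapping.lookup"
abbreviation "keys \<equiv> Poly_Mapping.keys"

lemma poly_mapping_eq_sum_single:
  "(\<Sum>k\<in>keys f. single k (lookup f k)) = f"
  by (rule poly_mapping_eqI)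
    (simp add: lookup_sum lookup_single when_def in_keys_iff sum.delta' split: if_splits)

lemma additive_eqI_single:
  fixes \<phi> \<psi> :: "('i \<Rightarrow>\<^sub>0 complex) \<Rightarrow> 'v::ab_group_add"
  assumes "Modules.additive \<phi>" "Modules.additive \<psi>"
    and "\<And>k c. \<phi> (single k c) = \<psi> (single k c)"
  shows "\<phi> f = \<psi> f"
proof -
  have "\<phi> (\<Sum>k\<in>keys f. single k (lookup f k)) =
      \<psi> (\<Sum>k\<in>keys f. single k (lookup f k))"
    by (simp only: additive.sum[OF assms(1)] additive.sum[OF assms(2)] assms(3))
  then show ?thesis by (simp add: poly_mapping_eq_sum_single)
qed

abbreviation sc :: "complex \<Rightarrow> ('i::monoid_add \<Rightarrow>\<^sub>0 complex)" where
  "sc \<equiv> single 0"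

lemma sc_mult_single [simp]: "sc c * single k d = single k (c * d)"
  by (simp add: mult_single)

lemma central_hom_sc: "central_hom (sc :: complex \<Rightarrow> ('i::monoid_add \<Rightarrow>\<^sub>0 complex))"
proof unfold_locales
  fix c and f :: "'i \<Rightarrow>\<^sub>0 complex"
  show "sc c * f = f * sc c"
    by (rule additive_eqI_single[of "\<lambda>f. sc c * f" "\<lambda>f. f * sc c"])
      (unfold_locales, auto simp: algebra_simps mult_single)
qed (auto simp: single_add mult_single)

lemma lookup_sc_mult [simp]:
  fixes f :: "'i::monoid_add \<Rightarrow>\<^sub>0 complex"
  shows "lookup (sc c * f) k = c * lookup f k"
  by (rule additive_eqI_single[of "\<lambda>f. lookup (sc c * f) k"])
    (unfold_locales, auto simp: algebra_simps lookup_add lookup_single when_def)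

definition linext :: "(complex \<Rightarrow> 'r::ring_1) \<Rightarrow> ('i \<Rightarrow> 'r) \<Rightarrow> ('i \<Rightarrow>\<^sub>0 complex) \<Rightarrow> 'r" where
  "linext \<iota> b f = (\<Sum>k\<in>keys f. \<iota> (lookup f k) * b k)"

locale complex_scalars = central_hom \<iota> for \<iota> :: "complex \<Rightarrow> 'r::ring_1"
begin

lemma linext_superset:
  "finite A \<Longrightarrow> keys f \<subseteq> A \<Longrightarrow>
     linext \<iota> b f = (\<Sum>k\<in>A. \<iota> (lookup f k) * b k)"
  unfolding linext_def by (rule sum.mono_neutral_left) (auto simp: in_keys_iff zero)

lemma linext_single [simp]: "linext \<iota> b (single k c) = \<iota> c * b k"
  by (subst linext_superset[of "{k}"]) (auto simp: in_keys_iff lookup_single when_def split: if_splits)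

lemma linext_add: "linext \<iota> b (f + f') = linext \<iota> b f + linext \<iota> b f'"
proof -
  let ?A = "keys f \<union> keys f'"
  have "linext \<iota> b p = (\<Sum>k\<in>?A. \<iota> (lookup p k) * b k)"
    if "keys p \<subseteq> ?A" for p
    using that by (intro linext_superset) auto
  then show ?thesis
    using keys_add[of f f'] by (simp add: lookup_add add distrib_right sum.distrib)
qed

lemma additive_linext: "Modules.additive (linext \<iota> b)"
  by unfold_locales (rule linext_add)

lemma linext_scalar:
  fixes f :: "'i::monoid_add \<Rightarrow>\<^sub>0 complex"
  shows "linext \<iota> b (sc c * f) = \<iota> c * linext \<iota> b f"
  by (rule additive_eqI_single[of "\<lambda>f. linext \<iota> b (sc c * f)" "\<lambda>f. \<iota> c * linext \<iota> b f"])
    (unfold_locales, simp_all add: distrib_left linext_add mult mult.assoc)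

lemma ring_morphism_linext:
  fixes b :: "'i::monoid_add \<Rightarrow> 'r"
  assumes b0: "b 0 = 1" and b_add: "\<And>i j. b (i + j) = b i * b j"
  shows "ring_morphism (linext \<iota> b)"
proof unfold_locales
  fix f f' :: "'i \<Rightarrow>\<^sub>0 complex"
  show "linext \<iota> b (f + f') = linext \<iota> b f + linext \<iota> b f'" by (rule linext_add)
  show "linext \<iota> b 1 = 1"
    using linext_single[of b 0 1] by (simp add: one b0)
  have *: "linext \<iota> b (f * single k c) = linext \<iota> b f * linext \<iota> b (single k c)" for k c
  proof (rule additive_eqI_single[of "\<lambda>f. linext \<iota> b (f * single k c)"
        "\<lambda>f. linext \<iota> b f * linext \<iota> b (single k c)"])
    fix j d
    have "\<iota> d * \<iota> c * (b j * b k) = \<iota> d * b j * (\<iota> c * b k)"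
      by (metis central mult.assoc)
    then show "linext \<iota> b (single j d * single k c) =
        linext \<iota> b (single j d) * linext \<iota> b (single k c)"
      by (simp add: mult_single mult b_add)
  qed (unfold_locales, auto simp: algebra_simps linext_add)
  show "linext \<iota> b (f * f') = linext \<iota> b f * linext \<iota> b f'"
    by (rule additive_eqI_single[of "\<lambda>f'. linext \<iota> b (f * f')" "\<lambda>f'. linext \<iota> b f * linext \<iota> b f'"])
      (unfold_locales, auto simp: algebra_simps linext_add *)
qed

end

lemma complex_scalars_iff: "complex_scalars \<iota> \<longleftrightarrow> central_hom \<iota>"
  by (simp add: complex_scalars_def)

interpretation sc: complex_scalars sc
  by (simp add: complex_scalars_iff central_hom_sc)

lemma linext_natural:
  assumes "ring_morphism \<phi>" "\<And>c. \<phi> (\<iota> c) = \<iota>' c"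
  shows "\<phi> (linext \<iota> b f) = linext \<iota>' (\<lambda>k. \<phi> (b k)) f"
  by (simp add: linext_def ring_morphism.hom_simps[OF assms(1)] assms(2))


section \<open>Adic sums in coordinates\<close>

lemma hbar_monomial_mult_nth:
  fixes F :: "'a::ring_1 fps fps"
  shows "(hbar ^ a * hbar' ^ b * F) $ j $ i = (if a \<le> i \<and> b \<le> j then F $ (j - b) $ (i - a) else 0)"
proof -
  have "hbar ^ a = fps_const ((fps_X :: 'a fps) ^ a)"
    by (simp add: hbar_def fps_const_power)
  then show ?thesis
    by (simp add: hbar'_def mult.assoc fps_X_power_mult_nth)
qed

lemma fps_map_hbar_monomial:
  assumes "ring_morphism \<iota>"
  shows "fps_map (fps_map \<iota>) (hbar ^ a * hbar' ^ b) = hbar ^ a * hbar' ^ b"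
proof -
  interpret ring_morphism \<iota> by fact
  interpret m: ring_morphism "fps_map (fps_map \<iota>)"
    by (intro ring_morphism_fps_map) unfold_locales
  have "fps_map \<iota> fps_X = fps_X"
    by (auto simp: fps_eq_iff fps_X_nth zero one)
  then have "fps_map (fps_map \<iota>) hbar = hbar" "fps_map (fps_map \<iota>) hbar' = hbar'"
    by (auto simp: hbar_def hbar'_def fps_eq_iff fps_X_nth zero one fps_one_nth)
  then show ?thesis by (simp add: m.hom_simps)
qed

definition order_ge :: "nat \<Rightarrow> 'a::zero fps fps set" where
  "order_ge N = {F. \<forall>i j. i + j < N \<longrightarrow> F $ j $ i = 0}"

text \<open>
  A monomial \<open>h\<^sup>i h'\<^sup>j\<close> with \<open>i + j \<ge> N\<close> is a multiple of several \<open>h\<^sup>a h'\<^bsup>N-a\<^esup>\<close>. It is assigned to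
  \<open>a = min i N\<close>, which fixes the quotients.
\<close>

lemma order_ge_decompose:
  fixes F :: "'a::ring_1 fps fps"
  assumes "F \<in> order_ge N"
  obtains x where "F = (\<Sum>a\<in>{..N}. hbar ^ a * hbar' ^ (N - a) * x a)"
proof -
  define x where "x a = Abs_fps (\<lambda>j. Abs_fps (\<lambda>i.
      if a = N then F $ j $ (N + i) else if i = 0 then F $ (j + (N - a)) $ a else 0))" for a
  have "(\<Sum>a\<in>{..N}. (hbar ^ a * hbar' ^ (N - a) * x a) $ j $ i) = F $ j $ i" for i j
  proof -
    have "(\<Sum>a\<in>{..N}. (hbar ^ a * hbar' ^ (N - a) * x a) $ j $ i) =
        (\<Sum>a\<in>{..N}. if a = min i N then F $ j $ i else 0)"
    proof (rule sum.cong[OF refl])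
      fix a assume a: "a \<in> {..N}"
      have "F $ j $ i = 0" if "i + j < N" using that assms by (simp add: order_ge_def)
      then show "(hbar ^ a * hbar' ^ (N - a) * x a) $ j $ i = (if a = min i N then F $ j $ i else 0)"
        using a unfolding hbar_monomial_mult_nth x_def by (auto simp: min_def)
    qed
    also have "\<dots> = F $ j $ i" by simp
    finally show ?thesis .
  qed
  then have "F = (\<Sum>a\<in>{..N}. hbar ^ a * hbar' ^ (N - a) * x a)"
    by (simp add: fps_eq_iff fps_sum_nth)
  with that show ?thesis by blast
qed

locale coordinates2 = base: central_hom \<iota> + coordinates "fps_map (fps_map \<iota>)" M \<alpha>
  for \<iota> :: "complex \<Rightarrow> 'v::ring_1" and M :: "(complex fps fps, 'm) module" and \<alpha>
begin

lemma adic_submodule: "adic_submodule M N = \<alpha> ` order_ge N"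
proof -
  have *: "(\<Oplus>\<^bsub>M\<^esub>a\<in>{..N}. (hbar ^ a * hbar' ^ (N - a)) \<odot>\<^bsub>M\<^esub> \<alpha> (x a)) =
      \<alpha> (\<Sum>a\<in>{..N}. hbar ^ a * hbar' ^ (N - a) * x a)" for x
    by (simp flip: smult finsum add: fps_map_hbar_monomial[OF base.ring_morphism_axioms])
  have ex: "\<exists>x'. x = (\<lambda>a. \<alpha> (x' a))" if "\<forall>a. x a \<in> carrier M" for x :: "nat \<Rightarrow> 'm"
  proof -
    have "\<forall>a. \<exists>v. x a = \<alpha> v" using that by (auto simp: carrier)
    then obtain x' where "\<forall>a. x a = \<alpha> (x' a)" by metis
    then show ?thesis by auto
  qed
  have mem: "(\<Sum>a\<in>{..N}. hbar ^ a * hbar' ^ (N - a) * x a) \<in> order_ge N" for x :: "nat \<Rightarrow> 'v fps fps"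
    unfolding order_ge_def by (auto simp: fps_sum_nth hbar_monomial_mult_nth intro!: sum.neutral)
  show ?thesis
  proof (intro equalityI subsetI)
    fix m assume "m \<in> adic_submodule M N"
    then obtain x where x: "\<forall>a. x a \<in> carrier M"
      and m: "m = (\<Oplus>\<^bsub>M\<^esub>a\<in>{..N}. (hbar ^ a * hbar' ^ (N - a)) \<odot>\<^bsub>M\<^esub> x a)"
      unfolding adic_submodule_def by blast
    from ex[OF x] obtain x' where "x = (\<lambda>a. \<alpha> (x' a))" by blast
    then have "m = \<alpha> (\<Sum>a\<in>{..N}. hbar ^ a * hbar' ^ (N - a) * x' a)" by (simp only: m *)
    then show "m \<in> \<alpha> ` order_ge N" using mem by blast
  next
    fix m assume "m \<in> \<alpha> ` order_ge N"
    then obtain x where "m = \<alpha> (\<Sum>a\<in>{..N}. hbar ^ a * hbar' ^ (N - a) * x a)"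
      by (auto elim!: order_ge_decompose)
    then have "m = (\<Oplus>\<^bsub>M\<^esub>a\<in>{..N}. (hbar ^ a * hbar' ^ (N - a)) \<odot>\<^bsub>M\<^esub> \<alpha> (x a))"
      by (simp only: *)
    moreover have "\<forall>a. \<alpha> (x a) \<in> carrier M" by simp
    ultimately show "m \<in> adic_submodule M N"
      unfolding adic_submodule_def by (intro CollectI exI[of _ "\<lambda>a. \<alpha> (x a)"] conjI)
  qed
qed

text \<open>
  Only finitely many coefficients have a given total degree, so that adic convergence is
  coefficientwise.
\<close>

lemma adic_has_sum_iff:
  "adic_has_sum M (\<lambda>i. \<alpha> (f i)) (\<alpha> x) \<longleftrightarrow>
    (\<forall>j i. \<exists>T. finite T \<and> (\<forall>S. finite S \<and> T \<subseteq> S \<longrightarrow> x $ j $ i = (\<Sum>s\<in>S. f s $ j $ i)))"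
    (is "?L \<longleftrightarrow> (\<forall>j i. \<exists>T. ?P j i T)")
proof
  have L: "?L \<longleftrightarrow> (\<forall>N. \<exists>F. finite F \<and> (\<forall>S. finite S \<and> F \<subseteq> S \<longrightarrow> x - (\<Sum>s\<in>S. f s) \<in> order_ge N))"
  proof -
    have "\<alpha> x \<ominus>\<^bsub>M\<^esub> (\<Oplus>\<^bsub>M\<^esub>i\<in>S. \<alpha> (f i)) \<in> adic_submodule M N \<longleftrightarrow> x - (\<Sum>s\<in>S. f s) \<in> order_ge N"
      if "finite S" for S N
      by (simp add: finsum[OF that] minus adic_submodule image_iff)
    then show ?thesis unfolding adic_has_sum_def by (simp cong: conj_cong)
  qed
  {
    assume ?L
    show "\<forall>j i. \<exists>T. ?P j i T"
    proof (intro allI)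
      fix j i
      obtain F where F: "finite F" "\<And>S. finite S \<Longrightarrow> F \<subseteq> S \<Longrightarrow> x - (\<Sum>s\<in>S. f s) \<in> order_ge (Suc (i + j))"
        using spec[OF \<open>?L\<close>[unfolded L], of "Suc (i + j)"] by (elim exE conjE) simp
      have "x $ j $ i = (\<Sum>s\<in>S. f s $ j $ i)" if "finite S" "F \<subseteq> S" for S
        using F(2)[OF that] by (simp add: order_ge_def fps_sum_nth)
      then have "?P j i F" using F(1) by blast
      then show "\<exists>T. ?P j i T" ..
    qed
  }
  {
    assume "\<forall>j i. \<exists>T. ?P j i T"
    then obtain T where T: "\<And>j i. ?P j i (T j i)" by metis
    show ?L unfolding L
    proof
      fix N
      define F where "F = (\<Union>j<N. \<Union>i<N. T j i)"
      have "x - (\<Sum>s\<in>S. f s) \<in> order_ge N" if S: "finite S" "F \<subseteq> S" for S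
      proof -
        have "x $ j $ i = (\<Sum>s\<in>S. f s $ j $ i)" if "i + j < N" for i j
        proof -
          have "T j i \<subseteq> F" using that unfolding F_def by fastforce
          then show ?thesis using T[of j i] S by blast
        qed
        then show ?thesis by (auto simp: order_ge_def fps_sum_nth)
      qed
      moreover have "finite F" using T by (auto simp: F_def)
      ultimately show "\<exists>F. finite F \<and> (\<forall>S. finite S \<and> F \<subseteq> S \<longrightarrow> x - (\<Sum>s\<in>S. f s) \<in> order_ge N)"
        by blast
    qed
  }
qed

end

lemma eventually_sum_single_iff:
  fixes p :: "'i \<Rightarrow>\<^sub>0 complex"
  shows "(\<exists>T. finite T \<and> (\<forall>S. finite S \<and> T \<subseteq> S \<longrightarrow> p = (\<Sum>s\<in>S. single s (c s)))) \<longleftrightarrow>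
    (\<forall>k. c k = lookup p k)"
proof
  assume "\<exists>T. finite T \<and> (\<forall>S. finite S \<and> T \<subseteq> S \<longrightarrow> p = (\<Sum>s\<in>S. single s (c s)))"
  then obtain T where T: "finite T" "\<And>S. finite S \<Longrightarrow> T \<subseteq> S \<Longrightarrow> p = (\<Sum>s\<in>S. single s (c s))"
    by blast
  show "\<forall>k. c k = lookup p k"
  proof
    fix k
    have "p = (\<Sum>s\<in>insert k T. single s (c s))" using T by blast
    then have "lookup p k = (\<Sum>s\<in>insert k T. if s = k then c s else 0)"
      by (simp only: lookup_sum lookup_single when_def)
    also have "\<dots> = c k" using T(1) by (subst sum.delta) auto
    finally show "c k = lookup p k" ..
  qed
next
  assume c: "\<forall>k. c k = lookup p k"
  have "p = (\<Sum>s\<in>S. single s (c s))" if "finite S" "keys p \<subseteq> S" for S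
  proof -
    have "(\<Sum>s\<in>S. single s (c s)) = (\<Sum>s\<in>keys p. single s (c s))"
      using that by (intro sum.mono_neutral_right) (auto simp: c in_keys_iff)
    then show ?thesis by (simp add: c poly_mapping_eq_sum_single)
  qed
  then show "\<exists>T. finite T \<and> (\<forall>S. finite S \<and> T \<subseteq> S \<longrightarrow> p = (\<Sum>s\<in>S. single s (c s)))"
    by (intro exI[of _ "keys p"]) auto
qed

lemma topological_basis_single:
  assumes "coordinates (fps_map (fps_map sc)) M \<alpha>"
    and b: "\<And>k. b k = \<alpha> (const2 (single k 1))"
  shows "topological_basis M b"
proof -
  interpret coordinates "fps_map (fps_map sc)" M \<alpha> by fact
  interpret coordinates2 sc M \<alpha> by unfold_locales
  have "adic_has_sum M (\<lambda>k. c k \<odot>\<^bsub>M\<^esub> b k) (\<alpha> v) \<longleftrightarrow>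
      (\<forall>j i k. c k $ j $ i = lookup (v $ j $ i) k)" for c v
    unfolding b smult[symmetric] adic_has_sum_iff
    by (simp add: eventually_sum_single_iff)
  then have *: "adic_has_sum M (\<lambda>k. c k \<odot>\<^bsub>M\<^esub> b k) (\<alpha> v) \<longleftrightarrow>
      c = (\<lambda>k. Abs_fps (\<lambda>j. Abs_fps (\<lambda>i. lookup (v $ j $ i) k)))" for c v
    by (auto simp: fun_eq_iff fps_eq_iff)
  show ?thesis
    unfolding topological_basis_def carrier by (auto simp only: * ball_simps) (simp_all add: b)
qed

text \<open>
  The component of weight \<open>m\<close> of a vector is obtained by keeping, in each coefficient, the basis
  vectors of that weight. An adic sum of weight vectors determines its summands because each
  basis vector occurs in only one weight.
\<close>

lemma weight_representation_diagonal:
  fixes n :: int and M :: "(complex fps fps, 'm) module" and \<alpha> :: "(nat \<Rightarrow>\<^sub>0 complex) fps fps \<Rightarrow> 'm"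
  assumes "coordinates (fps_map (fps_map sc)) M \<alpha>" and rep: "representation U M act"
    and H: "\<And>v. act (Hw U) (\<alpha> v) = \<alpha> (fps_map (fps_map D) v)"
    and D: "\<And>p k. lookup (D p) k = of_int (n - 2 * int k) * lookup p k"
  shows "weight_representation U M act"
proof -
  interpret coordinates "fps_map (fps_map sc)" M \<alpha> by fact
  interpret coordinates2 sc M \<alpha> by unfold_locales
  have scm: "(fps_map (fps_map sc) (of_int m) * v) $ j $ i = sc (of_int m) * v $ j $ i"
    for m j i and v :: "(nat \<Rightarrow>\<^sub>0 complex) fps fps"
  proof -
    have "(of_int m :: complex fps fps) = const2 (of_int m)"
      by (simp add: fps_of_int)
    moreover have "fps_map sc 0 = (0 :: (nat \<Rightarrow>\<^sub>0 complex) fps)" by (simp add: fps_eq_iff)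
    ultimately show ?thesis by (simp add: fps_map_const del: single_of_int)
  qed
  have weight: "\<alpha> v \<in> weight_space U M act m \<longleftrightarrow>
      (\<forall>j i k. lookup (v $ j $ i) k \<noteq> 0 \<longrightarrow> n - 2 * int k = m)" for v m
  proof -
    have "\<alpha> v \<in> weight_space U M act m \<longleftrightarrow> fps_map (fps_map D) v = fps_map (fps_map sc) (of_int m) * v"
      by (simp add: weight_space_def H flip: smult)
    also have "\<dots> \<longleftrightarrow> (\<forall>j i. D (v $ j $ i) = sc (of_int m) * v $ j $ i)"
      by (simp add: fps_eq_iff scm)
    also have "\<dots> \<longleftrightarrow> (\<forall>j i k. of_int (n - 2 * int k) * lookup (v $ j $ i) k =
        of_int m * lookup (v $ j $ i) k)"
      by (simp only: poly_mapping_eq_iff fun_eq_iff D lookup_sc_mult)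
    also have "\<dots> \<longleftrightarrow> (\<forall>j i k. lookup (v $ j $ i) k \<noteq> 0 \<longrightarrow> n - 2 * int k = m)"
      by (simp only: mult_cancel_right of_int_eq_iff) blast
    finally show ?thesis .
  qed
  have "\<exists>!f. (\<forall>m. f m \<in> weight_space U M act m) \<and> adic_has_sum M f (\<alpha> v)" for v
  proof -
    define F where "F m = Abs_fps (\<lambda>j. Abs_fps (\<lambda>i.
        \<Sum>k\<in>keys (v $ j $ i). single k
          (if n - 2 * int k = m then lookup (v $ j $ i) k else 0)))" for m
    have lookup_F: "lookup (F m $ j $ i) k =
        (if n - 2 * int k = m then lookup (v $ j $ i) k else 0)" for m j i k
    proof -
      have "lookup (F m $ j $ i) k = (\<Sum>l\<in>keys (v $ j $ i).
          if l = k then (if n - 2 * int k = m then lookup (v $ j $ i) k else 0) else 0)"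
        unfolding F_def by (simp add: lookup_sum lookup_single when_def)
      then show ?thesis by (simp add: sum.delta in_keys_iff)
    qed
    have lookup_sum_F: "lookup (\<Sum>m\<in>S. F m $ j $ i) k =
        (if n - 2 * int k \<in> S then lookup (v $ j $ i) k else 0)" if "finite S" for S j i k
      using that by (simp add: lookup_sum lookup_F sum.delta)
    show ?thesis
    proof (rule ex1I[of _ "\<lambda>m. \<alpha> (F m)"])
      have "\<exists>T. finite T \<and> (\<forall>S. finite S \<and> T \<subseteq> S \<longrightarrow> v $ j $ i = (\<Sum>m\<in>S. F m $ j $ i))" for j i
      proof (intro exI[of _ "(\<lambda>k. n - 2 * int k) ` keys (v $ j $ i)"] conjI allI impI)
        fix S assume S: "finite S \<and> (\<lambda>k. n - 2 * int k) ` keys (v $ j $ i) \<subseteq> S"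
        show "v $ j $ i = (\<Sum>m\<in>S. F m $ j $ i)"
          by (rule poly_mapping_eqI) (use S in \<open>auto simp: lookup_sum_F in_keys_iff image_subset_iff\<close>)
      qed simp
      then show "(\<forall>m. \<alpha> (F m) \<in> weight_space U M act m) \<and> adic_has_sum M (\<lambda>m. \<alpha> (F m)) (\<alpha> v)"
        by (auto simp: weight lookup_F adic_has_sum_iff split: if_splits)
    next
      fix f assume f: "(\<forall>m. f m \<in> weight_space U M act m) \<and> adic_has_sum M f (\<alpha> v)"
      then have "\<forall>m. \<exists>G. f m = \<alpha> G" by (auto simp: weight_space_def carrier)
      then obtain G where G: "f = (\<lambda>m. \<alpha> (G m))" by metis
      have wG: "lookup (G m $ j $ i) k \<noteq> 0 \<Longrightarrow> n - 2 * int k = m" for m j i k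
        using f by (auto simp: G weight)
      have "G m $ j $ i = F m $ j $ i" for m j i
      proof (rule poly_mapping_eqI)
        fix k
        from f obtain T where T: "finite T" "\<And>S. finite S \<Longrightarrow> T \<subseteq> S \<Longrightarrow> v $ j $ i = (\<Sum>m\<in>S. G m $ j $ i)"
        proof -
          have "adic_has_sum M (\<lambda>m. \<alpha> (G m)) (\<alpha> v)" using f by (simp add: G)
          then have "\<exists>T. finite T \<and> (\<forall>S. finite S \<and> T \<subseteq> S \<longrightarrow> v $ j $ i = (\<Sum>m\<in>S. G m $ j $ i))"
            unfolding adic_has_sum_iff by (elim allE)
          then obtain T' where T': "finite T'" "\<forall>S. finite S \<and> T' \<subseteq> S \<longrightarrow> v $ j $ i = (\<Sum>m\<in>S. G m $ j $ i)"
            by (elim exE conjE)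
          show ?thesis by (rule that[OF T'(1)], rule mp[OF spec[OF T'(2)]]) simp
        qed
        let ?S = "insert (n - 2 * int k) T"
        have "v $ j $ i = (\<Sum>m\<in>?S. G m $ j $ i)" by (rule T(2)) (use T(1) in auto)
        then have "lookup (v $ j $ i) k = (\<Sum>m\<in>?S. lookup (G m $ j $ i) k)"
          by (simp only: lookup_sum)
        also have "\<dots> = (\<Sum>m\<in>?S. if m = n - 2 * int k then lookup (G m $ j $ i) k else 0)"
          using wG by (intro sum.cong) auto
        also have "\<dots> = lookup (G (n - 2 * int k) $ j $ i) k"
          using T(1) by (subst sum.delta) auto
        finally show "lookup (G m $ j $ i) k = lookup (F m $ j $ i) k"
          using wG[of m j i k] by (auto simp: lookup_F)
      qed
      then show "f = (\<lambda>m. \<alpha> (F m))" by (auto simp: G fun_eq_iff fps_eq_iff)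
    qed
  qed
  then show ?thesis
    unfolding weight_representation_def carrier using rep by blast
qed

text \<open>
  Finitely many vectors involve only finitely many of the basis vectors.
\<close>

lemma not_finite_dimensional:
  fixes M :: "(complex, 'm) module" and \<alpha> :: "('i::monoid_add \<Rightarrow>\<^sub>0 complex) \<Rightarrow> 'm"
  assumes "coordinates sc M \<alpha>" "infinite (UNIV :: 'i set)"
  shows "\<not> finite_dimensional M"
proof
  interpret coordinates sc M \<alpha> by fact
  assume "finite_dimensional M"
  then obtain S where S: "finite S" "S \<subseteq> carrier M"
    "\<And>m. m \<in> carrier M \<Longrightarrow> \<exists>c. m = (\<Oplus>\<^bsub>M\<^esub>s\<in>S. c s \<odot>\<^bsub>M\<^esub> s)"
    unfolding finite_dimensional_def by blast
  have "\<forall>s\<in>S. \<exists>v. s = \<alpha> v" using S(2) by (auto simp: carrier)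
  then have "\<exists>w. \<forall>s\<in>S. s = \<alpha> (w s)" by (rule bchoice)
  then obtain w where w: "\<And>s. s \<in> S \<Longrightarrow> s = \<alpha> (w s)" by blast
  have "finite (\<Union>s\<in>S. keys (w s))" using S(1) by simp
  then obtain k where k: "k \<notin> (\<Union>s\<in>S. keys (w s))"
    using assms(2) by (metis UNIV_I ex_new_if_finite)
  obtain c where c: "\<alpha> (single k 1) = (\<Oplus>\<^bsub>M\<^esub>s\<in>S. c s \<odot>\<^bsub>M\<^esub> s)"
    using S(3)[of "\<alpha> (single k 1)"] by auto
  interpret abelian_group M by (rule abelian_group)
  have "(\<Oplus>\<^bsub>M\<^esub>s\<in>S. c s \<odot>\<^bsub>M\<^esub> s) = (\<Oplus>\<^bsub>M\<^esub>s\<in>S. \<alpha> (sc (c s) * w s))"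
  proof (rule finsum_cong')
    show "c s \<odot>\<^bsub>M\<^esub> s = \<alpha> (sc (c s) * w s)" if "s \<in> S" for s
      using smult[of "c s" "w s"] w[OF that] by simp
  qed auto
  also have "\<dots> = \<alpha> (\<Sum>s\<in>S. sc (c s) * w s)" by (rule finsum[OF S(1)])
  finally have "single k 1 = (\<Sum>s\<in>S. sc (c s) * w s)" using c by simp
  then have "lookup (single k (1::complex)) k =
      (\<Sum>s\<in>S. c s * lookup (w s) k)"
    by (simp only: lookup_sum lookup_sc_mult)
  moreover have "(\<Sum>s\<in>S. c s * lookup (w s) k) = 0"
    using k by (intro sum.neutral) (auto simp: in_keys_iff)
  ultimately show False by simp
qed


section \<open>Homomorphisms from a free algebra and their adic extensions\<close>

definition free_eval :: "(complex \<Rightarrow> 'r::ring_1) \<Rightarrow> ('x \<Rightarrow> 'r) \<Rightarrow> 'x free_algebra \<Rightarrow> 'r" where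
  "free_eval \<iota> L = linext \<iota> (\<lambda>w. prod_list (map L (letters w)))"

lemma scal_eq_sc: "scal = sc"
  by (simp add: scal_def fun_eq_iff)

lemma central_hom_scal: "central_hom scal"
  unfolding scal_eq_sc by (rule central_hom_sc)

context complex_scalars
begin

lemma ring_morphism_free_eval: "ring_morphism (free_eval \<iota> L)"
  unfolding free_eval_def
  by (rule ring_morphism_linext) (simp_all add: zero_free_monoid_def plus_free_monoid_def)

lemma free_eval_var [simp]: "free_eval \<iota> L (var x) = L x"
  by (simp add: free_eval_def var_def one)

lemma free_eval_scal [simp]: "free_eval \<iota> L (scal c) = \<iota> c"
  by (simp add: free_eval_def scal_def zero_free_monoid_def)

end

text \<open>
  The extension of \<open>\<rho> : A \<rightarrow> B[[t]]\<close> to the continuous map \<open>A[[t]] \<rightarrow> B[[t]]\<close> that fixes \<open>t\<close>, namely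
  \<open>\<Sum> f\<^sub>k t\<^sup>k \<mapsto> \<Sum> \<rho>(f\<^sub>k) t\<^sup>k\<close>.
\<close>

definition adic_ext :: "('a::ring_1 \<Rightarrow> 'b::ring_1 fps) \<Rightarrow> 'a fps \<Rightarrow> 'b fps" where
  "adic_ext \<rho> f = Abs_fps (\<lambda>n. \<Sum>k\<le>n. \<rho> (f $ k) $ (n - k))"

lemma adic_ext_nth: "adic_ext \<rho> f $ n = (\<Sum>k\<le>n. \<rho> (f $ k) $ (n - k))"
  by (simp add: adic_ext_def)

lemma adic_ext_nth_0 [simp]: "adic_ext \<rho> f $ 0 = \<rho> (f $ 0) $ 0"
  by (simp add: adic_ext_nth)

lemma additive_adic_ext: "Modules.additive \<rho> \<Longrightarrow> Modules.additive (adic_ext \<rho>)"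
  by unfold_locales (simp add: fps_eq_iff adic_ext_nth additive.add sum.distrib)

text \<open>
  Multiplicativity is stated for a product rule with several terms, because the coefficients of a
  homomorphism \<open>A \<rightarrow> B[[h]][[h']]\<close> with respect to \<open>h'\<close> satisfy such a rule and have to be extended
  one at a time.
\<close>

lemma adic_ext_mult:
  assumes "Modules.additive \<rho>" "\<And>p. Modules.additive (\<sigma> p)" "\<And>p. Modules.additive (\<tau> p)"
    and "\<And>a b. \<rho> (a * b) = (\<Sum>p\<in>S. \<sigma> p a * \<tau> p b)"
  shows "adic_ext \<rho> (f * g) = (\<Sum>p\<in>S. adic_ext (\<sigma> p) f * adic_ext (\<tau> p) g)"
proof (rule fps_ext)
  fix n
  have 1: "(\<Sum>m\<le>n. \<Sum>k\<le>m. \<Sum>r\<le>n - m. \<sigma> p (f $ k) $ r * \<tau> p (g $ (m - k)) $ (n - m - r)) =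
      (\<Sum>u\<le>n. \<Sum>k\<le>u. \<Sum>l\<le>n - u. \<sigma> p (f $ k) $ (u - k) * \<tau> p (g $ l) $ (n - u - l))" for p
  proof -
    \<comment> \<open>Both sides sum over all \<open>k + l + r + s = n\<close>, where \<open>m = k + l\<close> and \<open>u = k + r\<close>.\<close>
    have "(\<Sum>(m, k, r)\<in>(SIGMA m:{..n}. {..m} \<times> {..n - m}).
          \<sigma> p (f $ k) $ r * \<tau> p (g $ (m - k)) $ (n - m - r)) =
        (\<Sum>(u, k, l)\<in>(SIGMA u:{..n}. {..u} \<times> {..n - u}).
          \<sigma> p (f $ k) $ (u - k) * \<tau> p (g $ l) $ (n - u - l))"
      by (rule sum.reindex_bij_witness[of _ "\<lambda>(u, k, l). (k + l, k, u - k)" "\<lambda>(m, k, r). (k + r, k, m - k)"])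
        (auto simp: algebra_simps)
    then show ?thesis by (simp add: sum.Sigma sum.cartesian_product)
  qed
  have "adic_ext \<rho> (f * g) $ n =
      (\<Sum>m\<le>n. \<Sum>k\<le>m. \<Sum>p\<in>S. \<Sum>r\<le>n - m. \<sigma> p (f $ k) $ r * \<tau> p (g $ (m - k)) $ (n - m - r))"
    by (simp add: adic_ext_nth fps_mult_nth fps_sum_nth additive.sum[OF assms(1)] assms(4) atLeast0AtMost)
  also have "\<dots> = (\<Sum>p\<in>S. \<Sum>m\<le>n. \<Sum>k\<le>m. \<Sum>r\<le>n - m. \<sigma> p (f $ k) $ r * \<tau> p (g $ (m - k)) $ (n - m - r))"
    by (subst (2) sum.swap) (subst sum.swap, rule refl)
  also have "\<dots> = (\<Sum>p\<in>S. adic_ext (\<sigma> p) f * adic_ext (\<tau> p) g) $ n"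
    unfolding 1 by (simp add: fps_sum_nth fps_mult_nth adic_ext_nth sum_product atLeast0AtMost)
  finally show "adic_ext \<rho> (f * g) $ n = (\<Sum>p\<in>S. adic_ext (\<sigma> p) f * adic_ext (\<tau> p) g) $ n" .
qed

lemma adic_ext_const:
  assumes "\<rho> 0 = 0"
  shows "adic_ext \<rho> (fps_const a) = \<rho> a"
proof (rule fps_ext)
  fix n
  have "adic_ext \<rho> (fps_const a) $ n = (\<Sum>k\<le>n. if k = 0 then \<rho> a $ n else 0)"
    unfolding adic_ext_nth by (intro sum.cong) (auto simp: assms)
  then show "adic_ext \<rho> (fps_const a) $ n = \<rho> a $ n" by simp
qed

lemma ring_morphism_adic_ext:
  assumes "ring_morphism \<rho>"
  shows "ring_morphism (adic_ext \<rho>)"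
proof -
  interpret ring_morphism \<rho> by fact
  show ?thesis
  proof unfold_locales
    show "adic_ext \<rho> (f + g) = adic_ext \<rho> f + adic_ext \<rho> g" for f g
      using additive.add[OF additive_adic_ext[OF additive]] .
    show "adic_ext \<rho> (f * g) = adic_ext \<rho> f * adic_ext \<rho> g" for f g
      using adic_ext_mult[OF additive additive additive, of "{()}" f g] by (simp add: mult)
    show "adic_ext \<rho> 1 = 1"
      using adic_ext_const[of \<rho> 1] by (simp add: zero one)
  qed
qed

lemma adic_ext_constant_values:
  assumes "\<And>k. \<rho> (f $ k) = fps_const (\<sigma> k)"
  shows "adic_ext \<rho> f = Abs_fps \<sigma>"
proof (rule fps_ext)
  fix n
  have "adic_ext \<rho> f $ n = (\<Sum>k\<le>n. if k = n then \<sigma> n else 0)"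
    unfolding adic_ext_nth by (intro sum.cong) (auto simp: assms)
  then show "adic_ext \<rho> f $ n = Abs_fps \<sigma> $ n" by simp
qed

text \<open>
  The extension of \<open>A \<rightarrow> B[[h]][[h']]\<close> to \<open>A[[h]]\<close>; the inner variable \<open>h\<close> is extended first, and
  \<open>adic_ext\<close> then takes care of the outer variable \<open>h'\<close>.
\<close>

definition adic_ext_inner :: "('a::ring_1 \<Rightarrow> 'b::ring_1 fps fps) \<Rightarrow> 'a fps \<Rightarrow> 'b fps fps" where
  "adic_ext_inner \<rho> f = Abs_fps (\<lambda>j. adic_ext (\<lambda>a. \<rho> a $ j) f)"

definition adic_ext2 :: "('a::ring_1 \<Rightarrow> 'b::ring_1 fps fps) \<Rightarrow> 'a fps fps \<Rightarrow> 'b fps fps" where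
  "adic_ext2 \<rho> = adic_ext (adic_ext_inner \<rho>)"

lemma adic_ext_inner_nth [simp]: "adic_ext_inner \<rho> f $ j = adic_ext (\<lambda>a. \<rho> a $ j) f"
  by (simp add: adic_ext_inner_def)

lemma additive_nth: "Modules.additive \<rho> \<Longrightarrow> Modules.additive (\<lambda>a. \<rho> a $ j)"
  by unfold_locales (simp add: additive.add)

lemma ring_morphism_adic_ext_inner:
  assumes "ring_morphism \<rho>"
  shows "ring_morphism (adic_ext_inner \<rho>)"
proof -
  interpret ring_morphism \<rho> by fact
  have add_j: "Modules.additive (\<lambda>a. \<rho> a $ j)" for j by (rule additive_nth[OF additive])
  show ?thesis
  proof unfold_locales
    show "adic_ext_inner \<rho> (f + g) = adic_ext_inner \<rho> f + adic_ext_inner \<rho> g" for f g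
      by (rule fps_ext) (simp add: additive.add[OF additive_adic_ext[OF add_j]])
    show "adic_ext_inner \<rho> 1 = 1"
    proof (rule fps_ext)
      fix j
      show "adic_ext_inner \<rho> 1 $ j = 1 $ j"
        using adic_ext_const[of "\<lambda>a. \<rho> a $ j" 1] by (simp add: zero one)
    qed
    show "adic_ext_inner \<rho> (f * g) = adic_ext_inner \<rho> f * adic_ext_inner \<rho> g" for f g
    proof (rule fps_ext)
      fix j
      have "adic_ext (\<lambda>a. \<rho> a $ j) (f * g) =
          (\<Sum>p\<in>{0..j}. adic_ext (\<lambda>a. \<rho> a $ p) f * adic_ext (\<lambda>a. \<rho> a $ (j - p)) g)"
        by (rule adic_ext_mult) (simp_all add: add_j mult fps_mult_nth)
      then show "adic_ext_inner \<rho> (f * g) $ j = (adic_ext_inner \<rho> f * adic_ext_inner \<rho> g) $ j"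
        by (simp add: fps_mult_nth)
    qed
  qed
qed

lemma ring_morphism_adic_ext2: "ring_morphism \<rho> \<Longrightarrow> ring_morphism (adic_ext2 \<rho>)"
  unfolding adic_ext2_def by (intro ring_morphism_adic_ext ring_morphism_adic_ext_inner)

lemma adic_ext2_nth: "adic_ext2 \<rho> f $ j $ i = (\<Sum>k\<le>j. \<Sum>l\<le>i. \<rho> (f $ k $ l) $ (j - k) $ (i - l))"
  by (simp add: adic_ext2_def adic_ext_nth fps_sum_nth)

lemma adic_ext2_nth_0: "adic_ext2 \<rho> f $ 0 = adic_ext (\<lambda>a. \<rho> a $ 0) (f $ 0)"
  by (simp add: adic_ext2_def)

lemma adic_ext2_const:
  assumes "\<rho> 0 = 0"
  shows "adic_ext2 \<rho> (const2 a) = \<rho> a"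
proof -
  have *: "adic_ext_inner \<rho> (fps_const a) = \<rho> a" for a
    by (rule fps_ext) (simp add: adic_ext_const assms)
  show ?thesis unfolding adic_ext2_def
    using *[of 0] by (subst adic_ext_const) (simp_all add: * assms)
qed

lemma adic_ext2_constant_values:
  assumes "\<And>j i. \<rho> (f $ j $ i) = const2 (\<sigma> j i)"
  shows "adic_ext2 \<rho> f $ j $ i = \<sigma> j i"
proof -
  have "adic_ext_inner \<rho> (f $ j) = fps_const (Abs_fps (\<sigma> j))" for j
  proof (rule fps_ext)
    fix m
    show "adic_ext_inner \<rho> (f $ j) $ m = fps_const (Abs_fps (\<sigma> j)) $ m"
      using adic_ext_constant_values[of "\<lambda>a. \<rho> a $ m" "f $ j" "\<lambda>i. if m = 0 then \<sigma> j i else 0"] assms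
      by (cases "m = 0") (auto simp: fps_eq_iff)
  qed
  then show ?thesis
    unfolding adic_ext2_def by (subst adic_ext_constant_values[of _ _ "\<lambda>j. Abs_fps (\<sigma> j)"]) simp_all
qed


section \<open>Adic closures\<close>

text \<open>
  The extensions are continuous: a coefficient of the value depends on finitely many coefficients of
  the argument.
\<close>

lemma adic_closure1_kernel:
  assumes "\<And>s. s \<in> S \<Longrightarrow> adic_ext \<rho> s = 0" "f \<in> adic_closure1 S"
  shows "adic_ext \<rho> f = 0"
proof (rule fps_ext)
  fix n
  obtain s where "s \<in> S" and s: "\<forall>i<Suc n. f $ i = s $ i"
    using assms(2) unfolding adic_closure1_def by blast
  have "adic_ext \<rho> f $ n = adic_ext \<rho> s $ n"
    unfolding adic_ext_nth using s by (intro sum.cong) auto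
  with assms(1)[OF \<open>s \<in> S\<close>] show "adic_ext \<rho> f $ n = 0 $ n" by simp
qed

lemma adic_closure2_kernel:
  assumes "\<And>s. s \<in> S \<Longrightarrow> adic_ext2 \<rho> s = 0" "f \<in> adic_closure2 S"
  shows "adic_ext2 \<rho> f = 0"
proof (intro fps_ext)
  fix j i
  obtain s where "s \<in> S" and s: "\<forall>i' j'. i' + j' < Suc (i + j) \<longrightarrow> f $ j' $ i' = s $ j' $ i'"
    using assms(2) unfolding adic_closure2_def by blast
  have "adic_ext2 \<rho> f $ j $ i = adic_ext2 \<rho> s $ j $ i"
    unfolding adic_ext2_nth using s by (intro sum.cong) auto
  with assms(1)[OF \<open>s \<in> S\<close>] show "adic_ext2 \<rho> f $ j $ i = 0 $ j $ i" by simp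
qed

lemma fps_mult_nth2: "(f * g) $ j $ i = (\<Sum>k=0..j. \<Sum>l=0..i. f $ k $ l * g $ (j - k) $ (i - l))"
  for f g :: "'a::ring_1 fps fps"
  by (simp add: fps_mult_nth fps_sum_nth)

lemma ideal_closure:
  fixes I :: "'a::ring_1 set"
  assumes D: "\<And>N::nat. ideal (D N) type_ring" and I: "ideal I type_ring"
  shows "ideal {f. \<forall>N. \<exists>s\<in>I. f - s \<in> D N} type_ring" (is "ideal ?C _")
  unfolding ideal_type_ring_iff
proof (intro conjI ballI allI)
  note D' = ideal_type_ringD[OF D] and I' = ideal_type_ringD[OF I]
  show "0 \<in> ?C" using D'(1) I'(1) by (auto intro!: bexI[of _ 0])
  show "a - b \<in> ?C" if ab: "a \<in> ?C" "b \<in> ?C" for a b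
  proof (intro CollectI allI)
    fix N
    from ab obtain s t where "s \<in> I" "a - s \<in> D N" "t \<in> I" "b - t \<in> D N" by blast
    then show "\<exists>u\<in>I. a - b - u \<in> D N"
      using D'(2)[of "a - s" N "b - t"] by (intro bexI[of _ "s - t"] I'(2)) (simp_all add: algebra_simps)
  qed
  fix a r assume "a \<in> ?C"
  then have *: "\<exists>s\<in>I. a - s \<in> D N" for N by blast
  show "r * a \<in> ?C"
  proof (intro CollectI allI)
    fix N
    from *[of N] obtain s where "s \<in> I" "a - s \<in> D N" by blast
    then show "\<exists>u\<in>I. r * a - u \<in> D N"
      using D'(4)[of "a - s" N r] by (intro bexI[of _ "r * s"] I'(4)) (simp_all add: right_diff_distrib)
  qed
  show "a * r \<in> ?C"
  proof (intro CollectI allI)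
    fix N
    from *[of N] obtain s where "s \<in> I" "a - s \<in> D N" by blast
    then show "\<exists>u\<in>I. a * r - u \<in> D N"
      using D'(5)[of "a - s" N r] by (intro bexI[of _ "s * r"] I'(5)) (simp_all add: left_diff_distrib)
  qed
qed

definition order_ge1 :: "nat \<Rightarrow> 'a::zero fps set" where
  "order_ge1 N = {f. \<forall>i<N. f $ i = 0}"

lemma adic_closure1_eq: "adic_closure1 S = {f. \<forall>N. \<exists>s\<in>S. f - s \<in> order_ge1 N}" for S :: "'a::ring_1 fps set"
  by (simp add: adic_closure1_def order_ge1_def)

lemma adic_closure2_eq: "adic_closure2 S = {f. \<forall>N. \<exists>s\<in>S. f - s \<in> order_ge N}" for S :: "'a::ring_1 fps fps set"
  by (simp add: adic_closure2_def order_ge_def)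

lemma ideal_order_ge1: "ideal (order_ge1 N) (type_ring :: 'a::ring_1 fps ring)"
  by (auto simp: ideal_type_ring_iff order_ge1_def fps_mult_nth intro!: sum.neutral)

lemma ideal_order_ge: "ideal (order_ge N) (type_ring :: 'a::ring_1 fps fps ring)"
  by (auto simp: ideal_type_ring_iff order_ge_def fps_mult_nth2 intro!: sum.neutral)

lemma ideal_adic_closure1:
  "ideal I (type_ring :: 'a::ring_1 fps ring) \<Longrightarrow> ideal (adic_closure1 I) type_ring"
  unfolding adic_closure1_eq by (rule ideal_closure[OF ideal_order_ge1])

lemma ideal_adic_closure2:
  "ideal I (type_ring :: 'a::ring_1 fps fps ring) \<Longrightarrow> ideal (adic_closure2 I) type_ring"
  unfolding adic_closure2_eq by (rule ideal_closure[OF ideal_order_ge])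


section \<open>Lifting a complement from the residue algebra\<close>

text \<open>
  Here \<open>D\<close> and \<open>E\<close> are filtrations, and \<open>step\<close> corrects an error of order \<open>N\<close> by something in the
  image of \<open>P\<close> and something in \<open>I\<close>. The corrections in the image of \<open>P\<close> are summed up by
  completeness; those in \<open>I\<close> are not, which is why only the closure of \<open>I\<close> is reached.
\<close>

lemma successive_approximation:
  fixes P :: "'l::ab_group_add \<Rightarrow> 'r::ab_group_add"
  assumes P: "Modules.additive P" "\<And>N l. l \<in> E N \<Longrightarrow> P l \<in> D N"
    and D: "D 0 = UNIV" "\<And>N a b. a \<in> D N \<Longrightarrow> b \<in> D N \<Longrightarrow> a - b \<in> D N"
    and I: "0 \<in> I" "\<And>a b. a \<in> I \<Longrightarrow> b \<in> I \<Longrightarrow> a + b \<in> I"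
    and complete: "\<And>s. (\<And>N. s N \<in> E N) \<Longrightarrow> \<exists>l. \<forall>N. l - (\<Sum>k<N. s k) \<in> E N"
    and step: "\<And>N f. f \<in> D N \<Longrightarrow> \<exists>l\<in>E N. \<exists>i\<in>I. f - P l - i \<in> D (Suc N)"
  shows "\<exists>l. \<forall>N. \<exists>i\<in>I. f - P l - i \<in> D N"
proof -
  from step have "\<forall>N. \<forall>g\<in>D N. \<exists>l i. l \<in> E N \<and> i \<in> I \<and> g - P l - i \<in> D (Suc N)" by blast
  then obtain L J where LJ: "\<And>N g. g \<in> D N \<Longrightarrow> L N g \<in> E N \<and> J N g \<in> I \<and> g - P (L N g) - J N g \<in> D (Suc N)"
    by metis
  define F where "F = rec_nat f (\<lambda>N g. g - P (L N g) - J N g)"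
  have F_Suc: "F (Suc N) = F N - P (L N (F N)) - J N (F N)" and F_0: "F 0 = f" for N
    by (simp_all add: F_def)
  have F: "F N \<in> D N" for N
    by (induction N) (use LJ in \<open>auto simp: F_0 F_Suc D(1)\<close>)
  define s where "s N = L N (F N)" for N
  have s: "s N \<in> E N" for N using LJ[OF F] by (simp add: s_def)
  obtain l where l: "\<And>N. l - (\<Sum>k<N. s k) \<in> E N" using complete[of s] s by blast
  have F_eq: "F N = f - P (\<Sum>k<N. s k) - (\<Sum>k<N. J k (F k))" for N
    by (induction N) (simp_all add: F_0 F_Suc s_def additive.add[OF P(1)] additive.zero[OF P(1)] algebra_simps)
  have "\<exists>i\<in>I. f - P l - i \<in> D N" for N
  proof
    have "(\<Sum>k<m. J k (F k)) \<in> I" for m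
      by (induction m) (use I LJ[OF F] in auto)
    then show "(\<Sum>k<N. J k (F k)) \<in> I" .
    have "f - P l - (\<Sum>k<N. J k (F k)) = F N - P (l - (\<Sum>k<N. s k))"
      by (simp only: F_eq[of N] additive.diff[OF P(1)]) simp
    also have "\<dots> \<in> D N" by (rule D(2)[OF F P(2)[OF l]])
    finally show "f - P l - (\<Sum>k<N. J k (F k)) \<in> D N" .
  qed
  then show ?thesis by blast
qed

text \<open>
  An error of order \<open>N\<close> is \<open>t\<^sup>N\<close> times a series whose constant term is corrected by \<open>base\<close>; multiplied
  by \<open>t\<^sup>N\<close>, an element of \<open>I\<close> stays in \<open>I\<close>.
\<close>

lemma complement_lift1:
  fixes P :: "'l::ring_1 \<Rightarrow> 'a::ring_1"
  assumes P: "Modules.additive P" and I: "ideal I type_ring"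
    and base: "\<And>f. \<exists>l. \<exists>i\<in>I. f - P l = i $ 0"
  shows "\<exists>l. f - fps_map P l \<in> adic_closure1 I"
proof -
  note I' = ideal_type_ringD[OF I]
  have "\<exists>l. \<forall>N. \<exists>i\<in>I. f - fps_map P l - i \<in> order_ge1 N"
  proof (rule successive_approximation[where E = order_ge1])
    show "Modules.additive (fps_map P)" by (rule additive_fps_map[OF P])
    show "\<exists>l. \<forall>N. l - (\<Sum>k<N. s k) \<in> order_ge1 N" if s: "\<And>N. s N \<in> order_ge1 N" for s :: "nat \<Rightarrow> 'l fps"
    proof (intro exI allI)
      fix N
      have "(\<Sum>k\<le>i. s k $ i) = (\<Sum>k<N. s k $ i)" if "i < N" for i
        by (rule sum.mono_neutral_left) (use s that in \<open>auto simp: order_ge1_def\<close>)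
      then show "Abs_fps (\<lambda>i. \<Sum>k\<le>i. s k $ i) - (\<Sum>k<N. s k) \<in> order_ge1 N"
        by (simp add: order_ge1_def fps_sum_nth)
    qed
    show "\<exists>l\<in>order_ge1 N. \<exists>i\<in>I. f - fps_map P l - i \<in> order_ge1 (Suc N)" if f: "f \<in> order_ge1 N" for N f
    proof -
      obtain l i where i: "i \<in> I" and eq: "f $ N - P l = i $ 0" using base by blast
      have "f - fps_map P (fps_X ^ N * fps_const l) - fps_X ^ N * i \<in> order_ge1 (Suc N)"
        using f eq by (auto simp: order_ge1_def fps_X_power_mult_nth less_Suc_eq additive.zero[OF P])
      moreover have "fps_X ^ N * fps_const l \<in> order_ge1 N" by (simp add: order_ge1_def fps_X_power_mult_nth)
      ultimately show ?thesis using I'(4)[OF i] by blast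
    qed
  qed (auto simp: order_ge1_def I' additive.zero[OF P])
  then show ?thesis by (simp only: adic_closure1_eq mem_Collect_eq)
qed

lemma complement_lift2:
  fixes P :: "'l::ring_1 \<Rightarrow> 'a::ring_1"
  assumes P: "Modules.additive P" and I: "ideal I type_ring"
    and base: "\<And>f. \<exists>l. \<exists>i\<in>I. f - P l = i $ 0 $ 0"
  shows "\<exists>l. f - fps_map (fps_map P) l \<in> adic_closure2 I"
proof -
  note I' = ideal_type_ringD[OF I]
  have "\<exists>l. \<forall>N. \<exists>i\<in>I. f - fps_map (fps_map P) l - i \<in> order_ge N"
  proof (rule successive_approximation[where E = order_ge])
    show "Modules.additive (fps_map (fps_map P))" by (intro additive_fps_map P)
    show "\<exists>l. \<forall>N. l - (\<Sum>k<N. s k) \<in> order_ge N" if s: "\<And>N. s N \<in> order_ge N" for s :: "nat \<Rightarrow> 'l fps fps"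
    proof (intro exI allI)
      fix N
      have "(\<Sum>k\<le>i + j. s k $ j $ i) = (\<Sum>k<N. s k $ j $ i)" if "i + j < N" for i j
        by (rule sum.mono_neutral_left) (use s that in \<open>auto simp: order_ge_def\<close>)
      then show "Abs_fps (\<lambda>j. Abs_fps (\<lambda>i. \<Sum>k\<le>i + j. s k $ j $ i)) - (\<Sum>k<N. s k) \<in> order_ge N"
        by (simp add: order_ge_def fps_sum_nth)
    qed
    show "\<exists>l\<in>order_ge N. \<exists>i\<in>I. f - fps_map (fps_map P) l - i \<in> order_ge (Suc N)"
      if f: "f \<in> order_ge N" for N f
    proof -
      from base have "\<forall>g. \<exists>l i. i \<in> I \<and> g - P l = i $ 0 $ 0" by blast
      then obtain L J where LJ: "\<And>g. J g \<in> I" "\<And>g. g - P (L g) = J g $ 0 $ 0" by metis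
      \<comment> \<open>The homogeneous part of degree \<open>N\<close> is corrected coefficient by coefficient.\<close>
      define l where "l = Abs_fps (\<lambda>j. Abs_fps (\<lambda>i. if i + j = N then L (f $ j $ i) else 0))"
      define u where "u = (\<Sum>a\<le>N. hbar ^ a * hbar' ^ (N - a) * J (f $ (N - a) $ a))"
      have "(\<Sum>a\<in>A. hbar ^ a * hbar' ^ (N - a) * J (f $ (N - a) $ a)) \<in> I" for A
        by (induction A rule: infinite_finite_induct) (auto intro: I' LJ)
      then have "u \<in> I" by (simp add: u_def)
      moreover have "l \<in> order_ge N" by (simp add: l_def order_ge_def)
      moreover have "u $ j $ i = (if i + j = N then J (f $ j $ i) $ 0 $ 0 else 0)" if "i + j \<le> N" for i j
      proof -
        have "u $ j $ i = (\<Sum>a\<le>N. if a = i then if i + j = N then J (f $ j $ i) $ 0 $ 0 else 0 else 0)"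
          unfolding u_def fps_sum_nth hbar_monomial_mult_nth using that by (intro sum.cong) auto
        then show ?thesis using that by simp
      qed
      then have "f - fps_map (fps_map P) l - u \<in> order_ge (Suc N)"
        using f LJ(2) by (auto simp: order_ge_def l_def additive.zero[OF P] less_Suc_eq_le le_less
          simp flip: LJ(2))
      ultimately show ?thesis by blast
    qed
  qed (auto simp: order_ge_def I' additive.zero[OF P])
  then show ?thesis by (simp only: adic_closure2_eq mem_Collect_eq)
qed

text \<open>
  The lowest coefficient of \<open>f\<close> only sees the constant terms of the deformed maps \<open>\<rho> m\<close>, and these
  are assumed to separate the coefficients.
\<close>

lemma adic_ext_separates:
  assumes P: "P 0 = 0" and \<rho>: "\<And>m. Modules.additive (\<rho> m)"
    and zero: "\<And>m. adic_ext (\<rho> m) (fps_map P f) = 0"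
    and sep: "\<And>l. (\<And>m. \<rho> m (P l) $ 0 = 0) \<Longrightarrow> l = 0"
  shows "f = 0"
proof -
  have "f $ n = 0" for n
  proof (induction n rule: less_induct)
    case (less n)
    have "\<rho> m (P (f $ n)) $ 0 = 0" for m
    proof -
      have "adic_ext (\<rho> m) (fps_map P f) $ n = (\<Sum>k\<le>n. if k = n then \<rho> m (P (f $ n)) $ 0 else 0)"
        unfolding adic_ext_nth by (intro sum.cong) (auto simp: less P additive.zero[OF \<rho>])
      then show ?thesis using zero[of m] by simp
    qed
    then show ?case by (rule sep)
  qed
  then show ?thesis by (simp add: fps_eq_iff)
qed


section \<open>Ordered monomials span\<close>

text \<open>
  The family \<open>l\<close> of complex numbers stands for the linear combination of the ordered monomials
  \<open>y\<^sup>a h\<^sup>b x\<^sup>c\<close> with these coefficients.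
\<close>

definition pbw_lin ::
  "(complex \<Rightarrow> 'r::ring_1) \<Rightarrow> 'r \<Rightarrow> 'r \<Rightarrow> 'r \<Rightarrow> (nat \<times> nat \<times> nat \<Rightarrow>\<^sub>0 complex) \<Rightarrow> 'r" where
  "pbw_lin \<iota> x y h = linext \<iota> (\<lambda>(a, b, c). y ^ a * h ^ b * x ^ c)"

text \<open>
  The classical reordering argument, for three elements of a ring that satisfy the relations
  of \<open>sl\<^sub>2\<close> modulo an ideal. It is applied to the free algebra on the generators of \<open>U\<close> and also to the
  one with the further generator \<open>C\<close>.
\<close>

locale sl2_relations =
  scalars: complex_scalars \<iota> for \<iota> :: "complex \<Rightarrow> 'r::ring_1" +
  fixes J :: "'r set" and x y h :: 'r
  assumes J: "ideal J type_ring"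
    and hx: "h * x - x * h - 2 * x \<in> J"
    and hy: "h * y - y * h + 2 * y \<in> J"
    and xy: "x * y - y * x - h \<in> J"
begin

lemmas J_closed = ideal_type_ringD[OF J]

definition cong :: "'r \<Rightarrow> 'r \<Rightarrow> bool" (infix \<open>\<approx>\<close> 50) where
  "f \<approx> g \<longleftrightarrow> f - g \<in> J"

lemma cong_refl [simp]: "f \<approx> f"
  by (simp add: cong_def J_closed)

lemma cong_trans [trans]: "f \<approx> g \<Longrightarrow> g \<approx> k \<Longrightarrow> f \<approx> k"
  unfolding cong_def using J_closed(3)[of "f - g" "g - k"] by simp

lemma cong_add: "f \<approx> g \<Longrightarrow> f' \<approx> g' \<Longrightarrow> f + f' \<approx> g + g'"
  unfolding cong_def using J_closed(3)[of "f - g" "f' - g'"] by (simp add: algebra_simps)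

lemma cong_mult_left: "f \<approx> g \<Longrightarrow> r * f \<approx> r * g"
  unfolding cong_def using J_closed(4)[of "f - g" r] by (simp add: algebra_simps)

lemma cong_mult_right: "f \<approx> g \<Longrightarrow> f * r \<approx> g * r"
  unfolding cong_def using J_closed(5)[of "f - g" r] by (simp add: algebra_simps)

lemma xy_cong: "x * y \<approx> y * x + h"
  using xy by (simp add: cong_def algebra_simps)

lemma hy_cong: "h * y \<approx> y * (h - 2)"
  using hy by (simp add: cong_def algebra_simps mult_2 mult_2_right)

lemma xh_cong: "x * h \<approx> (h - 2) * x"
  using J_closed(6)[OF hx] by (simp add: cong_def algebra_simps mult_2 mult_2_right)

lemma of_nat_central: "of_nat k * f = f * (of_nat k :: 'r)"
  by (induction k) (simp_all add: algebra_simps)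

lemma h_y_power: "h * y ^ a \<approx> y ^ a * (h - 2 * of_nat a)"
proof (induction a)
  case (Suc a)
  have "h * y ^ Suc a \<approx> y * (h - 2) * y ^ a"
    using cong_mult_right[OF hy_cong, of "y ^ a"] by (simp add: mult.assoc)
  also have "y * (h - 2) * y ^ a = y * (h * y ^ a) - 2 * y ^ Suc a"
    by (simp add: algebra_simps mult_2 mult_2_right)
  also have "\<dots> \<approx> y * (y ^ a * (h - 2 * of_nat a)) - 2 * y ^ Suc a"
    using cong_add[OF cong_mult_left[OF Suc, of y] cong_refl[of "- 2 * y ^ Suc a"]] by simp
  also have "y * (y ^ a * (h - 2 * of_nat a)) - 2 * y ^ Suc a = y ^ Suc a * (h - 2 * of_nat (Suc a))"
    by (simp add: algebra_simps mult_2 mult_2_right)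
  finally show ?case .
qed simp

lemma x_h_power: "x * h ^ b \<approx> (h - 2) ^ b * x"
proof (induction b)
  case (Suc b)
  have "x * h ^ Suc b \<approx> (h - 2) * (x * h ^ b)"
    using cong_mult_right[OF xh_cong, of "h ^ b"] by (simp add: mult.assoc)
  also have "\<dots> \<approx> (h - 2) * ((h - 2) ^ b * x)" by (rule cong_mult_left[OF Suc])
  finally show ?case by (simp add: mult.assoc)
qed simp

lemma x_y_power: "x * y ^ a \<approx> y ^ a * x + of_nat a * y ^ (a - 1) * (h - of_nat (a - 1))"
proof (induction a)
  case (Suc a)
  have "x * y ^ Suc a \<approx> y * (x * y ^ a) + h * y ^ a"
    using cong_mult_right[OF xy_cong, of "y ^ a"] by (simp add: algebra_simps)
  also have "\<dots> \<approx> y * (y ^ a * x + of_nat a * y ^ (a - 1) * (h - of_nat (a - 1))) +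
      y ^ a * (h - 2 * of_nat a)"
    by (intro cong_add cong_mult_left Suc h_y_power)
  also have "y * (y ^ a * x + of_nat a * y ^ (a - 1) * (h - of_nat (a - 1))) +
      y ^ a * (h - 2 * of_nat a) = y ^ Suc a * x + of_nat (Suc a) * y ^ a * (h - of_nat a)"
  proof (cases a)
    case (Suc d)
    define N where "N = (of_nat d :: 'r)"
    define Z where "Z = y * y ^ d"
    have N: "y * (N * t) = N * (y * t)" for t
      unfolding N_def by (metis mult.assoc of_nat_central)
    have Z: "Z * (N * t) = N * (Z * t)" "Z * N = N * Z" for t
      unfolding N_def by (metis mult.assoc of_nat_central, simp add: of_nat_central)
    have "y * ((1 + N) * y ^ d * (h - N)) = (1 + N) * Z * (h - N)"
      unfolding Z_def by (simp add: distrib_left distrib_right N mult.assoc)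
    moreover have "(1 + N) * Z * (h - N) + Z * (h - 2 * (1 + N)) = (1 + (1 + N)) * Z * (h - (1 + N))"
    proof -
      have "(1 + N) * Z * (h - N) = Z * h + N * (Z * h) - N * Z - N * (N * Z)"
        by (simp add: distrib_right right_diff_distrib mult.assoc Z diff_add_eq add_diff_eq algebra_simps)
      moreover have "Z * (h - 2 * (1 + N)) = Z * h - Z - Z - N * Z - N * Z"
        by (simp add: right_diff_distrib distrib_left mult_2 mult_2_right Z algebra_simps)
      moreover have "(1 + (1 + N)) * Z * (h - (1 + N)) = Z * h + Z * h + N * (Z * h) - Z - Z - N * Z - N * Z - N * Z - N * (N * Z)"
        by (simp add: distrib_right right_diff_distrib distrib_left mult.assoc mult_2 Z algebra_simps)
      ultimately show ?thesis by simp
    qed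
    ultimately show ?thesis
      by (simp add: Suc N_def[symmetric] Z_def distrib_left mult.assoc add.assoc)
  qed simp
  finally show ?case by simp
qed simp

abbreviation P :: "(nat \<times> nat \<times> nat \<Rightarrow>\<^sub>0 complex) \<Rightarrow> 'r" where
  "P \<equiv> pbw_lin \<iota> x y h"

definition ordered_span :: "'r set" where
  "ordered_span = {f. \<exists>l. f \<approx> P l}"

lemma additive_P: "Modules.additive P"
  unfolding pbw_lin_def by (rule scalars.additive_linext)

lemma span_cong: "f \<approx> g \<Longrightarrow> g \<in> ordered_span \<Longrightarrow> f \<in> ordered_span"
  unfolding ordered_span_def using cong_trans by blast

lemma span_add: "f \<in> ordered_span \<Longrightarrow> g \<in> ordered_span \<Longrightarrow> f + g \<in> ordered_span"
proof -
  assume "f \<in> ordered_span" "g \<in> ordered_span"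
  then obtain l l' where "f \<approx> P l" "g \<approx> P l'" by (auto simp: ordered_span_def)
  then have "f + g \<approx> P (l + l')" by (simp add: additive.add[OF additive_P] cong_add)
  then show "f + g \<in> ordered_span" by (auto simp: ordered_span_def)
qed

lemma span_scalar: "f \<in> ordered_span \<Longrightarrow> \<iota> c * f \<in> ordered_span"
proof -
  assume "f \<in> ordered_span"
  then obtain l where "f \<approx> P l" by (auto simp: ordered_span_def)
  then have "\<iota> c * f \<approx> P (sc c * l)"
    by (simp add: pbw_lin_def scalars.linext_scalar cong_mult_left)
  then show "\<iota> c * f \<in> ordered_span" by (auto simp: ordered_span_def)
qed

lemma span_sum: "(\<And>i. i \<in> A \<Longrightarrow> f i \<in> ordered_span) \<Longrightarrow> sum f A \<in> ordered_span"
proof (induction A rule: infinite_finite_induct)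
  have "0 \<in> ordered_span"
    unfolding ordered_span_def using additive.zero[OF additive_P] cong_refl[of 0] by (metis mem_Collect_eq)
  then show "sum f {} \<in> ordered_span" "infinite A \<Longrightarrow> sum f A \<in> ordered_span" for A by simp_all
qed (simp add: span_add)

lemma span_of_int: "f \<in> ordered_span \<Longrightarrow> of_int k * f \<in> ordered_span"
  using span_scalar[of f "of_int k"] by (simp add: scalars.of_int)

lemma span_monomial: "y ^ a * h ^ b * x ^ c \<in> ordered_span"
  unfolding ordered_span_def
  by (auto simp: pbw_lin_def scalars.one intro!: exI[of _ "single (a, b, c) 1"])

lemma span_diff: "f \<in> ordered_span \<Longrightarrow> g \<in> ordered_span \<Longrightarrow> f - g \<in> ordered_span"
  using span_add[of f "- g"] span_of_int[of g "-1"] by simp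

text \<open>
  Moving \<open>x\<close> through \<open>h\<^sup>b\<close> produces \<open>(h - 2)\<^sup>b\<close>. The factor \<open>h\<^sup>m\<close> makes the induction work.
\<close>

lemma span_shifted: "y ^ a * (h - 2) ^ b * h ^ m * x ^ c \<in> ordered_span"
proof (induction b arbitrary: m)
  case (Suc b)
  have "y ^ a * (h - 2) ^ Suc b * h ^ m * x ^ c =
      y ^ a * (h - 2) ^ b * h ^ Suc m * x ^ c - of_int 2 * (y ^ a * (h - 2) ^ b * h ^ m * x ^ c)"
  proof -
    have "y ^ a * (h - 2) ^ Suc b * h ^ m * x ^ c = y ^ a * (h - 2) ^ b * ((h - 2) * h ^ m) * x ^ c"
      by (simp only: power_Suc2 mult.assoc)
    also have "(h - 2) * h ^ m = h ^ Suc m - 2 * h ^ m"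
      by (simp add: left_diff_distrib)
    finally show ?thesis
      by (simp add: right_diff_distrib left_diff_distrib mult_2 distrib_left distrib_right)
  qed
  then show ?case using Suc span_diff span_of_int by metis
qed (simp add: span_monomial)

lemma span_left_mult:
  assumes z: "\<And>a b c. z * (y ^ a * h ^ b * x ^ c) \<in> ordered_span" and f: "f \<in> ordered_span"
  shows "z * f \<in> ordered_span"
proof -
  obtain l where "f \<approx> P l" using f by (auto simp: ordered_span_def)
  moreover have "z * P l \<in> ordered_span"
  proof -
    have "z * P l = (\<Sum>(a, b, c)\<in>keys l.
        \<iota> (lookup l (a, b, c)) * (z * (y ^ a * h ^ b * x ^ c)))"
      unfolding pbw_lin_def linext_def sum_distrib_left
      by (intro sum.cong refl) (clarsimp, metis scalars.central mult.assoc)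
    also have "\<dots> \<in> ordered_span" by (rule span_sum) (auto intro!: span_scalar z)
    finally show ?thesis .
  qed
  ultimately show ?thesis using cong_mult_left span_cong by blast
qed

lemma span_left_generators:
  assumes f: "f \<in> ordered_span"
  shows "y * f \<in> ordered_span" "h * f \<in> ordered_span" "x * f \<in> ordered_span"
proof -
  have "y * (y ^ a * h ^ b * x ^ c) \<in> ordered_span" for a b c
    using span_monomial[of "Suc a" b c] by (simp add: mult.assoc)
  then show "y * f \<in> ordered_span" by (rule span_left_mult[OF _ f])
  have hh: "y ^ a * (h - of_nat k) * h ^ b * x ^ c \<in> ordered_span" for a b c k
  proof -
    have "y ^ a * (h - of_nat k) * h ^ b * x ^ c = y ^ a * h ^ Suc b * x ^ c - of_int (int k) * (y ^ a * h ^ b * x ^ c)"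
      by (simp add: algebra_simps of_nat_central)
    then show ?thesis using span_monomial span_diff span_of_int by metis
  qed
  have "h * (y ^ a * h ^ b * x ^ c) \<in> ordered_span" for a b c
  proof (rule span_cong)
    show "h * (y ^ a * h ^ b * x ^ c) \<approx> y ^ a * (h - of_nat (2 * a)) * h ^ b * x ^ c"
      using cong_mult_right[OF h_y_power, of a "h ^ b * x ^ c"] by (simp add: mult.assoc)
  qed (rule hh)
  then show "h * f \<in> ordered_span" by (rule span_left_mult[OF _ f])
  have "x * (y ^ a * h ^ b * x ^ c) \<in> ordered_span" for a b c
  proof (rule span_cong)
    have "x * (y ^ a * h ^ b * x ^ c) \<approx> (y ^ a * x + of_nat a * y ^ (a - 1) * (h - of_nat (a - 1))) * (h ^ b * x ^ c)"
      using cong_mult_right[OF x_y_power, of a "h ^ b * x ^ c"] by (simp add: mult.assoc)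
    also have "\<dots> = y ^ a * (x * h ^ b) * x ^ c + of_int (int a) * (y ^ (a - 1) * (h - of_nat (a - 1)) * h ^ b * x ^ c)"
      by (simp add: distrib_right mult.assoc)
    also have "\<dots> \<approx> y ^ a * ((h - 2) ^ b * x) * x ^ c + of_int (int a) * (y ^ (a - 1) * (h - of_nat (a - 1)) * h ^ b * x ^ c)"
      by (intro cong_add cong_refl cong_mult_right cong_mult_left x_h_power)
    also have "y ^ a * ((h - 2) ^ b * x) * x ^ c = y ^ a * (h - 2) ^ b * h ^ 0 * x ^ Suc c"
      by (simp add: mult.assoc)
    finally show "x * (y ^ a * h ^ b * x ^ c) \<approx> y ^ a * (h - 2) ^ b * h ^ 0 * x ^ Suc c +
        of_int (int a) * (y ^ (a - 1) * (h - of_nat (a - 1)) * h ^ b * x ^ c)" .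
  qed (intro span_add span_of_int span_shifted hh)
  then show "x * f \<in> ordered_span" by (rule span_left_mult[OF _ f])
qed

lemma span_one: "1 \<in> ordered_span"
  using span_monomial[of 0 0 0] by simp

end

text \<open>
  The ordered span is only known to be stable under left multiplication by the generators; words are
  built up from the right.
\<close>

lemma free_algebra_induct_left:
  fixes S :: "'x free_algebra set"
  assumes one: "1 \<in> S" and add: "\<And>f g. f \<in> S \<Longrightarrow> g \<in> S \<Longrightarrow> f + g \<in> S"
    and scal: "\<And>c f. f \<in> S \<Longrightarrow> scal c * f \<in> S"
    and var: "\<And>z f. f \<in> S \<Longrightarrow> var z * f \<in> S"
  shows "f \<in> S"
proof -
  have word: "single (Word w) 1 \<in> S" for w
  proof (induction w)
    case Nil
    show ?case using one by (simp flip: single_one add: zero_free_monoid_def)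
  next
    case (Cons z w)
    have "single (Word (z # w)) 1 = var z * single (Word w) (1::complex)"
      by (simp add: var_def mult_single plus_free_monoid_def)
    then show ?case using var[OF Cons] by simp
  qed
  have single: "single w c \<in> S" for w c
    using scal[OF word, of c "letters w"] by (simp add: scal_eq_sc)
  have zero: "0 \<in> S" using scal[OF one, of 0] by (simp add: scal_eq_sc)
  have "(\<Sum>k\<in>A. single k (lookup f k)) \<in> S" for A
    by (induction A rule: infinite_finite_induct) (auto intro: add single zero)
  then show ?thesis by (metis poly_mapping_eq_sum_single)
qed


section \<open>Linear operators on finitely supported sequences\<close>

text \<open>
  The linear endomorphisms of the space \<open>V\<close> with basis \<open>m\<^sub>0, m\<^sub>1, \<dots>\<close>, where \<open>m\<^sub>k\<close> is \<open>single k 1\<close>. They are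
  made a ring type so that power series with such coefficients are available.
\<close>

typedef endo = "{f :: (nat \<Rightarrow>\<^sub>0 complex) \<Rightarrow> (nat \<Rightarrow>\<^sub>0 complex).
    Modules.additive f \<and> (\<forall>c v. f (sc c * v) = sc c * f v)}"
  morphisms app Endo
  by (rule exI[of _ "\<lambda>v. v"]) (auto simp: Modules.additive_def)

lemma app_add: "app T (v + w) = app T v + app T w"
  using app[of T] by (auto simp: additive.add)

lemma additive_app: "Modules.additive (app T)"
  using app[of T] by simp

lemma app_scalar: "app T (sc c * v) = sc c * app T v"
  using app[of T] by auto

lemma app_Endo:
  "(\<And>v w. f (v + w) = f v + f w) \<Longrightarrow> (\<And>c v. f (sc c * v) = sc c * f v) \<Longrightarrow> app (Endo f) = f"
  by (rule Endo_inverse) (auto simp: Modules.additive_def)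

lemmas app_linear = app_add app_scalar additive.zero[OF additive_app]
  additive.minus[OF additive_app] additive.diff[OF additive_app]

instantiation endo :: ring_1
begin

definition "0 = Endo (\<lambda>v. 0)"
definition "1 = Endo (\<lambda>v. v)"
definition "S + T = Endo (\<lambda>v. app S v + app T v)"
definition "S - T = Endo (\<lambda>v. app S v - app T v)"
definition "- T = Endo (\<lambda>v. - app T v)"
definition "S * T = Endo (\<lambda>v. app S (app T v))"

lemma app_simps [simp]:
  "app 0 v = 0" "app 1 v = v" "app (S + T) v = app S v + app T v"
  "app (S - T) v = app S v - app T v" "app (- T) v = - app T v" "app (S * T) v = app S (app T v)"
  unfolding zero_endo_def one_endo_def plus_endo_def minus_endo_def uminus_endo_def times_endo_def
  by (subst app_Endo; simp add: app_linear distrib_left right_diff_distrib add_ac)+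

lemma endo_eqI: "(\<And>v. app S v = app T v) \<Longrightarrow> S = T"
  by (simp add: app_inject[symmetric] fun_eq_iff)

instance
proof
  show "(0::endo) \<noteq> 1"
  proof
    assume "(0::endo) = 1"
    then have "app 0 (1 :: nat \<Rightarrow>\<^sub>0 complex) = app 1 1" by simp
    then show False by simp
  qed
qed (rule endo_eqI; simp add: app_linear algebra_simps)+

end

lemma app_sum: "app (sum T A) v = (\<Sum>a\<in>A. app (T a) v)"
  by (induction A rule: infinite_finite_induct) simp_all

lemma endo_eqI_single:
  assumes "\<And>k. app S (single k 1) = app T (single k 1)"
  shows "S = T"
proof (rule endo_eqI)
  fix v
  have "app S (single k c) = app T (single k c)" for k c
    using app_scalar[of S c "single k 1"] app_scalar[of T c "single k 1"] assms by simp
  then show "app S v = app T v" by (rule additive_eqI_single[OF additive_app additive_app])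
qed

definition scE :: "complex \<Rightarrow> endo" where
  "scE c = Endo (\<lambda>v. sc c * v)"

lemma app_scE [simp]: "app (scE c) v = sc c * v"
proof -
  have "sc a * (sc c * v) = sc c * (sc a * v)" for a v
    by (rule poly_mapping_eqI) simp
  then show ?thesis unfolding scE_def by (subst app_Endo) (simp_all add: distrib_left)
qed

lemma central_hom_scE: "central_hom scE"
proof unfold_locales
  show "scE (a * b) = scE a * scE b" for a b
    by (rule endo_eqI) (simp add: mult_single mult.assoc[symmetric])
qed (rule endo_eqI; simp add: app_linear single_add distrib_right)+

interpretation scE: complex_scalars scE
  by (simp add: complex_scalars_iff central_hom_scE)

definition endo_of :: "(nat \<Rightarrow> (nat \<Rightarrow>\<^sub>0 complex)) \<Rightarrow> endo" where
  "endo_of b = Endo (linext sc b)"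

lemma app_endo_of: "app (endo_of b) = linext sc b"
  unfolding endo_of_def by (rule app_Endo) (simp_all add: sc.linext_add sc.linext_scalar)

definition raise :: endo where
  "raise = endo_of (\<lambda>k. single (Suc k) 1)"

definition diagonal :: "(nat \<Rightarrow> complex) \<Rightarrow> endo" where
  "diagonal w = endo_of (\<lambda>k. single k (w k))"

definition lower :: "(nat \<Rightarrow> complex) \<Rightarrow> endo" where
  "lower w = endo_of (\<lambda>k. if k = 0 then 0 else single (k - 1) (w k))"

lemma app_raise [simp]: "app raise (single k c) = single (Suc k) c"
  by (simp add: raise_def app_endo_of)

lemma app_diagonal [simp]: "app (diagonal w) (single k c) = single k (w k * c)"
  by (simp add: diagonal_def app_endo_of mult.commute)

lemma app_lower [simp]:
  "app (lower w) (single k c) = (if k = 0 then 0 else single (k - 1) (w k * c))"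
  by (simp add: lower_def app_endo_of mult.commute)

lemma lookup_diagonal: "lookup (app (diagonal w) v) k = w k * lookup v k"
  by (rule additive_eqI_single[of "\<lambda>v. lookup (app (diagonal w) v) k"])
    (unfold_locales, auto simp: app_add lookup_add lookup_single when_def algebra_simps)

lemma app_raise_power [simp]:
  "app (raise ^ a) (single k c) = single (a + k) c"
  by (induction a) simp_all

lemma app_diagonal_power [simp]:
  "app (diagonal w ^ b) (single k c) = single k (w k ^ b * c)"
  by (induction b) (simp_all add: mult.assoc)

lemma app_lower_power [simp]:
  "app (lower w ^ c) (single k d) =
     (if c \<le> k then single (k - c) ((\<Prod>i<c. w (k - i)) * d) else 0)"
  by (induction c) (auto simp: app_linear not_le mult.assoc mult.left_commute)

text \<open>
  The action of \<open>H\<close> on the Verma module of highest weight \<open>n\<close>.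
\<close>

definition weight_op :: "int \<Rightarrow> endo" where
  "weight_op n = diagonal (\<lambda>k. of_int (n - 2 * int k))"


section \<open>Ordered monomials act independently on the classical Verma modules\<close>

text \<open>
  Let \<open>c\<close> be the least exponent of \<open>X\<^sup>+\<close> in the combination. On \<open>m\<^sub>c\<close> all larger powers of \<open>X\<^sup>+\<close>
  vanish, and \<open>(X\<^sup>+)\<^sup>c m\<^sub>c\<close> is a multiple \<open>K n\<close> of \<open>m\<^sub>0\<close>, with \<open>K n \<noteq> 0\<close> when \<open>n \<ge> c\<close>. On \<open>m\<^sub>0\<close> a power
  \<open>H\<^sup>b\<close> is \<open>n\<^sup>b\<close>, so that the coefficient of \<open>m\<^sub>a\<close> in the value is \<open>K n\<close> times a polynomial \<open>q\<close> in \<open>n\<close> whose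
  coefficients are those of the monomials \<open>(X\<^sup>-)\<^sup>a H\<^sup>b (X\<^sup>+)\<^sup>c\<close>. It has infinitely many zeros.
\<close>

lemma pbw_independent_on_vermas:
  assumes "\<And>n::int. pbw_lin scE (lower (\<lambda>k. of_nat k * of_int (n - int k + 1))) raise (weight_op n) l = 0"
  shows "l = 0"
proof -
  let ?w = "\<lambda>n k. of_nat k * of_int (n - int k + 1) :: complex"
  have "\<forall>a b. lookup l (a, b, c) = 0" for c
  proof (induction c rule: less_induct)
    case (less c)
    show ?case
    proof
      fix a
      define K where "K n = (\<Prod>i<c. ?w n (c - i))" for n
      define B where "B = (\<lambda>(a, b, c). b) ` keys l"
      define q where "q = (\<Sum>b\<in>B. Polynomial.monom (lookup l (a, b, c)) b)"
      have finB: "finite B" by (simp add: B_def)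
      have K: "K n \<noteq> 0" if "n \<ge> int c" for n
      proof -
        have "n - int (c - i) + 1 \<noteq> 0" if "i < c" for i using \<open>n \<ge> int c\<close> by linarith
        then show ?thesis unfolding K_def by (auto simp del: of_int_add of_int_diff simp: prod_zero_iff)
      qed
      have root: "poly q (of_int n) = 0" if n: "n \<ge> int c" for n
      proof -
        let ?t = "\<lambda>(a', b, c'). lookup l (a', b, c') *
            (if a' = a \<and> c' = c then of_int n ^ b * K n else 0)"
        have summand: "lookup (app (scE (lookup l (a', b, c')) *
              (raise ^ a' * weight_op n ^ b * lower (?w n) ^ c')) (single c 1)) a =
            ?t (a', b, c')" for a' b c'
        proof (cases "c' < c")
          case True
          then show ?thesis using less by simp
        next
          case False
          then show ?thesis
            by (cases "c' = c") (auto simp: weight_op_def K_def lookup_single when_def app_linear)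
        qed
        have "0 = lookup (app (pbw_lin scE (lower (?w n)) raise (weight_op n) l) (single c 1)) a"
          by (simp only: assms app_simps lookup_zero)
        also have "\<dots> = (\<Sum>k\<in>keys l. ?t k)"
          unfolding pbw_lin_def linext_def app_sum lookup_sum
          by (intro sum.cong refl) (use summand in auto)
        also have "\<dots> = (\<Sum>k\<in>(\<lambda>b. (a, b, c)) ` B. ?t k)"
        proof (rule sum.mono_neutral_cong)
          show "?t k = 0" if "k \<in> keys l - (\<lambda>b. (a, b, c)) ` B" for k
          proof -
            obtain a' b' c' where k: "k = (a', b', c')" by (cases k)
            then have "b' \<in> B" using that by (force simp: B_def)
            then show ?thesis using that by (auto simp: k)
          qed
        qed (auto simp: finB in_keys_iff)
        also have "\<dots> = K n * poly q (of_int n)"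
          by (subst sum.reindex) (auto simp: inj_on_def q_def poly_sum poly_monom sum_distrib_left mult_ac)
        finally show ?thesis using K[OF n] by simp
      qed
      have "q = 0"
      proof (rule ccontr)
        assume "q \<noteq> 0"
        then have "finite {z. poly q z = 0}" by (rule poly_roots_finite)
        moreover have "(of_int :: int \<Rightarrow> complex) ` {int c..} \<subseteq> {z. poly q z = 0}" using root by auto
        ultimately have "finite ((of_int :: int \<Rightarrow> complex) ` {int c..})" by (rule rev_finite_subset)
        then have "finite {int c..}" by (rule finite_imageD) (simp add: inj_on_def)
        then show False by (simp add: infinite_Ici)
      qed
      show "\<forall>b. lookup l (a, b, c) = 0"
      proof
        fix b
        show "lookup l (a, b, c) = 0"
        proof (cases "b \<in> B")
          case True
          have "Polynomial.coeff q b = (\<Sum>b'\<in>B. if b' = b then lookup l (a, b, c) else 0)"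
            unfolding q_def coeff_sum by (intro sum.cong) auto
          with True finB \<open>q = 0\<close> show ?thesis by simp
        next
          case False
          then show ?thesis by (force simp: B_def in_keys_iff image_iff)
        qed
      qed
    qed
  qed
  then show ?thesis by (intro poly_mapping_eqI) auto
qed


section \<open>The structure functions\<close>

lemma exact_quot_eq: "b \<noteq> 0 \<Longrightarrow> q * b = a \<Longrightarrow> exact_quot a b = q"
  unfolding exact_quot_def by (rule the_equality) auto

text \<open>
  \<open>\<Sum>\<^sub>k a\<^sub>k w\<^sup>k\<close> for a series \<open>w\<close> in \<open>h,h'\<close> without constant term, with the same truncation as in
  \<^const>\<open>exp2\<close>.
\<close>

definition subst2 :: "(nat \<Rightarrow> 'a) \<Rightarrow> 'a fps fps \<Rightarrow> 'a::comm_ring_1 fps fps" where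
  "subst2 a w = Abs_fps (\<lambda>j. Abs_fps (\<lambda>i. \<Sum>k\<le>i + j. a k * (w ^ k) $ j $ i))"

lemma exp2_eq_subst2: "exp2 \<iota> w = subst2 (\<lambda>k. \<iota> (1 / fact k)) w"
  by (simp add: exp2_def subst2_def)

lemma power_low_order:
  fixes w :: "'a::comm_ring_1 fps fps"
  assumes "w $ 0 $ 0 = 0"
  shows "i + j < k \<Longrightarrow> (w ^ k) $ j $ i = 0"
proof (induction k arbitrary: i j)
  case (Suc k)
  have "w $ p $ q * (w ^ k) $ (j - p) $ (i - q) = 0" if "p \<le> j" "q \<le> i" for p q
  proof (cases "p = 0 \<and> q = 0")
    case False
    then have "i - q + (j - p) < k" using Suc.prems that by auto
    then show ?thesis using Suc.IH by simp
  qed (simp add: assms)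
  then show ?case by (simp add: fps_mult_nth2 sum.neutral)
qed simp

lemma subst2_nth:
  assumes "w $ 0 $ 0 = 0" "i + j \<le> N"
  shows "subst2 a w $ j $ i = (\<Sum>k\<le>N. a k * (w ^ k) $ j $ i)"
proof -
  have "(\<Sum>k\<le>i + j. a k * (w ^ k) $ j $ i) = (\<Sum>k\<le>N. a k * (w ^ k) $ j $ i)"
    by (rule sum.mono_neutral_left) (use assms power_low_order[of w] in auto)
  then show ?thesis by (simp add: subst2_def)
qed

lemma subst2_Suc:
  assumes w: "w $ 0 $ 0 = 0"
  shows "subst2 a w = const2 (a 0) + w * subst2 (\<lambda>k. a (Suc k)) w"
proof (intro fps_ext)
  fix j i :: nat
  let ?N = "i + j"
  have "(w * subst2 (\<lambda>k. a (Suc k)) w) $ j $ i =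
      (\<Sum>p=0..j. \<Sum>q=0..i. \<Sum>k\<le>?N. a (Suc k) * (w $ p $ q * (w ^ k) $ (j - p) $ (i - q)))"
    unfolding fps_mult_nth2
    by (intro sum.cong refl) (subst subst2_nth[OF w, of _ _ ?N], auto simp: sum_distrib_left mult_ac)
  also have "\<dots> = (\<Sum>p=0..j. \<Sum>k\<le>?N. \<Sum>q=0..i. a (Suc k) * (w $ p $ q * (w ^ k) $ (j - p) $ (i - q)))"
    by (intro sum.cong refl sum.swap)
  also have "\<dots> = (\<Sum>k\<le>?N. a (Suc k) * (w ^ Suc k) $ j $ i)"
    by (subst sum.swap) (simp add: fps_mult_nth2 sum_distrib_left)
  finally have *: "(w * subst2 (\<lambda>k. a (Suc k)) w) $ j $ i = (\<Sum>k\<le>?N. a (Suc k) * (w ^ Suc k) $ j $ i)" .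
  have "subst2 a w $ j $ i = (\<Sum>k\<le>Suc ?N. a k * (w ^ k) $ j $ i)"
    by (rule subst2_nth[OF w]) simp
  also have "\<dots> = a 0 * (w ^ 0) $ j $ i + (\<Sum>k\<le>?N. a (Suc k) * (w ^ Suc k) $ j $ i)"
    by (rule sum.atMost_Suc_shift)
  finally show "subst2 a w $ j $ i = (const2 (a 0) + w * subst2 (\<lambda>k. a (Suc k)) w) $ j $ i"
    unfolding fps_add_nth * by (cases "i = 0"; cases "j = 0") simp_all
qed

lemma subst2_nth_0_0: "subst2 a w $ 0 $ 0 = a 0"
  by (simp add: subst2_def)

lemma subst2_diff: "subst2 a w - subst2 b w = subst2 (\<lambda>k. a k - b k) w"
  by (simp add: fps_eq_iff subst2_def sum_subtractf left_diff_distrib)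

lemma subst2_uminus: "subst2 (\<lambda>k. - a k) w = - subst2 a w"
  by (simp add: fps_eq_iff subst2_def sum_negf)

lemma subst2_const_mult: "subst2 a (const2 x * w) = subst2 (\<lambda>k. a k * x ^ k) w"
  by (simp add: fps_eq_iff subst2_def power_mult_distrib fps_const_power mult.assoc)

lemma subst2_map:
  assumes "ring_morphism \<phi>"
  shows "fps_map (fps_map \<phi>) (subst2 a w) = subst2 (\<lambda>k. \<phi> (a k)) (fps_map (fps_map \<phi>) w)"
proof -
  interpret ring_morphism \<phi> by fact
  interpret m: ring_morphism "fps_map (fps_map \<phi>)" by (intro ring_morphism_fps_map) unfold_locales
  have "\<phi> ((w ^ k) $ j $ i) = (fps_map (fps_map \<phi>) w ^ k) $ j $ i" for k j i
    by (simp flip: m.power)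
  then show ?thesis by (simp add: fps_eq_iff subst2_def sum mult)
qed

lemma fps_unit_exists:
  fixes f :: "'a::comm_ring_1 fps fps"
  assumes "f $ 0 $ 0 * u = 1"
  shows "\<exists>g. f * g = 1"
proof -
  have "f $ 0 * fps_right_inverse (f $ 0) u = 1" by (rule fps_right_inverse[OF assms])
  from fps_right_inverse[OF this] show ?thesis ..
qed

text \<open>
  \<open>sinh_div a x z\<close> is \<open>(exp (xz) - exp (-xz)) / z\<close>.
\<close>

definition sinh_div :: "(complex \<Rightarrow> 'a::comm_ring_1) \<Rightarrow> 'a \<Rightarrow> 'a fps fps \<Rightarrow> 'a fps fps" where
  "sinh_div \<iota> x z = subst2 (\<lambda>k. \<iota> (1 / fact (Suc k)) * (x ^ Suc k - (- x) ^ Suc k)) z"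

lemma sinh_div_times:
  assumes "z $ 0 $ 0 = 0"
  shows "sinh_div \<iota> x z * z = exp2 \<iota> (const2 x * z) - exp2 \<iota> (- (const2 x * z))"
proof -
  have m: "- (const2 x * z) = const2 (- x) * z"
    by (simp flip: fps_const_neg)
  have "exp2 \<iota> (const2 x * z) - exp2 \<iota> (- (const2 x * z)) =
      subst2 (\<lambda>k. \<iota> (1 / fact k) * (x ^ k - (- x) ^ k)) z"
    by (simp only: m exp2_eq_subst2 subst2_const_mult subst2_diff right_diff_distrib)
  also have "\<dots> = z * sinh_div \<iota> x z"
    by (subst subst2_Suc[OF assms]) (simp add: sinh_div_def)
  finally show ?thesis by (simp add: mult.commute)
qed

lemma sinh_div_nth_0_0: "ring_morphism \<iota> \<Longrightarrow> sinh_div \<iota> x z $ 0 $ 0 = x + x"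
  by (simp add: sinh_div_def subst2_nth_0_0 ring_morphism.one)

lemma sinh_div_unit:
  assumes "ring_morphism \<iota>"
  obtains u where "sinh_div \<iota> 1 z * u = 1"
proof -
  interpret ring_morphism \<iota> by fact
  have "(1 + 1) * \<iota> (1/2) = \<iota> (1/2 + 1/2)" by (simp only: add distrib_right mult_1)
  then have "sinh_div \<iota> 1 z $ 0 $ 0 * \<iota> (1/2) = 1"
    by (simp add: sinh_div_nth_0_0[OF assms] one)
  then show ?thesis using fps_unit_exists that by blast
qed

lemma sinh_div_uminus: "sinh_div \<iota> (- x) z = - sinh_div \<iota> x z"
proof -
  have "\<iota> (1 / fact (Suc k)) * ((- x) ^ Suc k - (- (- x)) ^ Suc k) =
      - (\<iota> (1 / fact (Suc k)) * (x ^ Suc k - (- x) ^ Suc k))" for k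
    by (simp only: minus_minus mult_minus_right[symmetric] minus_diff_eq)
  then show ?thesis by (simp only: sinh_div_def subst2_uminus)
qed

text \<open>
  The series \<open>h + h'{x}\<^sub>Q\<close>, whose exponential is \<open>Q T\<^bsup>{x}\<^esup>\<close>.
\<close>

definition qt_exponent :: "(complex \<Rightarrow> 'a::comm_ring_1) \<Rightarrow> nat \<Rightarrow> 'a \<Rightarrow> 'a fps fps" where
  "qt_exponent \<iota> g x = hbar + hbar' * curly \<iota> g x"

lemma qt_exponent_nth_0: "qt_exponent \<iota> g x $ 0 = fps_X"
  by (simp add: qt_exponent_def hbar_def hbar'_def)

lemma qt_exponent_nth_0_0: "qt_exponent \<iota> g x $ 0 $ 0 = 0"
  by (simp add: qt_exponent_nth_0)

text \<open>
  Writing \<open>z\<close> for the exponent, numerator and denominator are \<open>z\<close> times \<open>sinh_div \<iota> x z\<close> and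
  \<open>z\<close> times \<open>sinh_div \<iota> 1 z\<close>, and the latter factor is invertible because its constant term is \<open>2\<close>.
  So both divisions in the definition of \<^const>\<open>qt_bracket\<close> are possible, and the bracket is
  characterised by an equation that every homomorphism of coefficient rings preserves.
\<close>

lemma qt_bracket_mult:
  fixes \<iota> :: "complex \<Rightarrow> 'a::idom"
  assumes "ring_morphism \<iota>"
  shows "qt_bracket \<iota> g x * sinh_div \<iota> 1 (qt_exponent \<iota> g x) = sinh_div \<iota> x (qt_exponent \<iota> g x)"
proof -
  let ?z = "qt_exponent \<iota> g x"
  have z: "?z \<noteq> 0"
  proof
    assume "?z = 0"
    then have "?z $ 0 $ 1 = 0" by simp
    then show False by (simp add: qt_exponent_nth_0)
  qed
  have quot: "exact_quot (exp2 \<iota> (const2 y * ?z) - exp2 \<iota> (- (const2 y * ?z))) ?z = sinh_div \<iota> y ?z" for y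
    using z sinh_div_times[OF qt_exponent_nth_0_0] by (intro exact_quot_eq) auto
  have den: "exact_quot (exp2 \<iota> ?z - exp2 \<iota> (- ?z)) ?z = sinh_div \<iota> 1 ?z"
    using quot[of 1] by (simp del: fps_const_mult)
  obtain u where u: "sinh_div \<iota> 1 ?z * u = 1" using sinh_div_unit[OF assms] by blast
  then have nz: "sinh_div \<iota> 1 ?z \<noteq> 0" by auto
  have "qt_bracket \<iota> g x = exact_quot (sinh_div \<iota> x ?z) (sinh_div \<iota> 1 ?z)"
    unfolding qt_bracket_def Let_def qt_exponent_def[symmetric] quot den ..
  also have "\<dots> = sinh_div \<iota> x ?z * u"
    by (rule exact_quot_eq[OF nz]) (use u in \<open>simp add: mult.assoc mult.commute[of u]\<close>)
  finally show ?thesis using u by (simp add: mult.assoc mult.commute[of u])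
qed

lemma qt_bracket_unique:
  fixes \<iota> :: "complex \<Rightarrow> 'a::idom"
  assumes "ring_morphism \<iota>"
    and "q * sinh_div \<iota> 1 (qt_exponent \<iota> g x) = sinh_div \<iota> x (qt_exponent \<iota> g x)"
  shows "qt_bracket \<iota> g x = q"
proof -
  obtain u where u: "sinh_div \<iota> 1 (qt_exponent \<iota> g x) * u = 1"
    using sinh_div_unit[OF assms(1)] by blast
  then have "sinh_div \<iota> 1 (qt_exponent \<iota> g x) \<noteq> 0" by auto
  then show ?thesis using assms(2) qt_bracket_mult[OF assms(1), of g x] by (metis mult_right_cancel)
qed

lemma qt_bracket_nth_0_0:
  fixes \<iota> :: "complex \<Rightarrow> 'a::idom"
  assumes "ring_morphism \<iota>"
  shows "qt_bracket \<iota> g x $ 0 $ 0 = x"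
proof -
  interpret ring_morphism \<iota> by fact
  have half: "(y + y) * \<iota> (1/2) = y" for y
  proof -
    have "(y + y) * \<iota> (1/2) = y * \<iota> (1/2 + 1/2)" by (simp only: add distrib_right distrib_left)
    then show ?thesis by (simp add: one)
  qed
  define Q where "Q = qt_bracket \<iota> g x $ 0 $ 0"
  have "(qt_bracket \<iota> g x * sinh_div \<iota> 1 (qt_exponent \<iota> g x)) $ 0 $ 0 = x + x"
    by (simp only: qt_bracket_mult[OF assms] sinh_div_nth_0_0[OF assms])
  then have "Q + Q = x + x"
    by (simp only: fps_mult_nth_0 sinh_div_nth_0_0[OF assms] Q_def distrib_left mult_1_right)
  then have "(Q + Q) * \<iota> (1/2) = (x + x) * \<iota> (1/2)" by (rule arg_cong)
  then show ?thesis by (simp only: half Q_def)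
qed

lemma fps_map2_simps:
  assumes "ring_morphism \<phi>"
  shows "fps_map (fps_map \<phi>) (const2 x) = const2 (\<phi> x)"
    "fps_map (fps_map \<phi>) hbar = hbar" "fps_map (fps_map \<phi>) hbar' = hbar'"
proof -
  show "fps_map (fps_map \<phi>) (const2 x) = const2 (\<phi> x)"
    by (auto simp: fps_eq_iff ring_morphism.zero[OF assms])
  show "fps_map (fps_map \<phi>) hbar = hbar"
    using fps_map_hbar_monomial[OF assms, of 1 0] by simp
  show "fps_map (fps_map \<phi>) hbar' = hbar'"
    using fps_map_hbar_monomial[OF assms, of 0 1] by simp
qed

lemma qt_exponent_map:
  fixes \<iota> :: "complex \<Rightarrow> 'a::comm_ring_1" and \<iota>' :: "complex \<Rightarrow> 'b::comm_ring_1"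
  assumes \<phi>: "ring_morphism \<phi>" and \<iota>: "\<And>c. \<phi> (\<iota> c) = \<iota>' c"
  shows "fps_map (fps_map \<phi>) (qt_exponent \<iota> g x) = qt_exponent \<iota>' g (\<phi> x)"
proof -
  interpret \<phi>: ring_morphism \<phi> by fact
  have m: "ring_morphism (fps_map (fps_map \<phi>))" by (intro ring_morphism_fps_map \<phi>)
  interpret m: ring_morphism "fps_map (fps_map \<phi>)" by (rule m)
  have exp2: "fps_map (fps_map \<phi>) (exp2 \<iota> w) = exp2 \<iota>' (fps_map (fps_map \<phi>) w)" for w
    by (simp add: exp2_eq_subst2 subst2_map[OF \<phi>] \<iota>)
  have P: "fps_map (fps_map \<phi>) (P_fun \<iota> g u v) =
      P_fun \<iota>' g (fps_map (fps_map \<phi>) u) (fps_map (fps_map \<phi>) v)" for u v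
    unfolding P_fun_def Let_def
    by (simp only: m.mult m.add m.diff m.power ring_morphism_prod[OF m] fps_map2_simps[OF \<phi>] \<iota>)
  show ?thesis
    unfolding qt_exponent_def curly_def
    by (simp only: m.mult m.add m.uminus P exp2 fps_map2_simps[OF \<phi>])
qed

lemma qt_bracket_map:
  fixes \<iota> :: "complex \<Rightarrow> 'a::idom" and \<iota>' :: "complex \<Rightarrow> 'b::idom"
  assumes \<phi>: "ring_morphism \<phi>" and \<iota>: "\<And>c. \<phi> (\<iota> c) = \<iota>' c" and i: "ring_morphism \<iota>"
  shows "fps_map (fps_map \<phi>) (qt_bracket \<iota> g x) = qt_bracket \<iota>' g (\<phi> x)"
proof -
  interpret \<phi>: ring_morphism \<phi> by fact
  interpret m: ring_morphism "fps_map (fps_map \<phi>)" by (intro ring_morphism_fps_map \<phi>)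
  have i': "ring_morphism \<iota>'"
    using ring_morphism_comp[OF \<phi> i] by (simp add: \<iota>)
  have S: "fps_map (fps_map \<phi>) (sinh_div \<iota> y (qt_exponent \<iota> g x)) = sinh_div \<iota>' (\<phi> y) (qt_exponent \<iota>' g (\<phi> x))" for y
    unfolding sinh_div_def subst2_map[OF \<phi>] qt_exponent_map[OF \<phi> \<iota>]
    by (simp only: \<phi>.hom_simps \<iota>)
  have "fps_map (fps_map \<phi>) (qt_bracket \<iota> g x) * sinh_div \<iota>' 1 (qt_exponent \<iota>' g (\<phi> x)) =
      sinh_div \<iota>' (\<phi> x) (qt_exponent \<iota>' g (\<phi> x))"
    using arg_cong[OF qt_bracket_mult[OF i, of g x], of "fps_map (fps_map \<phi>)"]
    by (simp only: m.mult S \<phi>.one)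
  from qt_bracket_unique[OF i' this] show ?thesis ..
qed

text \<open>
  \<open>P(u) = P(u\<inverse>)\<close>: as \<open>\<epsilon>\<^sup>g = -1\<close>, one has \<open>\<epsilon>\<^bsup>g-k\<^esup> = -\<epsilon>\<^bsup>-k\<^esup>\<close>, and so the factor for \<open>k\<close> at \<open>u\<close> is the factor
  for \<open>g - k\<close> at \<open>u\<inverse>\<close>.
\<close>

lemma P_fun_swap:
  assumes g: "g \<ge> 1" and \<iota>: "ring_morphism \<iota>"
  shows "P_fun \<iota> g u v = P_fun \<iota> g v u"
proof -
  interpret ring_morphism \<iota> by fact
  define \<epsilon> :: complex where "\<epsilon> = exp (\<i> * of_real pi / of_nat g)"
  define F where "F u v k = const2 (\<iota> (1 / (\<epsilon> ^ k - inverse \<epsilon> ^ k))) *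
         (const2 (\<iota> (\<epsilon> ^ k)) * u - const2 (\<iota> (inverse \<epsilon> ^ k)) * v)" for u v k
  have nz: "\<epsilon> \<noteq> 0" by (simp add: \<epsilon>_def)
  have "\<epsilon> ^ g = exp (of_nat g * (\<i> * of_real pi / of_nat g))"
    unfolding \<epsilon>_def by (rule exp_of_nat_mult[symmetric])
  also have "of_nat g * (\<i> * of_real pi / of_nat g) = (\<i> * of_real pi :: complex)"
    using g by simp
  finally have \<epsilon>_g: "\<epsilon> ^ g = -1" by simp
  have "F u v k = F v u (g - k)" if k: "k \<in> {1..g - 1}" for k
  proof -
    have "\<epsilon> ^ (g - k) * \<epsilon> ^ k = -1"
    proof -
      have "g - k + k = g" using k by auto
      then show ?thesis by (simp only: \<epsilon>_g flip: power_add)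
    qed
    then have 1: "\<epsilon> ^ (g - k) = - (inverse \<epsilon> ^ k)"
      using nz by (simp add: field_simps power_inverse)
    then have 2: "inverse \<epsilon> ^ (g - k) = - (\<epsilon> ^ k)"
      using nz by (simp add: power_inverse)
    have "F v u (g - k) = const2 (\<iota> (1 / (\<epsilon> ^ k - inverse \<epsilon> ^ k))) *
         (const2 (\<iota> (- (inverse \<epsilon> ^ k))) * v - const2 (\<iota> (- (\<epsilon> ^ k))) * u)"
      unfolding F_def 1 2 by simp
    also have "\<dots> = F u v k"
      unfolding F_def uminus by (simp flip: fps_const_neg)
    finally show ?thesis ..
  qed
  then have "(\<Prod>k=1..g - 1. F u v k) = (\<Prod>k=1..g - 1. F v u k)"
    by (intro prod.reindex_bij_witness[of _ "\<lambda>k. g - k" "\<lambda>k. g - k"]) auto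
  then show ?thesis
    unfolding P_fun_def Let_def \<epsilon>_def[symmetric] F_def[symmetric] by (simp add: add.commute)
qed

lemma qt_bracket_uminus:
  fixes \<iota> :: "complex \<Rightarrow> 'a::idom"
  assumes g: "g \<ge> 1" and \<iota>: "ring_morphism \<iota>"
  shows "qt_bracket \<iota> g (- x) = - qt_bracket \<iota> g x"
proof (rule qt_bracket_unique[OF \<iota>])
  have "curly \<iota> g (- x) = curly \<iota> g x"
    unfolding curly_def by (subst P_fun_swap[OF g \<iota>]) (simp flip: fps_const_neg)
  then have z: "qt_exponent \<iota> g (- x) = qt_exponent \<iota> g x"
    by (simp add: qt_exponent_def)
  show "- qt_bracket \<iota> g x * sinh_div \<iota> 1 (qt_exponent \<iota> g (- x)) =
      sinh_div \<iota> (- x) (qt_exponent \<iota> g (- x))"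
    unfolding z sinh_div_uminus using qt_bracket_mult[OF \<iota>, of g x] by simp
qed


section \<open>The relations evaluated at a weight\<close>

abbreviation cpp :: "complex \<Rightarrow> complex poly poly" where
  "cpp c \<equiv> [:[:c:]:]"

lemma ring_morphism_cpp: "ring_morphism cpp"
  by unfold_locales (auto simp: one_pCons)

lemma ring_morphism_eval_poly: "ring_morphism (\<lambda>q::complex poly poly. poly (poly q [:r:]) w)"
  by unfold_locales auto

lemma ring_morphism_reflect: "ring_morphism (\<lambda>q::complex poly poly. q \<circ>\<^sub>p [:0, -1:])"
  by unfold_locales (auto simp: pcompose_add pcompose_mult pcompose_1)

lemma XX_series_eq:
  "XX_series g s = qt_bracket cpp g (H_pm s 1) * qt_bracket cpp g (H_pm s (-1))"
proof -
  have "(1::complex) \<noteq> -1" by simp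
  then show ?thesis by (simp add: XX_series_def)
qed

lemma XX_series_eval:
  "poly (poly (XX_series g s $ j $ i) [:r:]) w =
     (qt_bracket (\<lambda>c. c) g ((r + w - s) / 2) * qt_bracket (\<lambda>c. c) g ((r - w + s) / 2)) $ j $ i"
proof -
  let ?ev = "\<lambda>q::complex poly poly. poly (poly q [:r:]) w"
  have *: "fps_map (fps_map ?ev) (qt_bracket cpp g q) = qt_bracket (\<lambda>c. c) g (?ev q)" for q
    by (rule qt_bracket_map[OF ring_morphism_eval_poly _ ring_morphism_cpp]) simp
  interpret m: ring_morphism "fps_map (fps_map ?ev)"
    by (intro ring_morphism_fps_map ring_morphism_eval_poly)
  have H: "?ev (H_pm s e) = (r + e * w - s * e) / 2" for e
    by (simp add: H_pm_def field_simps)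
  have "?ev (XX_series g s $ j $ i) = fps_map (fps_map ?ev) (XX_series g s) $ j $ i" by simp
  also have "\<dots> = (qt_bracket (\<lambda>c. c) g (?ev (H_pm s 1)) * qt_bracket (\<lambda>c. c) g (?ev (H_pm s (-1)))) $ j $ i"
    unfolding XX_series_eq m.mult * ..
  finally show ?thesis unfolding H by simp
qed

text \<open>
  The substitution \<open>\<surd>C \<mapsto> -\<surd>C\<close> takes \<open>H\<^sub>e\<^sup>\<plusminus>\<close> to \<open>-H\<^bsub>-e\<^esub>\<^sup>\<plusminus>\<close>. It exchanges the two factors and changes the
  sign of both.
\<close>

lemma XX_series_even:
  assumes g: "g \<ge> 1" and k: "odd k"
  shows "coeff (XX_series g s $ j $ i) k = 0"
proof -
  let ?R = "\<lambda>q::complex poly poly. q \<circ>\<^sub>p [:0, -1:]"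
  have *: "fps_map (fps_map ?R) (qt_bracket cpp g q) = qt_bracket cpp g (?R q)" for q
    by (rule qt_bracket_map[OF ring_morphism_reflect _ ring_morphism_cpp]) simp
  interpret m: ring_morphism "fps_map (fps_map ?R)"
    by (intro ring_morphism_fps_map ring_morphism_reflect)
  have H: "?R (H_pm s e) = - H_pm s (- e)" for e
    by (simp add: H_pm_def pcompose_pCons)
  have "fps_map (fps_map ?R) (XX_series g s) = XX_series g s"
    unfolding XX_series_eq m.mult * H qt_bracket_uminus[OF g ring_morphism_cpp] by (simp add: mult.commute)
  then have "?R (XX_series g s $ j $ i) = XX_series g s $ j $ i"
    by (metis fps_map_nth)
  then have "coeff (?R (XX_series g s $ j $ i)) k = coeff (XX_series g s $ j $ i) k" by simp
  then have "(-1) ^ k * coeff (XX_series g s $ j $ i) k = coeff (XX_series g s $ j $ i) k"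
    unfolding coeff_pcompose_linear by simp
  then show ?thesis using k by simp
qed

text \<open>
  This is how \<^const>\<open>eval_HC\<close> evaluates when \<open>C\<close> acts by \<open>r\<^sup>2\<close> and \<open>H\<close> by \<open>w\<close>; evenness turns the sum
  over the powers of \<open>C\<close> into the value of \<open>q\<close> at \<open>\<surd>C = r\<close>.
\<close>

lemma even_poly_eval:
  fixes q :: "complex poly poly"
  assumes even: "\<And>k. odd k \<Longrightarrow> coeff q k = 0"
  shows "(\<Sum>b\<le>degree q div 2. \<Sum>a\<le>degree (coeff q (2 * b)). coeff (coeff q (2 * b)) a * w ^ a * (r\<^sup>2) ^ b) =
    poly (poly q [:r:]) w"
proof -
  have "poly (poly q [:r:]) w = (\<Sum>k\<le>degree q. poly (coeff q k) w * r ^ k)"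
    by (simp add: poly_altdef[of q] poly_sum poly_power)
  also have "\<dots> = (\<Sum>k\<in>(\<lambda>b. 2 * b) ` {..degree q div 2}. poly (coeff q k) w * r ^ k)"
  proof (rule sum.mono_neutral_right)
    show "\<forall>k\<in>{..degree q} - (\<lambda>b. 2 * b) ` {..degree q div 2}. poly (coeff q k) w * r ^ k = 0"
    proof
      fix k assume k: "k \<in> {..degree q} - (\<lambda>b. 2 * b) ` {..degree q div 2}"
      have "odd k"
      proof
        assume "even k"
        then have "k = 2 * (k div 2)" "k div 2 \<le> degree q div 2" using k by (auto simp: div_le_mono)
        then show False using k by blast
      qed
      then show "poly (coeff q k) w * r ^ k = 0" by (simp add: even)
    qed
  qed auto
  also have "\<dots> = (\<Sum>b\<le>degree q div 2. poly (coeff q (2 * b)) w * (r\<^sup>2) ^ b)"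
    by (subst sum.reindex) (auto simp: inj_on_def power_mult)
  finally show ?thesis by (simp add: poly_altdef sum_distrib_right)
qed


section \<open>Quantum integers and their specialisations\<close>

lemma qt_int_0: "qt_int g 0 = 0"
  unfolding qt_int_def by (rule qt_bracket_unique[OF ring_morphism_id]) (simp add: sinh_div_def fps_eq_iff subst2_def)

lemma qt_int_nth_0_0: "qt_int g a $ 0 $ 0 = of_int a"
  by (simp add: qt_int_def qt_bracket_nth_0_0[OF ring_morphism_id])

text \<open>
  Modulo \<open>h'\<close> the base \<open>Q T\<^bsup>{a}\<^esup>\<close> becomes \<open>Q\<close>, so that \<open>[a]\<close> becomes \<open>sinh(ha)/sinh(h)\<close>.
\<close>

lemma qt_int_nth_0:
  "qt_int g a $ 0 * (fps_exp 1 - fps_exp (-1)) = fps_exp (of_int a) - fps_exp (- of_int a)"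
proof -
  let ?z = "qt_exponent (\<lambda>c::complex. c) g (of_int a)"
  interpret z: ring_morphism "\<lambda>f::complex fps fps. f $ 0" by (rule ring_morphism_fps_nth_0)
  have e: "exp2 (\<lambda>c. c) (const2 x * ?z) $ 0 = fps_exp x" for x :: complex
  proof (rule fps_ext)
    fix i
    have "((const2 x * ?z) ^ k) $ 0 $ i = (if i = k then x ^ k else 0)" for k
      unfolding z.power z.mult qt_exponent_nth_0 by (simp add: power_mult_distrib fps_const_power)
    then have "exp2 (\<lambda>c. c) (const2 x * ?z) $ 0 $ i = (\<Sum>k\<le>i. if k = i then x ^ i / fact i else 0)"
      unfolding exp2_def fps_nth_Abs_fps add_0_right by (intro sum.cong refl) simp
    then show "exp2 (\<lambda>c. c) (const2 x * ?z) $ 0 $ i = fps_exp x $ i" by simp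
  qed
  have s: "(sinh_div (\<lambda>c. c) x ?z * ?z) $ 0 = fps_exp x - fps_exp (- x)" for x :: complex
  proof -
    have "- (const2 x * ?z) = const2 (- x) * ?z" by (simp flip: fps_const_neg)
    then show ?thesis by (simp only: sinh_div_times[OF qt_exponent_nth_0_0] z.diff e)
  qed
  have "qt_int g a * (sinh_div (\<lambda>c. c) 1 ?z * ?z) = sinh_div (\<lambda>c. c) (of_int a) ?z * ?z"
    using qt_bracket_mult[OF ring_morphism_id, of g "of_int a"] by (simp add: qt_int_def mult.assoc[symmetric])
  then have "(qt_int g a * (sinh_div (\<lambda>c. c) 1 ?z * ?z)) $ 0 = (sinh_div (\<lambda>c. c) (of_int a) ?z * ?z) $ 0"
    by (rule arg_cong)
  then show ?thesis unfolding z.mult[of "qt_int g a"] s .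
qed

text \<open>The coefficient of \<open>m\<^bsub>k-1\<^esub>\<close> in \<open>X\<^sup>+ . m\<^sub>k\<close>.\<close>

definition ladder :: "nat \<Rightarrow> int \<Rightarrow> nat \<Rightarrow> complex fps fps" where
  "ladder g n k = qt_int g (int k) * qt_int g (n - int k + 1)"

lemma ladder_0: "ladder g n 0 = 0"
  by (simp add: ladder_def qt_int_0)

lemma ladder_nth_0_0: "ladder g n k $ 0 $ 0 = of_nat k * of_int (n - int k + 1)"
  by (simp add: ladder_def qt_int_nth_0_0)

text \<open>
  With \<open>E\<^sub>a = exp(ha)\<close>, the two products of brackets have the same terms \<open>E\<^bsub>n+1\<^esub> + E\<^bsub>-n-1\<^esub>\<close>; what
  remains is \<open>(E\<^bsub>n-2k\<^esub> - E\<^bsub>2k-n\<^esub>) (E\<^sub>1 - E\<^bsub>-1\<^esub>)\<close>.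
\<close>

lemma ladder_relation:
  "(ladder g n (Suc k) - ladder g n k) $ 0 * (fps_exp 1 - fps_exp (-1)) =
     fps_exp (of_int (n - 2 * int k)) - fps_exp (- of_int (n - 2 * int k))"
proof -
  define S :: "complex fps" where "S = fps_exp 1 - fps_exp (-1)"
  define E where "E a = fps_exp (of_int a :: complex)" for a :: int
  have E_mult: "E a * E b = E (a + b)" for a b
    by (simp add: E_def fps_exp_add_mult)
  have q: "qt_int g a $ 0 * S = E a - E (- a)" for a
    using qt_int_nth_0[of g a] by (simp add: S_def E_def)
  have S: "S = E 1 - E (-1)" by (simp add: S_def E_def)
  have l: "ladder g n k $ 0 * S * S = (E (int k) - E (- int k)) * (E (n - int k + 1) - E (- (n - int k + 1)))" for k
    by (simp only: q[symmetric] ladder_def) (simp add: mult_ac)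
  have "(ladder g n (Suc k) - ladder g n k) $ 0 * S * S =
      ladder g n (Suc k) $ 0 * S * S - ladder g n k $ 0 * S * S"
    by (simp add: algebra_simps)
  also have "\<dots> = (E (n - 2 * int k) - E (- (n - 2 * int k))) * S"
    unfolding l by (simp only: S) (simp add: algebra_simps E_mult)
  finally have "(ladder g n (Suc k) - ladder g n k) $ 0 * S = E (n - 2 * int k) - E (- (n - 2 * int k))"
  proof -
    assume *: "(ladder g n (Suc k) - ladder g n k) $ 0 * S * S = (E (n - 2 * int k) - E (- (n - 2 * int k))) * S"
    have "S $ 1 \<noteq> 0" by (simp add: S_def)
    then have "S \<noteq> 0" by auto
    with * show ?thesis by (metis mult_right_cancel)
  qed
  then show ?thesis by (simp add: S_def E_def)
qed

lemma sinh1_nth: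
  "sinh1 \<iota> (fps_const x * fps_X) $ k = \<iota> (1/2) * (\<iota> (1 / fact k) * (x ^ k - (- x) ^ k))"
proof -
  have e: "exp1 \<iota> (fps_const x * fps_X) $ k = \<iota> (1 / fact k) * x ^ k" for x
  proof -
    have "exp1 \<iota> (fps_const x * fps_X) $ k = (\<Sum>i=0..k. if i = k then \<iota> (1 / fact k) * x ^ k else 0)"
      unfolding exp1_def fps_compose_nth
      by (intro sum.cong) (auto simp: power_mult_distrib fps_const_power)
    then show ?thesis by simp
  qed
  have "- (fps_const x * fps_X) = fps_const (- x) * fps_X" by (simp flip: fps_const_neg)
  then show ?thesis by (simp add: sinh1_def e right_diff_distrib)
qed

lemma sinh_quot_mult:
  "sinh_quot * sinh1 (\<lambda>c. [:c:]) fps_X = sinh1 (\<lambda>c. [:c:]) (fps_const [:0, 1:] * fps_X)" (is ?mult)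
  and sinh_quot_nth_0: "sinh_quot $ 0 = [:0, 1:]"
proof -
  let ?s = "\<lambda>x. sinh1 (\<lambda>c. [:c:]) (fps_const x * fps_X) :: complex poly fps"
  define N where "N x = fps_shift 1 (?s x)" for x
  have s0: "?s x $ 0 = 0" for x by (simp add: sinh1_nth)
  have sN: "?s x = N x * fps_X" for x
    unfolding N_def using s0[of x] by (intro fps_ext) (simp add: fps_X_mult_right_nth)
  have N0: "N x $ 0 = x" for x
  proof -
    have "Polynomial.smult (1/2) (x + x) = Polynomial.smult (1/2 + 1/2) x"
      by (simp only: smult_add_left smult_add_right)
    then show ?thesis by (simp add: N_def sinh1_nth)
  qed
  have "N 1 $ 0 * 1 = 1" by (simp add: N0)
  from fps_right_inverse[OF this] obtain u where u: "N 1 * u = 1" by blast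
  have X: "?s 1 = sinh1 (\<lambda>c. [:c:]) fps_X" by simp
  have "N 1 \<noteq> 0" using u by auto
  then have nz: "?s 1 \<noteq> 0" unfolding sN by simp
  have u': "u * N 1 = 1" using u by (subst mult.commute)
  have q: "sinh_quot = N [:0, 1:] * u"
    unfolding sinh_quot_def X[symmetric]
  proof (rule exact_quot_eq[OF nz])
    have "N [:0, 1:] * u * ?s 1 = N [:0, 1:] * (N 1 * u) * fps_X"
      unfolding sN[of 1] by (simp only: mult_ac)
    then show "N [:0, 1:] * u * ?s 1 = ?s [:0, 1:]" by (simp only: u sN mult_1_right)
  qed
  have eq: "sinh_quot * N 1 = N [:0, 1:]" unfolding q mult.assoc u' by (rule mult_1_right)
  then show ?mult unfolding X[symmetric] sN by (simp only: mult.assoc[symmetric])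
  show "sinh_quot $ 0 = [:0, 1:]"
    using arg_cong[OF eq, of "\<lambda>f. f $ 0"] by (simp add: N0)
qed

lemma sinh_quot_eval:
  "fps_map (\<lambda>p. poly p w) sinh_quot * (fps_exp 1 - fps_exp (-1)) = fps_exp w - fps_exp (- w)"
proof -
  let ?ev = "\<lambda>p::complex poly. poly p w"
  have ev: "ring_morphism ?ev" by unfold_locales auto
  interpret m: ring_morphism "fps_map ?ev" by (rule ring_morphism_fps_map[OF ev])
  have s: "fps_map ?ev (sinh1 (\<lambda>c. [:c:]) (fps_const x * fps_X)) =
      fps_const (1/2) * (fps_exp (?ev x) - fps_exp (- ?ev x))" for x
    by (rule fps_ext, unfold fps_map_nth sinh1_nth) (simp add: field_simps)
  have "fps_map ?ev sinh_quot * (fps_const (1/2) * (fps_exp 1 - fps_exp (-1))) =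
      fps_const (1/2) * (fps_exp w - fps_exp (- w))"
    using arg_cong[OF sinh_quot_mult, of "fps_map ?ev"] s[of 1] s[of "[:0, 1:]"]
    by (simp add: m.mult)
  then have "fps_const (1/2) * (fps_map ?ev sinh_quot * (fps_exp 1 - fps_exp (-1))) =
      fps_const (1/2) * (fps_exp w - fps_exp (- w))"
    by (simp only: mult.left_commute)
  then show ?thesis by (simp only: mult_cancel_left) simp
qed

lemma ladder_sinh_quot:
  "(ladder g n (Suc k) - ladder g n k) $ 0 = fps_map (\<lambda>p. poly p (of_int (n - 2 * int k))) sinh_quot"
proof -
  have "(fps_exp 1 - fps_exp (-1) :: complex fps) $ 1 \<noteq> 0" by simp
  then have "(fps_exp 1 - fps_exp (-1) :: complex fps) \<noteq> 0" by (metis fps_zero_nth)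
  then show ?thesis
    using ladder_relation[of g n k] sinh_quot_eval[of "of_int (n - 2 * int k)"]
    by (metis mult_right_cancel)
qed


section \<open>Presentations with coordinates\<close>

text \<open>
  A presented algebra with a candidate \<open>P\<close> for its coordinates, a candidate \<open>Q\<close> for the coordinates of
  its Verma modules, and a map \<open>\<pi> n\<close> that computes \<open>f m\<^sub>0\<close> in the model. The assumption \<open>split\<close> bounds
  the Verma module from above, and the assumptions on \<open>\<pi>\<close> bound it from below.
\<close>

locale coordinatised_presentation =
  presentation \<iota> I x y h +
  alg: central_hom \<iota>L + ver: central_hom \<iota>V
  for \<iota> :: "'k::comm_ring_1 \<Rightarrow> 'a::ring_1" and I x y h
    and \<iota>L :: "'k \<Rightarrow> 'l::ring_1" and \<iota>V :: "'k \<Rightarrow> 'v::ring_1" +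
  fixes P :: "'l \<Rightarrow> 'a" and Q :: "'v \<Rightarrow> 'a" and \<pi> :: "int \<Rightarrow> 'a \<Rightarrow> 'v"
  assumes P: "Modules.additive P" "\<And>c l. P (\<iota>L c * l) = \<iota> c * P l"
    and span: "\<And>f. \<exists>l. f - P l \<in> I"
    and independent: "\<And>l. P l \<in> I \<Longrightarrow> l = 0"
    and Q: "Modules.additive Q" "\<And>c v. Q (\<iota>V c * v) = \<iota> c * Q v"
    and split: "\<And>n l. \<exists>v a b. P l = Q v + a * x + b * (h - \<iota> (of_int n))"
    and \<pi>: "\<And>n. Modules.additive (\<pi> n)"
    and \<pi>_I: "\<And>n f. f \<in> I \<Longrightarrow> \<pi> n f = 0"
    and \<pi>_x: "\<And>n a. \<pi> n (a * x) = 0"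
    and \<pi>_h: "\<And>n a. \<pi> n (a * (h - \<iota> (of_int n))) = 0"
    and \<pi>_Q: "\<And>n v. \<pi> n (Q v) = v"
begin

lemma algebra_coordinates: "coordinates \<iota>L U (\<lambda>l. cls (P l))"
proof (rule coordinatesI)
  show "inj (\<lambda>l. cls (P l))"
  proof (rule injI)
    fix l l' assume "cls (P l) = cls (P l')"
    then have "P (l - l') \<in> I" by (simp add: cls_eq_iff additive.diff[OF P(1)])
    then show "l = l'" using independent[of "l - l'"] by simp
  qed
  have "cls f \<in> range (\<lambda>l. cls (P l))" for f
    using span[of f] by (auto simp flip: cls_eq_iff)
  then show "range (\<lambda>l. cls (P l)) = carrier U" by (auto simp: U_carrier)
qed (simp_all add: additive.add[OF P(1)] additive.zero[OF P(1)] P(2) U_add U_smult U_zero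
    alg.central_hom_axioms)

lemma verma_split: "\<exists>v. f - Q v \<in> verma_ideal n"
proof -
  obtain l where l: "f - P l \<in> I" using span by blast
  obtain v a b where "P l = Q v + a * x + b * (h - \<iota> (of_int n))" using split by blast
  then have "f - Q v - (a * x + b * (h - \<iota> (of_int n))) = f - P l" by (simp only: diff_diff_eq add.assoc)
  with l have "f - Q v - (a * x + b * (h - \<iota> (of_int n))) \<in> I" by (simp only:)
  then show ?thesis by (blast intro: verma_idealI)
qed

lemma verma_ideal_iff: "f \<in> verma_ideal n \<longleftrightarrow> \<pi> n f = 0"
proof -
  have *: "\<pi> n f = 0" if "f \<in> verma_ideal n" for f
  proof -
    from that obtain a b where ab: "f - (a * x + b * (h - \<iota> (of_int n))) \<in> I"
      by (auto simp: verma_ideal_def)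
    have "\<pi> n f = \<pi> n (f - (a * x + b * (h - \<iota> (of_int n)))) + (\<pi> n (a * x) + \<pi> n (b * (h - \<iota> (of_int n))))"
      unfolding additive.add[OF \<pi>, symmetric] by simp
    then show ?thesis by (simp only: \<pi>_I[OF ab] \<pi>_x \<pi>_h add_0_right)
  qed
  moreover have "f \<in> verma_ideal n" if "\<pi> n f = 0"
  proof -
    obtain v where v: "f - Q v \<in> verma_ideal n" using verma_split by blast
    from *[OF v] that have "v = 0" by (simp add: additive.diff[OF \<pi>] \<pi>_Q)
    with v show ?thesis by (simp add: additive.zero[OF Q(1)])
  qed
  ultimately show ?thesis by blast
qed

text \<open>
  Two elements with the same value at \<open>m\<^sub>0\<close> in the model have the same class; so every identity in
  the Verma module can be checked in the model.
\<close>

lemma vcls_eq_Q: "vcls n f = vcls n (Q (\<pi> n f))"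
  by (simp add: vcls_eq_iff verma_ideal_iff additive.diff[OF \<pi>] \<pi>_Q)

lemma verma_coordinates: "coordinates \<iota>V (verma U n) (\<lambda>v. vcls n (Q v))"
proof (rule coordinatesI)
  show "inj (\<lambda>v. vcls n (Q v))"
    by (rule injI) (simp add: vcls_eq_iff verma_ideal_iff additive.diff[OF \<pi>] \<pi>_Q)
  show "range (\<lambda>v. vcls n (Q v)) = carrier (verma U n)"
    using vcls_eq_Q by (auto simp: verma_carrier)
qed (simp_all add: additive.add[OF Q(1)] additive.zero[OF Q(1)] Q(2) verma_add verma_smult verma_zero
    ver.central_hom_axioms)

lemma verma_act_coordinates: "verma_act U n (cls f) (vcls n (Q v)) = vcls n (Q (\<pi> n (f * Q v)))"
  unfolding verma_act_vcls by (rule vcls_eq_Q)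

end


section \<open>The Verma modules as representations of the free algebras\<close>

definition Xp_op :: "nat \<Rightarrow> int \<Rightarrow> endo fps fps" where
  "Xp_op g n = Abs_fps (\<lambda>j. Abs_fps (\<lambda>i. lower (\<lambda>k. ladder g n k $ j $ i)))"

lemma Xp_op_nth [simp]: "Xp_op g n $ j $ i = lower (\<lambda>k. ladder g n k $ j $ i)"
  by (simp add: Xp_op_def)

text \<open>
  The index \<open>4\<close> refers to the algebra over \<open>\<complex>[[h,h']]\<close> with its four generators, the index \<open>3\<close> to \<open>U\<^sub>h\<close>, and
  the index \<open>0\<close> to \<open>U\<close>. The model \<open>letter3\<close> is the reduction of \<open>letter4\<close> modulo \<open>h'\<close>, from which it inherits
  the parameter \<open>g\<close>, and \<open>letter0\<close> is the reduction modulo \<open>(h,h')\<close>.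
\<close>

fun letter4 :: "nat \<Rightarrow> int \<Rightarrow> gen4 \<Rightarrow> endo fps fps" where
  "letter4 g n Xp4 = Xp_op g n"
| "letter4 g n Xm4 = const2 raise"
| "letter4 g n H4 = const2 (weight_op n)"
| "letter4 g n C4 = const2 (scE (of_int (n + 1) ^ 2))"

fun letter3 :: "nat \<Rightarrow> int \<Rightarrow> gen3 \<Rightarrow> endo fps" where
  "letter3 g n Xp3 = Xp_op g n $ 0"
| "letter3 g n Xm3 = fps_const raise"
| "letter3 g n H3 = fps_const (weight_op n)"

fun letter0 :: "int \<Rightarrow> gen3 \<Rightarrow> endo" where
  "letter0 n Xp3 = lower (\<lambda>k. of_nat k * of_int (n - int k + 1))"
| "letter0 n Xm3 = raise"
| "letter0 n H3 = weight_op n"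

definition \<rho>4 :: "nat \<Rightarrow> int \<Rightarrow> gen4 free_algebra \<Rightarrow> endo fps fps" where
  "\<rho>4 g n = free_eval (\<lambda>c. const2 (scE c)) (letter4 g n)"

definition \<rho>3 :: "nat \<Rightarrow> int \<Rightarrow> gen3 free_algebra \<Rightarrow> endo fps" where
  "\<rho>3 g n = free_eval (\<lambda>c. fps_const (scE c)) (letter3 g n)"

definition \<rho>0 :: "int \<Rightarrow> gen3 free_algebra \<Rightarrow> endo" where
  "\<rho>0 n = free_eval scE (letter0 n)"

interpretation scE1: complex_scalars "\<lambda>c. fps_const (scE c)"
  by (simp add: complex_scalars_iff central_hom_fps_const central_hom_scE)

interpretation scE2: complex_scalars "\<lambda>c. const2 (scE c)"
  using central_hom_fps_const[OF central_hom_fps_const[OF central_hom_scE]]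
  by (simp add: complex_scalars_iff)

lemma ring_morphism_\<rho>4: "ring_morphism (\<rho>4 g n)"
  unfolding \<rho>4_def by (rule scE2.ring_morphism_free_eval)

lemma ring_morphism_\<rho>3: "ring_morphism (\<rho>3 g n)"
  unfolding \<rho>3_def by (rule scE1.ring_morphism_free_eval)

lemma ring_morphism_\<rho>0: "ring_morphism (\<rho>0 n)"
  unfolding \<rho>0_def by (rule scE.ring_morphism_free_eval)

lemma \<rho>4_simps [simp]: "\<rho>4 g n (var z) = letter4 g n z" "\<rho>4 g n (scal c) = const2 (scE c)"
  by (simp_all add: \<rho>4_def)

lemma \<rho>3_simps [simp]: "\<rho>3 g n (var z) = letter3 g n z" "\<rho>3 g n (scal c) = fps_const (scE c)"
  by (simp_all add: \<rho>3_def)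

lemma \<rho>0_simps [simp]: "\<rho>0 n (var z) = letter0 n z" "\<rho>0 n (scal c) = scE c"
  by (simp_all add: \<rho>0_def)

lemma pbw_lin_natural:
  assumes "ring_morphism \<phi>" "\<And>c. \<phi> (\<iota> c) = \<iota>' c"
  shows "\<phi> (pbw_lin \<iota> x y h l) = pbw_lin \<iota>' (\<phi> x) (\<phi> y) (\<phi> h) l"
proof -
  have "(\<lambda>k. \<phi> (case k of (a, b, c) \<Rightarrow> y ^ a * h ^ b * x ^ c)) = (\<lambda>(a, b, c). \<phi> y ^ a * \<phi> h ^ b * \<phi> x ^ c)"
    by (auto simp: ring_morphism.hom_simps[OF assms(1)])
  then show ?thesis unfolding pbw_lin_def linext_natural[of \<phi> \<iota> \<iota>', OF assms] by simp
qed

abbreviation P4 :: "(nat \<times> nat \<times> nat \<Rightarrow>\<^sub>0 complex) \<Rightarrow> gen4 free_algebra" where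
  "P4 \<equiv> pbw_lin scal (var Xp4) (var Xm4) (var H4)"

abbreviation P3 :: "(nat \<times> nat \<times> nat \<Rightarrow>\<^sub>0 complex) \<Rightarrow> gen3 free_algebra" where
  "P3 \<equiv> pbw_lin scal (var Xp3) (var Xm3) (var H3)"

abbreviation powers_lin :: "'x \<Rightarrow> (nat \<Rightarrow>\<^sub>0 complex) \<Rightarrow> 'x free_algebra" where
  "powers_lin z \<equiv> linext scal (\<lambda>k. var z ^ k)"

interpretation scal: complex_scalars scal
  by (simp add: complex_scalars_iff central_hom_scal)

lemma \<rho>4_P4: "\<rho>4 g n (P4 l) = pbw_lin (\<lambda>c. const2 (scE c)) (Xp_op g n) (const2 raise) (const2 (weight_op n)) l"
  by (subst pbw_lin_natural[OF ring_morphism_\<rho>4]) simp_all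

lemma \<rho>3_P3: "\<rho>3 g n (P3 l) = pbw_lin (\<lambda>c. fps_const (scE c)) (Xp_op g n $ 0) (fps_const raise) (fps_const (weight_op n)) l"
  by (subst pbw_lin_natural[OF ring_morphism_\<rho>3]) simp_all

lemma \<rho>0_P3: "\<rho>0 n (P3 l) = pbw_lin scE (lower (\<lambda>k. of_nat k * of_int (n - int k + 1))) raise (weight_op n) l"
  by (subst pbw_lin_natural[OF ring_morphism_\<rho>0]) simp_all

lemma \<rho>4_P4_nth_0: "\<rho>4 g n (P4 l) $ 0 = \<rho>3 g n (P3 l)"
  unfolding \<rho>4_P4 \<rho>3_P3 by (subst pbw_lin_natural[OF ring_morphism_fps_nth_0]) simp_all

lemma \<rho>3_P3_nth_0: "\<rho>3 g n (P3 l) $ 0 = \<rho>0 n (P3 l)"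
  unfolding \<rho>0_P3 \<rho>3_P3 by (subst pbw_lin_natural[OF ring_morphism_fps_nth_0]) (simp_all add: ladder_nth_0_0)

text \<open>
  The operator \<open>\<Sum> v\<^sub>k (X\<^sup>-)\<^sup>k\<close>, which takes \<open>m\<^sub>0\<close> to \<open>v\<close>.
\<close>

definition raise_lin :: "(nat \<Rightarrow>\<^sub>0 complex) \<Rightarrow> endo" where
  "raise_lin = linext scE (\<lambda>k. raise ^ k)"

lemma app_raise_lin: "app (raise_lin v) (single 0 1) = v"
  unfolding raise_lin_def
  by (rule additive_eqI_single[of "\<lambda>v. app (linext scE (\<lambda>k. raise ^ k) v) (single 0 1)" "\<lambda>v. v"])
    (unfold_locales, simp_all add: scE.linext_add del: single_one)

lemma \<rho>0_powers: "\<rho>0 n (powers_lin Xm3 v) = raise_lin v"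
  unfolding raise_lin_def
  by (subst linext_natural[OF ring_morphism_\<rho>0]) (simp_all add: ring_morphism.power[OF ring_morphism_\<rho>0])

lemma \<rho>3_powers: "\<rho>3 g n (powers_lin Xm3 v) = fps_const (raise_lin v)"
  unfolding raise_lin_def
  by (subst linext_natural[OF ring_morphism_\<rho>3], simp, subst linext_natural[OF ring_morphism_fps_const], rule refl)
    (simp add: ring_morphism.power[OF ring_morphism_\<rho>3] fps_const_power)

lemma \<rho>4_powers: "\<rho>4 g n (powers_lin Xm4 v) = const2 (raise_lin v)"
  unfolding raise_lin_def
  by (subst linext_natural[OF ring_morphism_\<rho>4], simp,
      subst linext_natural[OF ring_morphism_comp[OF ring_morphism_fps_const ring_morphism_fps_const]], rule refl)
    (simp add: ring_morphism.power[OF ring_morphism_\<rho>4] fps_const_power)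

abbreviation R4 :: "nat \<Rightarrow> int \<Rightarrow> gen4 free_algebra fps fps \<Rightarrow> endo fps fps" where
  "R4 g n \<equiv> adic_ext2 (\<rho>4 g n)"

abbreviation R3 :: "nat \<Rightarrow> int \<Rightarrow> gen3 free_algebra fps \<Rightarrow> endo fps" where
  "R3 g n \<equiv> adic_ext (\<rho>3 g n)"

lemma ring_morphism_R4: "ring_morphism (R4 g n)"
  by (intro ring_morphism_adic_ext2 ring_morphism_\<rho>4)

lemma ring_morphism_R3: "ring_morphism (R3 g n)"
  by (intro ring_morphism_adic_ext ring_morphism_\<rho>3)

lemma R4_const: "R4 g n (const2 f) = \<rho>4 g n f"
  by (rule adic_ext2_const) (rule ring_morphism.zero[OF ring_morphism_\<rho>4])

lemma R3_const: "R3 g n (fps_const f) = \<rho>3 g n f"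
  by (rule adic_ext_const) (rule ring_morphism.zero[OF ring_morphism_\<rho>3])

lemma eval_HC_action:
  assumes "\<And>k. odd k \<Longrightarrow> coeff q k = 0"
  shows "\<rho>4 g n (eval_HC q) = const2 (diagonal (\<lambda>k. poly (poly q [:of_int (n + 1):]) (of_int (n - 2 * int k))))"
proof -
  interpret \<rho>: ring_morphism "\<rho>4 g n" by (rule ring_morphism_\<rho>4)
  interpret c: ring_morphism "\<lambda>T::endo. const2 T"
    by (rule ring_morphism_comp[OF ring_morphism_fps_const ring_morphism_fps_const])
  let ?T = "\<Sum>b\<le>degree q div 2. \<Sum>a\<le>degree (coeff q (2 * b)).
      scE (coeff (coeff q (2 * b)) a) * weight_op n ^ a * scE (of_int (n + 1) ^ 2) ^ b"
  have "\<rho>4 g n (eval_HC q) = const2 ?T"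
    unfolding eval_HC_def \<rho>.hom_simps c.hom_simps by simp
  moreover have "?T = diagonal (\<lambda>k. poly (poly q [:of_int (n + 1):]) (of_int (n - 2 * int k)))"
  proof (rule endo_eqI_single)
    fix k
    have sc_power: "app (scE c ^ b) (single k d) = single k (c ^ b * d)" for c b d
      by (induction b) (simp_all add: mult.assoc)
    have single_sum: "(\<Sum>a\<in>A. single k (f a)) = single k (\<Sum>a\<in>A. f a)"
      for A and f :: "nat \<Rightarrow> complex"
      by (induction A rule: infinite_finite_induct) (simp_all add: single_add)
    have even: "poly (poly q [:of_int (n + 1):]) (of_int (n - 2 * int k)) =
        (\<Sum>b\<le>degree q div 2. \<Sum>a\<le>degree (coeff q (2 * b)).
          coeff (coeff q (2 * b)) a * of_int (n - 2 * int k) ^ a * (of_int (n + 1) ^ 2) ^ b)"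
      by (rule even_poly_eval[symmetric]) (rule assms)
    show "app ?T (single k 1) =
        app (diagonal (\<lambda>k. poly (poly q [:of_int (n + 1):]) (of_int (n - 2 * int k)))) (single k 1)"
      unfolding app_diagonal even
      by (simp only: app_sum app_simps sc_power weight_op_def app_diagonal_power app_scE sc_mult_single single_sum
          mult_1_right mult.assoc)
  qed
  ultimately show ?thesis by simp
qed

lemma eval_H_action:
  "\<rho>3 g n (eval_H p) = fps_const (diagonal (\<lambda>k. poly p (of_int (n - 2 * int k))))"
proof -
  interpret \<rho>: ring_morphism "\<rho>3 g n" by (rule ring_morphism_\<rho>3)
  interpret c: ring_morphism "fps_const :: endo \<Rightarrow> endo fps" by (rule ring_morphism_fps_const)
  let ?T = "\<Sum>a\<le>degree p. scE (coeff p a) * weight_op n ^ a"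
  have "\<rho>3 g n (eval_H p) = fps_const ?T"
    unfolding eval_H_def \<rho>.hom_simps c.hom_simps by simp
  moreover have "?T = diagonal (\<lambda>k. poly p (of_int (n - 2 * int k)))"
  proof (rule endo_eqI_single)
    fix k :: nat
    have single_sum: "(\<Sum>a\<in>A. single k (f a)) = single k (\<Sum>a\<in>A. f a)"
      for A and f :: "nat \<Rightarrow> complex"
      by (induction A rule: infinite_finite_induct) (simp_all add: single_add)
    show "app ?T (single k 1) =
        app (diagonal (\<lambda>k. poly p (of_int (n - 2 * int k)))) (single k 1)"
      by (simp only: app_sum app_simps weight_op_def app_diagonal_power app_diagonal app_scE sc_mult_single single_sum
          mult_1_right poly_altdef)
  qed
  ultimately show ?thesis by simp
qed

lemma weight_op_lower: "weight_op n * lower w - lower w * weight_op n - 2 * lower w = 0"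
  unfolding mult_2
proof (rule endo_eqI_single)
  fix k
  show "app (weight_op n * lower w - lower w * weight_op n - (lower w + lower w)) (single k 1) =
      app 0 (single k 1)"
  proof (cases k)
    case 0
    then show ?thesis by (simp add: weight_op_def additive.zero[OF additive_app] del: single_one single_of_int)
  next
    case (Suc m)
    have "of_int (n - 2 * int m) * w k - w k * of_int (n - 2 * int k) - (w k + w k) = 0"
      by (simp add: Suc algebra_simps)
    then show ?thesis
      by (simp only: app_simps weight_op_def app_lower app_diagonal Suc nat.distinct if_False diff_Suc_1 mult_1_right
          single_zero flip: single_add single_diff)
  qed
qed

lemma weight_op_raise: "weight_op n * raise - raise * weight_op n + 2 * raise = 0"
  unfolding mult_2
  by (rule endo_eqI_single) (simp add: weight_op_def algebra_simps flip: single_add single_diff)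

lemma lower_raise_commutator:
  assumes "w 0 = 0"
  shows "lower w * raise - raise * lower w = diagonal (\<lambda>k. w (Suc k) - w k)"
  by (rule endo_eqI_single) (auto simp: assms additive.zero[OF additive_app] simp flip: single_diff)

text \<open>
  The commutation relations hold because \<open>C\<close> is a scalar, \<open>H\<close> is diagonal and \<open>X\<^sup>\<plusminus>\<close> shift the
  index by one. In the two product relations, the right-hand sides act on \<open>m\<^sub>k\<close> by \<open>[n-k] [k+1]\<close> and
  \<open>[n-k+1] [k]\<close>; the second vanishes at \<open>k = 0\<close>, where \<open>X\<^sup>- X\<^sup>+\<close> does.
\<close>

lemma R4_kills_relations:
  assumes g: "g \<ge> 1" and r: "r \<in> Uhh_rels g"
  shows "R4 g n r = 0"
proof -
  interpret R: ring_morphism "R4 g n" by (rule ring_morphism_R4)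
  let ?R = "\<lambda>s. Abs_fps (\<lambda>j. Abs_fps (\<lambda>i. eval_HC (XX_series g s $ j $ i)))"
  have RR: "R4 g n (?R s) $ j $ i = diagonal (\<lambda>k.
      (qt_bracket (\<lambda>c. c) g ((of_int (n + 1) + of_int (n - 2 * int k) - s) / 2) *
       qt_bracket (\<lambda>c. c) g ((of_int (n + 1) - of_int (n - 2 * int k) + s) / 2)) $ j $ i)" for s j i
  proof -
    have "\<rho>4 g n (eval_HC (XX_series g s $ j $ i)) = const2 (diagonal (\<lambda>k.
        poly (poly (XX_series g s $ j $ i) [:of_int (n + 1):]) (of_int (n - 2 * int k))))" for j i
      by (rule eval_HC_action) (rule XX_series_even[OF g])
    then have "\<rho>4 g n (?R s $ j $ i) = const2 (diagonal (\<lambda>k.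
        poly (poly (XX_series g s $ j $ i) [:of_int (n + 1):]) (of_int (n - 2 * int k))))" for j i
      by (simp only: fps_nth_Abs_fps)
    then show ?thesis
      unfolding XX_series_eval by (rule adic_ext2_constant_values)
  qed
  have ladder: "qt_bracket (\<lambda>c. c) g a * qt_bracket (\<lambda>c. c) g b = ladder g n k"
    if "a = of_int (n - int k + 1)" "b = of_int (int k)" for a b k
    by (simp only: that ladder_def qt_int_def mult.commute)
  have XpXm: "R4 g n (?R 1) = Xp_op g n * const2 raise"
  proof (intro fps_ext endo_eqI_single)
    fix j i k :: nat
    have "qt_bracket (\<lambda>c. c) g ((of_int (n + 1) + of_int (n - 2 * int k) - 1) / 2) *
        qt_bracket (\<lambda>c. c) g ((of_int (n + 1) - of_int (n - 2 * int k) + 1) / 2) = ladder g n (Suc k)"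
      by (rule ladder) (simp_all add: field_simps)
    then show "app (R4 g n (?R 1) $ j $ i) (single k 1) =
        app ((Xp_op g n * const2 raise) $ j $ i) (single k 1)"
      unfolding RR by simp
  qed
  have XmXp: "R4 g n (?R (-1)) = const2 raise * Xp_op g n"
  proof (intro fps_ext endo_eqI_single)
    fix j i k :: nat
    have "qt_bracket (\<lambda>c. c) g ((of_int (n + 1) + of_int (n - 2 * int k) - (-1)) / 2) *
        qt_bracket (\<lambda>c. c) g ((of_int (n + 1) - of_int (n - 2 * int k) + (-1)) / 2) = ladder g n k"
      by (rule ladder) (simp_all add: field_simps)
    then show "app (R4 g n (?R (-1)) $ j $ i) (single k 1) =
        app ((const2 raise * Xp_op g n) $ j $ i) (single k 1)"
      unfolding RR by (simp add: ladder_0 additive.zero[OF additive_app])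
  qed
  have C: "const2 (scE c) * T = T * const2 (scE c)" for c T
    by (rule scE2.central)
  have two: "(2 * T) $ j $ i = 2 * T $ j $ i" for T :: "endo fps fps" and j i
    by (simp add: mult_2)
  have HXp: "const2 (weight_op n) * Xp_op g n - Xp_op g n * const2 (weight_op n) - 2 * Xp_op g n = 0"
  proof (intro fps_ext)
    fix j i :: nat
    show "(const2 (weight_op n) * Xp_op g n - Xp_op g n * const2 (weight_op n) - 2 * Xp_op g n) $ j $ i = 0 $ j $ i"
      using weight_op_lower[of n "\<lambda>k. ladder g n k $ j $ i"] by (simp add: two)
  qed
  have HXm: "const2 (weight_op n) * const2 raise - const2 raise * const2 (weight_op n) + 2 * const2 raise = 0"
  proof (intro fps_ext)
    fix j i :: nat
    show "(const2 (weight_op n) * const2 raise - const2 raise * const2 (weight_op n) + 2 * const2 raise) $ j $ i = 0 $ j $ i"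
      unfolding fps_add_nth fps_sub_nth two using weight_op_raise[of n] by simp
  qed
  show ?thesis
    using r unfolding Uhh_rels_def Let_def
    by (elim insertE emptyE; simp only: R.hom_simps R4_const \<rho>4_simps letter4.simps HXp HXm XpXm XmXp C[symmetric] diff_self)
qed

lemma R3_kills_relations:
  assumes r: "r \<in> Uh_rels"
  shows "R3 g n r = 0"
proof -
  interpret R: ring_morphism "R3 g n" by (rule ring_morphism_R3)
  let ?R = "Abs_fps (\<lambda>i. eval_H (sinh_quot $ i))"
  have RR: "R3 g n ?R = Abs_fps (\<lambda>i. diagonal (\<lambda>k. poly (sinh_quot $ i) (of_int (n - 2 * int k))))"
    by (rule adic_ext_constant_values) (simp only: fps_nth_Abs_fps eval_H_action)
  have ladder: "poly (sinh_quot $ i) (of_int (n - 2 * int k)) = ladder g n (Suc k) $ 0 $ i - ladder g n k $ 0 $ i" for i k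
    using arg_cong[OF ladder_sinh_quot[of g n k], of "\<lambda>f. f $ i"] by simp
  have XX: "Xp_op g n $ 0 * fps_const raise - fps_const raise * Xp_op g n $ 0 - R3 g n ?R = 0"
  proof (rule fps_ext)
    fix i
    show "(Xp_op g n $ 0 * fps_const raise - fps_const raise * Xp_op g n $ 0 - R3 g n ?R) $ i = 0 $ i"
      unfolding RR using lower_raise_commutator[of "\<lambda>k. ladder g n k $ 0 $ i"]
      by (simp only: fps_sub_nth fps_mult_left_const_nth fps_mult_right_const_nth Xp_op_nth fps_nth_Abs_fps ladder)
        (simp add: ladder_0)
  qed
  have two: "(2 * T) $ i = 2 * T $ i" for T :: "endo fps" and i
    by (simp add: mult_2)
  have HXp: "fps_const (weight_op n) * Xp_op g n $ 0 - Xp_op g n $ 0 * fps_const (weight_op n) - 2 * Xp_op g n $ 0 = 0"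
  proof (rule fps_ext)
    fix i
    show "(fps_const (weight_op n) * Xp_op g n $ 0 - Xp_op g n $ 0 * fps_const (weight_op n) - 2 * Xp_op g n $ 0) $ i = 0 $ i"
      using weight_op_lower[of n "\<lambda>k. ladder g n k $ 0 $ i"] by (simp add: two)
  qed
  have HXm: "fps_const (weight_op n) * fps_const raise - fps_const raise * fps_const (weight_op n) + 2 * fps_const raise = 0"
  proof (rule fps_ext)
    fix i
    show "(fps_const (weight_op n) * fps_const raise - fps_const raise * fps_const (weight_op n) + 2 * fps_const raise) $ i = 0 $ i"
      unfolding fps_add_nth fps_sub_nth two using weight_op_raise[of n] by simp
  qed
  show ?thesis
    using r unfolding Uh_rels_def Let_def
    by (elim insertE emptyE; simp only: R.hom_simps R3_const \<rho>3_simps letter3.simps HXp HXm XX)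
qed

lemma \<rho>0_kills_relations:
  assumes r: "r \<in> U_rels"
  shows "\<rho>0 n r = 0"
proof -
  interpret R: ring_morphism "\<rho>0 n" by (rule ring_morphism_\<rho>0)
  let ?X = "lower (\<lambda>k. of_nat k * of_int (n - int k + 1))"
  have "weight_op n * ?X - ?X * weight_op n - 2 * ?X = 0" by (rule weight_op_lower)
  moreover have "weight_op n * raise - raise * weight_op n + 2 * raise = 0" by (rule weight_op_raise)
  moreover have "?X * raise - raise * ?X - weight_op n = 0"
  proof -
    have "(\<lambda>k. of_nat (Suc k) * of_int (n - int (Suc k) + 1) - of_nat k * of_int (n - int k + 1)) =
        (\<lambda>k. of_int (n - 2 * int k) :: complex)"
      by (auto simp: algebra_simps)
    then show ?thesis using lower_raise_commutator[of "\<lambda>k. of_nat k * of_int (n - int k + 1)"]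
      by (simp add: weight_op_def)
  qed
  ultimately show ?thesis
    using r unfolding U_rels_def
    by (elim insertE emptyE; simp only: R.hom_simps \<rho>0_simps letter0.simps)
qed


section \<open>The three algebras and their Verma modules in coordinates\<close>

abbreviation Q3 :: "(nat \<Rightarrow>\<^sub>0 complex) fps \<Rightarrow> gen3 free_algebra fps" where
  "Q3 \<equiv> fps_map (powers_lin Xm3)"

abbreviation Q4 :: "(nat \<Rightarrow>\<^sub>0 complex) fps fps \<Rightarrow> gen4 free_algebra fps fps" where
  "Q4 \<equiv> fps_map (fps_map (powers_lin Xm4))"

lemma scal1_eq: "scal1 = fps_map scal"
  by (simp add: fun_eq_iff scal1_def fps_eq_iff)

lemma scal2_eq: "scal2 = fps_map (fps_map scal)"
  by (simp add: fun_eq_iff scal2_def scal1_eq fps_eq_iff)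

lemma scal_0: "scal 0 = 0"
  by (simp add: scal_eq_sc)

lemma fps_map_scal_0: "fps_map scal 0 = 0"
  by (simp add: fps_eq_iff scal_0)

lemma scal_of_int_1: "fps_map scal (of_int n) = fps_const (scal (of_int n))"
  by (simp add: fps_map_const scal_0 flip: fps_of_int)

lemma scal_of_int_2: "fps_map (fps_map scal) (of_int n) = const2 (scal (of_int n))"
proof -
  have "(of_int n :: complex fps fps) = const2 (of_int n)" by (simp add: fps_of_int)
  then show ?thesis by (simp add: fps_map_const fps_map_scal_0 scal_0)
qed

text \<open>
  A monomial \<open>y\<^sup>a h\<^sup>b x\<^sup>e\<close> is a left multiple of \<open>x\<close> if \<open>e > 0\<close>. Otherwise it is congruent to \<open>c\<^sup>b y\<^sup>a\<close>
  modulo the left multiples of \<open>h - c\<close>, for the scalar \<open>c\<close> by which \<open>h\<close> is to act on \<open>m\<^sub>0\<close>.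
\<close>

lemma (in complex_scalars) pbw_lin_split:
  "\<exists>v a b. pbw_lin \<iota> x y h l = linext \<iota> (\<lambda>k. y ^ k) v + a * x + b * (h - \<iota> c)"
proof -
  define D where "D = {f. \<exists>v a b. f = linext \<iota> (\<lambda>k. y ^ k) v + a * x + b * (h - \<iota> c)}"
  have D_add: "f + g \<in> D" if "f \<in> D" "g \<in> D" for f g
  proof -
    from that obtain v a b v' a' b' where "f = linext \<iota> (\<lambda>k. y ^ k) v + a * x + b * (h - \<iota> c)"
      "g = linext \<iota> (\<lambda>k. y ^ k) v' + a' * x + b' * (h - \<iota> c)" by (auto simp: D_def)
    then have "f + g = linext \<iota> (\<lambda>k. y ^ k) (v + v') + (a + a') * x + (b + b') * (h - \<iota> c)"
      by (simp add: linext_add distrib_right)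
    then show ?thesis unfolding D_def by blast
  qed
  have D_scalar: "\<iota> d * f \<in> D" if "f \<in> D" for f d
  proof -
    from that obtain v a b where "f = linext \<iota> (\<lambda>k. y ^ k) v + a * x + b * (h - \<iota> c)"
      by (auto simp: D_def)
    then have "\<iota> d * f = linext \<iota> (\<lambda>k. y ^ k) (sc d * v) + (\<iota> d * a) * x + (\<iota> d * b) * (h - \<iota> c)"
      by (simp add: linext_scalar distrib_left mult.assoc)
    then show ?thesis unfolding D_def by blast
  qed
  have D_sum: "sum f A \<in> D" if "\<And>i. i \<in> A \<Longrightarrow> f i \<in> D" for f and A :: "(nat \<times> nat \<times> nat) set"
    using that
  proof (induction A rule: infinite_finite_induct)
    have "0 = linext \<iota> (\<lambda>k. y ^ k) 0 + 0 * x + 0 * (h - \<iota> c)"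
      by (simp add: additive.zero[OF additive_linext])
    then have "0 \<in> D" unfolding D_def by blast
    then show "sum f {} \<in> D" "infinite A \<Longrightarrow> sum f A \<in> D" for A by simp_all
  qed (simp add: D_add)
  have mono: "y ^ a * h ^ b * x ^ e \<in> D" for a b e
  proof (cases e)
    case (Suc e')
    have "y ^ a * h ^ b * x ^ e = linext \<iota> (\<lambda>k. y ^ k) 0 + (y ^ a * h ^ b * x ^ e') * x + 0 * (h - \<iota> c)"
      by (simp add: Suc additive.zero[OF additive_linext] power_Suc2 mult.assoc del: power_Suc)
    then show ?thesis unfolding D_def by blast
  next
    case 0
    have "\<exists>t. h ^ b = \<iota> (c ^ b) + t * (h - \<iota> c)"
    proof (induction b)
      case (Suc b)
      then obtain t where "h ^ b = \<iota> (c ^ b) + t * (h - \<iota> c)" by blast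
      define z where "z = \<iota> (c ^ b)"
      have "h * z = z * h" unfolding z_def by (rule central[symmetric])
      moreover have "\<iota> (c ^ Suc b) = z * \<iota> c"
        unfolding z_def by (simp only: power_Suc2 mult)
      moreover have "h ^ Suc b = h * (z + t * (h - \<iota> c))"
        using \<open>h ^ b = _\<close> by (simp add: z_def)
      ultimately have "h ^ Suc b = \<iota> (c ^ Suc b) + (z + h * t) * (h - \<iota> c)"
        by (simp add: distrib_left distrib_right right_diff_distrib mult.assoc)
      then show ?case by blast
    qed (auto simp: one intro!: exI[of _ 0])
    then obtain t where "h ^ b = \<iota> (c ^ b) + t * (h - \<iota> c)" by blast
    then have "y ^ a * h ^ b * x ^ e = y ^ a * \<iota> (c ^ b) + (y ^ a * t) * (h - \<iota> c)"
      by (simp add: 0 distrib_left mult.assoc)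
    also have "y ^ a * \<iota> (c ^ b) = linext \<iota> (\<lambda>k. y ^ k) (single a (c ^ b))"
      by (simp only: linext_single central)
    finally have "y ^ a * h ^ b * x ^ e =
        linext \<iota> (\<lambda>k. y ^ k) (single a (c ^ b)) + 0 * x + (y ^ a * t) * (h - \<iota> c)"
      by simp
    then show ?thesis unfolding D_def by blast
  qed
  have "pbw_lin \<iota> x y h l \<in> D"
    unfolding pbw_lin_def linext_def by (rule D_sum) (auto intro!: D_scalar mono)
  then show ?thesis by (simp add: D_def)
qed

lemma fps_map_split:
  fixes P :: "'l \<Rightarrow> 'a::ring_1"
  assumes "\<And>l. \<exists>v a b. P l = Q v + a * x + b * k"
  shows "\<exists>v a b. fps_map P l = fps_map Q v + a * fps_const x + b * fps_const k"
proof -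
  have "\<forall>i. \<exists>v a b. P (l $ i) = Q v + a * x + b * k" using assms by blast
  then obtain v a b where "\<And>i. P (l $ i) = Q (v i) + a i * x + b i * k" by metis
  then have "fps_map P l = fps_map Q (Abs_fps v) + Abs_fps a * fps_const x + Abs_fps b * fps_const k"
    by (simp add: fps_eq_iff fps_mult_right_const_nth)
  then show ?thesis by blast
qed

text \<open>
  The value of an operator at the highest weight vector \<open>m\<^sub>0\<close>. The maps \<open>\<pi>0\<close>, \<open>\<pi>3\<close>, \<open>\<pi>4\<close> below are
  \<open>f \<mapsto> f m\<^sub>0\<close> in the three models.
\<close>

definition on_highest :: "endo \<Rightarrow> (nat \<Rightarrow>\<^sub>0 complex)" where
  "on_highest T = app T (single 0 1)"

lemma additive_on_highest: "Modules.additive on_highest"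
  by unfold_locales (simp add: on_highest_def)

lemma on_highest_raise_lin: "on_highest (raise_lin v) = v"
  unfolding on_highest_def by (rule app_raise_lin)

lemma on_highest_mult: "on_highest T = 0 \<Longrightarrow> on_highest (S * T) = 0"
  by (simp add: on_highest_def additive.zero[OF additive_app])

lemma on_highest_mult_nth: "(\<And>i. on_highest (T $ i) = 0) \<Longrightarrow> on_highest ((S * T) $ i) = 0"
  by (simp add: fps_mult_nth additive.sum[OF additive_on_highest] on_highest_mult sum.neutral)

lemma on_highest_mult_nth2: "(\<And>j i. on_highest (T $ j $ i) = 0) \<Longrightarrow> on_highest ((S * T) $ j $ i) = 0"
  by (simp add: fps_mult_nth2 additive.sum[OF additive_on_highest] on_highest_mult sum.neutral)

lemma on_highest_lower: "on_highest (lower w) = 0"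
  by (simp add: on_highest_def del: single_one)

lemma on_highest_weight: "on_highest (weight_op n - scE (of_int n)) = 0"
  by (simp add: on_highest_def weight_op_def del: single_one single_of_int)

definition \<pi>0 :: "int \<Rightarrow> gen3 free_algebra \<Rightarrow> (nat \<Rightarrow>\<^sub>0 complex)" where
  "\<pi>0 n f = on_highest (\<rho>0 n f)"

definition \<pi>3 :: "nat \<Rightarrow> int \<Rightarrow> gen3 free_algebra fps \<Rightarrow> (nat \<Rightarrow>\<^sub>0 complex) fps" where
  "\<pi>3 g n f = fps_map on_highest (R3 g n f)"

definition \<pi>4 :: "nat \<Rightarrow> int \<Rightarrow> gen4 free_algebra fps fps \<Rightarrow> (nat \<Rightarrow>\<^sub>0 complex) fps fps" where
  "\<pi>4 g n f = fps_map (fps_map on_highest) (R4 g n f)"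

lemma span_U:
  fixes f :: "gen3 free_algebra"
  assumes J: "ideal J type_ring" and rels: "U_rels \<subseteq> J"
  shows "\<exists>l. f - P3 l \<in> J"
proof -
  interpret sl2_relations scal J "var Xp3" "var Xm3" "var H3"
    by (intro sl2_relations.intro sl2_relations_axioms.intro scal.complex_scalars_axioms J)
      (use rels in \<open>auto simp: U_rels_def\<close>)
  have "f \<in> ordered_span"
  proof (rule free_algebra_induct_left)
    show "var z * f \<in> ordered_span" if "f \<in> ordered_span" for z f
      using span_left_generators[OF that] by (cases z) auto
  qed (auto intro: span_one span_add span_scalar)
  then show ?thesis by (auto simp: ordered_span_def cong_def)
qed

lemma eval_HC_quadratic:
  assumes "c \<noteq> 0" "d \<noteq> 0"
  shows "eval_HC [:[:a, b, c:], 0, [:d:]:] = scal a + scal b * var H4 + scal c * var H4 ^ 2 + scal d * var C4"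
  using assms by (simp add: eval_HC_def numeral_2_eq_2)

text \<open>
  Modulo \<open>(h,h')\<close> a bracket \<open>[x]\<close> is \<open>x\<close>, and the product over \<open>e\<close> is \<open>(C - (H \<minusplus> 1)\<^sup>2)/4\<close>.
\<close>

lemma eval_HC_classical:
  "eval_HC (XX_series g 1 $ 0 $ 0) =
     scal (-1/4) + scal (1/2) * var H4 + scal (-1/4) * var H4 ^ 2 + scal (1/4) * var C4"
  "eval_HC (XX_series g (-1) $ 0 $ 0) =
     scal (-1/4) + scal (-1/2) * var H4 + scal (-1/4) * var H4 ^ 2 + scal (1/4) * var C4"
proof -
  have XX: "XX_series g s $ 0 $ 0 = H_pm s 1 * H_pm s (-1)" for s
    by (simp add: XX_series_eq qt_bracket_nth_0_0[OF ring_morphism_cpp])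
  have "XX_series g 1 $ 0 $ 0 = [:[:-1/4, 1/2, -1/4:], 0, [:1/4:]:]"
    unfolding XX by (simp add: H_pm_def)
  then show "eval_HC (XX_series g 1 $ 0 $ 0) =
     scal (-1/4) + scal (1/2) * var H4 + scal (-1/4) * var H4 ^ 2 + scal (1/4) * var C4"
    by (simp only:) (rule eval_HC_quadratic, simp_all)
  have "XX_series g (-1) $ 0 $ 0 = [:[:-1/4, -1/2, -1/4:], 0, [:1/4:]:]"
    unfolding XX by (simp add: H_pm_def)
  then show "eval_HC (XX_series g (-1) $ 0 $ 0) =
     scal (-1/4) + scal (-1/2) * var H4 + scal (-1/4) * var H4 ^ 2 + scal (1/4) * var C4"
    by (simp only:) (rule eval_HC_quadratic, simp_all)
qed

text \<open>
  Modulo \<open>(h,h')\<close> the difference of the two product relations is \<open>[X\<^sup>+, X\<^sup>-] = H\<close>, so that the classical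
  reordering applies. The second of them expresses \<open>C\<close> as \<open>4 X\<^sup>- X\<^sup>+ + (H + 1)\<^sup>2\<close>; so the ordered
  span is also stable under multiplication by \<open>C\<close>.
\<close>

lemma span_Uhh:
  fixes f :: "gen4 free_algebra"
  assumes J: "ideal J type_ring" and rels: "\<And>r. r \<in> Uhh_rels g \<Longrightarrow> r $ 0 $ 0 \<in> J"
  shows "\<exists>l. f - P4 l \<in> J"
proof -
  let ?q = "\<lambda>s. eval_HC (XX_series g s $ 0 $ 0)"
  note Jd = ideal_type_ringD(2)[OF J] and Jl = ideal_type_ringD(4)[OF J]
  have two: "2 * const2 a = const2 (2 * a)" for a :: "gen4 free_algebra"
    by (simp add: mult_2)
  have rel: "var H4 * var Xp4 - var Xp4 * var H4 - 2 * var Xp4 \<in> J"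
    "var H4 * var Xm4 - var Xm4 * var H4 + 2 * var Xm4 \<in> J"
    "var Xp4 * var Xm4 - ?q 1 \<in> J" "var Xm4 * var Xp4 - ?q (-1) \<in> J"
  proof -
    have "(\<lambda>r. r $ 0 $ 0) ` Uhh_rels g \<subseteq> J" using rels by blast
    then show "var H4 * var Xp4 - var Xp4 * var H4 - 2 * var Xp4 \<in> J"
      "var H4 * var Xm4 - var Xm4 * var H4 + 2 * var Xm4 \<in> J"
      "var Xp4 * var Xm4 - ?q 1 \<in> J" "var Xm4 * var Xp4 - ?q (-1) \<in> J"
      unfolding Uhh_rels_def Let_def two by simp_all
  qed
  have "?q 1 - ?q (-1) = scal (1/2) * var H4 - scal (-1/2) * var H4"
    unfolding eval_HC_classical by simp
  also have "\<dots> = var H4"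
    by (simp add: scal_eq_sc flip: left_diff_distrib single_diff)
  finally have q_diff: "?q 1 - ?q (-1) = var H4" .
  have "var Xp4 * var Xm4 - ?q 1 - (var Xm4 * var Xp4 - ?q (-1)) =
      var Xp4 * var Xm4 - var Xm4 * var Xp4 - (?q 1 - ?q (-1))" by simp
  then have XX: "var Xp4 * var Xm4 - var Xm4 * var Xp4 - var H4 \<in> J"
    using Jd[OF rel(3,4)] by (simp only: q_diff)
  interpret sl2_relations scal J "var Xp4" "var Xm4" "var H4"
    by (intro sl2_relations.intro sl2_relations_axioms.intro scal.complex_scalars_axioms J rel XX)
  have C: "var C4 \<approx> scal 4 * (var Xm4 * var Xp4) + 1 + scal 2 * var H4 + var H4 * var H4"
  proof -
    have "scal 4 * ?q (-1) = scal (-1) + scal (-2) * var H4 + scal (-1) * var H4 ^ 2 + scal 1 * var C4"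
      unfolding eval_HC_classical by (simp add: scal_eq_sc distrib_left mult.assoc[symmetric] mult_single del: single_numeral)
    also have "\<dots> = var C4 - (1 + scal 2 * var H4 + var H4 * var H4)"
      by (simp add: scal_eq_sc power2_eq_square single_uminus)
    finally have "scal 4 * (var Xm4 * var Xp4 - ?q (-1)) =
        scal 4 * (var Xm4 * var Xp4) + 1 + scal 2 * var H4 + var H4 * var H4 - var C4"
      by (simp only: right_diff_distrib) (simp add: algebra_simps)
    then show ?thesis
      unfolding cong_def using Jl[OF rel(4), of "scal 4"] J_closed(6) by (metis minus_diff_eq)
  qed
  have "f \<in> ordered_span"
  proof (rule free_algebra_induct_left)
    show "var z * f \<in> ordered_span" if f: "f \<in> ordered_span" for z f
    proof (cases z)
      case C4
      show ?thesis unfolding C4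
      proof (rule span_cong)
        show "var C4 * f \<approx> scal 4 * (var Xm4 * (var Xp4 * f)) + f + scal 2 * (var H4 * f) + var H4 * (var H4 * f)"
          using cong_mult_right[OF C, of f] by (simp add: distrib_right mult.assoc)
      qed (intro span_add span_scalar span_left_generators f)
    qed (use span_left_generators[OF f] in auto)
  qed (auto intro: span_one span_add span_scalar)
  then show ?thesis by (auto simp: ordered_span_def cong_def)
qed

lemma additive_P3: "Modules.additive P3" and additive_P4: "Modules.additive P4"
  by (simp_all add: pbw_lin_def scal.additive_linext)

text \<open>
  The ideal is killed by the models of all Verma modules at once. This bounds the algebra from below, and
  the spanning property of the ordered monomials bounds it from above. The same argument serves for
  \<open>U\<^sub>h\<close> and for the algebra over \<open>\<complex>[[h,h']]\<close>, with spanning lifted by successive approximation and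
  independence reduced to the lowest coefficient.
\<close>

lemma coordinatised_U:
  "coordinatised_presentation scal (Idl\<^bsub>type_ring\<^esub> U_rels) (var Xp3) (var H3)
     sc sc P3 (powers_lin Xm3) \<pi>0"
proof (intro coordinatised_presentation.intro presentation.intro presentation_axioms.intro
    coordinatised_presentation_axioms.intro central_hom_scal central_hom_sc)
  show I: "ideal (Idl\<^bsub>type_ring\<^esub> U_rels) type_ring" by (rule genideal_type_ring)
  interpret \<rho>: ring_morphism "\<rho>0 n" for n by (rule ring_morphism_\<rho>0)
  have kill: "\<rho>0 n f = 0" if "f \<in> Idl\<^bsub>type_ring\<^esub> U_rels" for n f
    using genideal_type_ring(3)[OF ring_morphism_kernel_ideal[OF ring_morphism_\<rho>0], of U_rels n] that
      \<rho>0_kills_relations by auto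
  show "Modules.additive P3" by (rule additive_P3)
  show "P3 (sc c * l) = scal c * P3 l" for c l by (simp add: pbw_lin_def scal.linext_scalar)
  show "\<exists>l. f - P3 l \<in> Idl\<^bsub>type_ring\<^esub> U_rels" for f
    by (rule span_U[OF I]) (rule genideal_type_ring(2))
  show "l = 0" if "P3 l \<in> Idl\<^bsub>type_ring\<^esub> U_rels" for l
    using kill[OF that] unfolding \<rho>0_P3 by (rule pbw_independent_on_vermas)
  show "Modules.additive (powers_lin Xm3)" by (rule scal.additive_linext)
  show "powers_lin Xm3 (sc c * v) = scal c * powers_lin Xm3 v" for c v by (rule scal.linext_scalar)
  show "\<exists>v a b. P3 l = powers_lin Xm3 v + a * var Xp3 + b * (var H3 - scal (of_int n))" for n l
    by (rule scal.pbw_lin_split)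
  show "Modules.additive (\<pi>0 n)" for n
    by unfold_locales (simp add: \<pi>0_def \<rho>.add additive.add[OF additive_on_highest])
  show "\<pi>0 n f = 0" if "f \<in> Idl\<^bsub>type_ring\<^esub> U_rels" for n f
    by (simp add: \<pi>0_def kill[OF that] additive.zero[OF additive_on_highest])
  show "\<pi>0 n (a * var Xp3) = 0" for n a
    by (simp add: \<pi>0_def \<rho>.mult on_highest_mult on_highest_lower)
  show "\<pi>0 n (a * (var H3 - scal (of_int n))) = 0" for n a
    by (simp add: \<pi>0_def \<rho>.mult \<rho>.diff on_highest_mult on_highest_weight)
  show "\<pi>0 n (powers_lin Xm3 v) = v" for n v
    by (simp add: \<pi>0_def \<rho>0_powers on_highest_raise_lin)
qed

lemma coordinatised_Uh:
  "coordinatised_presentation scal1 (adic_closure1 (Idl\<^bsub>type_ring\<^esub> Uh_rels))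
     (fps_const (var Xp3)) (fps_const (var H3))
     (fps_map sc) (fps_map sc) (fps_map P3) Q3 (\<pi>3 g)"
  unfolding scal1_eq
proof (intro coordinatised_presentation.intro presentation.intro presentation_axioms.intro
    coordinatised_presentation_axioms.intro central_hom_fps_map central_hom_scal central_hom_sc)
  let ?I = "Idl\<^bsub>type_ring\<^esub> Uh_rels"
  have I: "ideal ?I type_ring" by (rule genideal_type_ring)
  show "ideal (adic_closure1 ?I) type_ring" by (rule ideal_adic_closure1[OF I])
  interpret R: ring_morphism "R3 g n" for n by (rule ring_morphism_R3)
  interpret U: coordinatised_presentation scal "Idl\<^bsub>type_ring\<^esub> U_rels" "var Xp3" "var Xm3" "var H3"
    sc sc P3 "powers_lin Xm3" \<pi>0 by (rule coordinatised_U)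
  have kill: "R3 g n f = 0" if "f \<in> adic_closure1 ?I" for n f
  proof (rule adic_closure1_kernel[OF _ that])
    show "R3 g n s = 0" if "s \<in> ?I" for s
      using genideal_type_ring(3)[OF ring_morphism_kernel_ideal[OF ring_morphism_R3], of Uh_rels g n] that
        R3_kills_relations by auto
  qed
  show "Modules.additive (fps_map P3)" by (intro additive_fps_map additive_P3)
  show "fps_map P3 (fps_map sc c * l) = fps_map scal c * fps_map P3 l" for c l
    by (rule fps_map_scalar[OF U.P])
  show "\<exists>l. f - fps_map P3 l \<in> adic_closure1 ?I" for f
  proof (rule complement_lift1[OF additive_P3 I])
    let ?J = "(\<lambda>r. r $ 0) ` ?I"
    have "surj (\<lambda>f::gen3 free_algebra fps. f $ 0)" by (rule surjI[of _ fps_const]) simp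
    then have J: "ideal ?J type_ring" by (rule ring_morphism_image_ideal[OF ring_morphism_fps_nth_0 _ I])
    have two: "2 * fps_const a = fps_const (2 * a)" for a :: "gen3 free_algebra"
      by (simp add: mult_2)
    have "eval_H (sinh_quot $ 0) = var H3"
      unfolding sinh_quot_nth_0 by (simp add: eval_H_def scal_eq_sc)
    then have "U_rels \<subseteq> (\<lambda>r. r $ 0) ` Uh_rels"
      unfolding U_rels_def Uh_rels_def Let_def two by simp
    also have "\<dots> \<subseteq> ?J" by (rule image_mono) (rule genideal_type_ring(2))
    finally show "\<exists>l. \<exists>i\<in>?I. f - P3 l = i $ 0" for f
      using span_U[OF J] by blast
  qed
  show "l = 0" if "fps_map P3 l \<in> adic_closure1 ?I" for l
  proof (rule adic_ext_separates[where \<rho> = "\<rho>3 g"])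
    show "R3 g m (fps_map P3 l) = 0" for m by (rule kill[OF that])
    show "l = 0" if "\<And>m. \<rho>3 g m (P3 l) $ 0 = 0" for l
      using that unfolding \<rho>3_P3_nth_0 \<rho>0_P3 by (rule pbw_independent_on_vermas)
  qed (simp_all add: additive.zero[OF additive_P3] ring_morphism.additive[OF ring_morphism_\<rho>3])
  show "Modules.additive Q3" by (intro additive_fps_map scal.additive_linext)
  show "Q3 (fps_map sc c * v) = fps_map scal c * Q3 v" for c v
    by (rule fps_map_scalar[OF U.Q])
  have h: "fps_const (var H3) - fps_map scal (of_int n) = fps_const (var H3 - scal (of_int n))" for n
    by (simp add: scal_of_int_1)
  show "\<exists>v a b. fps_map P3 l = Q3 v + a * fps_const (var Xp3) +
      b * (fps_const (var H3) - fps_map scal (of_int n))" for n l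
    unfolding h by (rule fps_map_split[OF U.split])
  show "Modules.additive (\<pi>3 g n)" for n
    by unfold_locales (simp add: \<pi>3_def R.add additive.add[OF additive_fps_map[OF additive_on_highest]])
  show "\<pi>3 g n f = 0" if "f \<in> adic_closure1 ?I" for n f
    by (simp add: \<pi>3_def kill[OF that] fps_eq_iff additive.zero[OF additive_on_highest])
  show "\<pi>3 g n (a * fps_const (var Xp3)) = 0" for n a
    unfolding \<pi>3_def R.mult R3_const by (rule fps_ext) (simp add: on_highest_mult_nth on_highest_lower)
  show "\<pi>3 g n (a * (fps_const (var H3) - fps_map scal (of_int n))) = 0" for n a
    unfolding \<pi>3_def R.mult h R3_const
    by (rule fps_ext) (simp add: on_highest_mult on_highest_weight ring_morphism.diff[OF ring_morphism_\<rho>3] additive.zero[OF additive_on_highest])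
  show "\<pi>3 g n (Q3 v) = v" for n v
  proof -
    have "R3 g n (Q3 v) = Abs_fps (\<lambda>i. raise_lin (v $ i))"
      by (rule adic_ext_constant_values) (simp add: \<rho>3_powers)
    then show ?thesis by (simp add: \<pi>3_def fps_eq_iff on_highest_raise_lin)
  qed
qed

lemma coordinatised_Uhh:
  assumes g: "g \<ge> 1"
  shows "coordinatised_presentation scal2 (Uhh_ideal g)
     (const2 (var Xp4)) (const2 (var H4))
     (fps_map (fps_map sc)) (fps_map (fps_map sc)) (fps_map (fps_map P4)) Q4 (\<pi>4 g)"
  unfolding scal2_eq Uhh_ideal_def
proof (intro coordinatised_presentation.intro presentation.intro presentation_axioms.intro
    coordinatised_presentation_axioms.intro central_hom_fps_map central_hom_scal central_hom_sc)
  let ?I = "Idl\<^bsub>type_ring\<^esub> (Uhh_rels g)"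
  have I: "ideal ?I type_ring" by (rule genideal_type_ring)
  show "ideal (adic_closure2 ?I) type_ring" by (rule ideal_adic_closure2[OF I])
  interpret R: ring_morphism "R4 g n" for n by (rule ring_morphism_R4)
  have kill: "R4 g n f = 0" if "f \<in> adic_closure2 ?I" for n f
  proof (rule adic_closure2_kernel[OF _ that])
    show "R4 g n s = 0" if "s \<in> ?I" for s
      using genideal_type_ring(3)[OF ring_morphism_kernel_ideal[OF ring_morphism_R4], of "Uhh_rels g" g n] that
        R4_kills_relations[OF g] by auto
  qed
  show "Modules.additive (fps_map (fps_map P4))" by (intro additive_fps_map additive_P4)
  have P4_scalar: "P4 (sc c * l) = scal c * P4 l" for c l by (simp add: pbw_lin_def scal.linext_scalar)
  show "fps_map (fps_map P4) (fps_map (fps_map sc) c * l) = fps_map (fps_map scal) c * fps_map (fps_map P4) l" for c l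
    by (rule fps_map_scalar[OF additive_fps_map[OF additive_P4] fps_map_scalar[OF additive_P4 P4_scalar]])
  show "\<exists>l. f - fps_map (fps_map P4) l \<in> adic_closure2 ?I" for f
  proof (rule complement_lift2[OF additive_P4 I])
    let ?J = "(\<lambda>r. r $ 0 $ 0) ` ?I"
    have "surj (\<lambda>f::gen4 free_algebra fps fps. f $ 0 $ 0)" by (rule surjI[of _ const2]) simp
    then have J: "ideal ?J type_ring"
      by (rule ring_morphism_image_ideal[OF ring_morphism_comp[OF ring_morphism_fps_nth_0 ring_morphism_fps_nth_0] _ I])
    have "r $ 0 $ 0 \<in> ?J" if "r \<in> Uhh_rels g" for r
      using genideal_type_ring(2)[of "Uhh_rels g"] that by blast
    from span_Uhh[OF J this] show "\<exists>l. \<exists>i\<in>?I. f - P4 l = i $ 0 $ 0" for f by blast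
  qed
  show "l = 0" if l: "fps_map (fps_map P4) l \<in> adic_closure2 ?I" for l
  proof (rule adic_ext_separates[where \<rho> = "\<lambda>m. adic_ext_inner (\<rho>4 g m)" and P = "fps_map P4"])
    show "adic_ext (adic_ext_inner (\<rho>4 g m)) (fps_map (fps_map P4) l) = 0" for m
      using kill[OF l] by (simp add: adic_ext2_def)
    show "fps_map P4 0 = 0" by (simp add: fps_eq_iff additive.zero[OF additive_P4])
    show "Modules.additive (adic_ext_inner (\<rho>4 g m))" for m
      by (intro ring_morphism.additive ring_morphism_adic_ext_inner ring_morphism_\<rho>4)
    show "l = 0" if l: "\<And>m. adic_ext_inner (\<rho>4 g m) (fps_map P4 l) $ 0 = 0" for l
    proof (rule adic_ext_separates[where \<rho> = "\<lambda>m a. \<rho>4 g m a $ 0" and P = P4])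
      show "adic_ext (\<lambda>a. \<rho>4 g m a $ 0) (fps_map P4 l) = 0" for m using l by simp
      show "l = 0" if "\<And>m. \<rho>4 g m (P4 l) $ 0 $ 0 = 0" for l
        using that unfolding \<rho>4_P4_nth_0 \<rho>3_P3_nth_0 \<rho>0_P3 by (rule pbw_independent_on_vermas)
    qed (simp_all add: additive.zero[OF additive_P4] additive_nth ring_morphism.additive[OF ring_morphism_\<rho>4])
  qed
  have Q4: "Modules.additive (powers_lin Xm4)" by (rule scal.additive_linext)
  show "Modules.additive Q4" by (intro additive_fps_map Q4)
  show "Q4 (fps_map (fps_map sc) c * v) =
      fps_map (fps_map scal) c * Q4 v" for c v
    by (rule fps_map_scalar[OF additive_fps_map[OF Q4] fps_map_scalar[OF Q4 scal.linext_scalar]])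
  have h: "const2 (var H4) - fps_map (fps_map scal) (of_int n) = const2 (var H4 - scal (of_int n))" for n
    by (simp add: scal_of_int_2)
  show "\<exists>v a b. fps_map (fps_map P4) l = Q4 v + a * const2 (var Xp4) +
      b * (const2 (var H4) - fps_map (fps_map scal) (of_int n))" for n l
    unfolding h by (intro fps_map_split scal.pbw_lin_split)
  show "Modules.additive (\<pi>4 g n)" for n
    by unfold_locales (simp add: \<pi>4_def R.add additive.add[OF additive_fps_map[OF additive_fps_map[OF additive_on_highest]]])
  show "\<pi>4 g n f = 0" if "f \<in> adic_closure2 ?I" for n f
    by (simp add: \<pi>4_def kill[OF that] fps_eq_iff additive.zero[OF additive_on_highest])
  show "\<pi>4 g n (a * const2 (var Xp4)) = 0" for n a
    unfolding \<pi>4_def R.mult R4_const by (intro fps_ext) (simp add: on_highest_mult_nth2 on_highest_lower)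
  show "\<pi>4 g n (a * (const2 (var H4) - fps_map (fps_map scal) (of_int n))) = 0" for n a
    unfolding \<pi>4_def R.mult h R4_const
    by (intro fps_ext) (simp add: on_highest_mult on_highest_weight ring_morphism.diff[OF ring_morphism_\<rho>4] additive.zero[OF additive_on_highest])
  show "\<pi>4 g n (Q4 v) = v" for n v
  proof -
    have "R4 g n (Q4 v) $ j $ i = raise_lin (v $ j $ i)" for j i
      by (rule adic_ext2_constant_values[where \<sigma> = "\<lambda>j i. raise_lin (v $ j $ i)"]) (simp add: \<rho>4_powers)
    then show ?thesis by (simp add: \<pi>4_def fps_eq_iff on_highest_raise_lin)
  qed
qed

text \<open>
  Reduction modulo \<open>h'\<close>, and then modulo \<open>h\<close>, of the product of an element of the algebra with a
  vector of the Verma module, both in coordinates.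
\<close>

lemma \<pi>4_nth_0:
  "\<pi>4 g n (fps_map (fps_map P4) F * Q4 v) $ 0 =
     \<pi>3 g n (fps_map P3 (F $ 0) * Q3 (v $ 0))"
proof -
  let ?\<rho> = "\<lambda>a. \<rho>4 g n a $ 0"
  have \<rho>: "ring_morphism ?\<rho>" by (rule ring_morphism_comp[OF ring_morphism_fps_nth_0 ring_morphism_\<rho>4])
  have P: "adic_ext ?\<rho> (fps_map P4 l) = R3 g n (fps_map P3 l)" for l
    by (simp add: fps_eq_iff adic_ext_nth \<rho>4_P4_nth_0)
  have Q: "adic_ext ?\<rho> (fps_map (powers_lin Xm4) w) = R3 g n (Q3 w)" for w
    by (simp add: fps_eq_iff adic_ext_nth \<rho>4_powers \<rho>3_powers)
  show ?thesis
    by (simp add: \<pi>4_def \<pi>3_def adic_ext2_nth_0 ring_morphism.mult[OF ring_morphism_adic_ext[OF \<rho>]]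
        ring_morphism.mult[OF ring_morphism_R3] P Q)
qed

lemma \<pi>3_nth_0:
  "\<pi>3 g n (fps_map P3 F * Q3 v) $ 0 = \<pi>0 n (P3 (F $ 0) * powers_lin Xm3 (v $ 0))"
  by (simp add: \<pi>3_def \<pi>0_def ring_morphism.mult[OF ring_morphism_R3] ring_morphism.mult[OF ring_morphism_\<rho>0]
      \<rho>3_P3_nth_0 \<rho>3_powers \<rho>0_powers)


section \<open>The Verma modules of the deformed algebra\<close>

theorem proposition5p1:
  fixes n :: int and g :: nat
  assumes "g \<ge> 1"
  shows
    "infinite_rank_representation (Uhh_sl2 g) (verma (Uhh_sl2 g) n) (verma_act (Uhh_sl2 g) n)
       (verma U_sl2 n)
     \<and>
     (\<exists>\<theta> \<phi>.
        identification
          (series_module2 U_sl2) (\<lambda>i. series_const2 U_sl2 (pbw U_sl2 i))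
          (Uhh_sl2 g) (pbw (Uhh_sl2 g)) \<theta> \<and>
        identification
          (series_module2 (verma U_sl2 n))
          (\<lambda>j. series_const2 (verma U_sl2 n) (verma_vec U_sl2 n j))
          (verma (Uhh_sl2 g) n) (verma_vec (Uhh_sl2 g) n) \<phi> \<and>
        deformation_along_hh'
          U_sl2 (verma U_sl2 n) (verma_act U_sl2 n)
          (Uhh_sl2 g) (verma (Uhh_sl2 g) n) (verma_act (Uhh_sl2 g) n) \<theta> \<phi>)
     \<and>
     (\<exists>\<theta> \<phi> \<psi>.
        identification
          (series_module (verma U_sl2 n))
          (\<lambda>j. series_const (verma U_sl2 n) (verma_vec U_sl2 n j))
          (verma Uh_sl2 n) (verma_vec Uh_sl2 n) \<psi> \<and>
        identification
          (series_module Uh_sl2) (\<lambda>i. series_const Uh_sl2 (pbw Uh_sl2 i))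
          (Uhh_sl2 g) (pbw (Uhh_sl2 g)) \<theta> \<and>
        identification
          (series_module (verma Uh_sl2 n))
          (\<lambda>j. series_const (verma Uh_sl2 n) (verma_vec Uh_sl2 n j))
          (verma (Uhh_sl2 g) n) (verma_vec (Uhh_sl2 g) n) \<phi> \<and>
        deformation_along_h'
          Uh_sl2 (verma Uh_sl2 n) (verma_act Uh_sl2 n)
          (Uhh_sl2 g) (verma (Uhh_sl2 g) n) (verma_act (Uhh_sl2 g) n) \<theta> \<phi>)
     \<and>
     weight_representation (Uhh_sl2 g) (verma (Uhh_sl2 g) n) (verma_act (Uhh_sl2 g) n)
     \<and>
     topological_basis (verma (Uhh_sl2 g) n) (verma_vec (Uhh_sl2 g) n)
     \<and>
     (\<forall>j.
        verma_act (Uhh_sl2 g) n (Hw (Uhh_sl2 g)) (verma_vec (Uhh_sl2 g) n j) =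
          of_int (n - 2 * int j) \<odot>\<^bsub>verma (Uhh_sl2 g) n\<^esub> verma_vec (Uhh_sl2 g) n j \<and>
        verma_act (Uhh_sl2 g) n (Uhh_C g) (verma_vec (Uhh_sl2 g) n j) =
          of_int ((n + 1)^2) \<odot>\<^bsub>verma (Uhh_sl2 g) n\<^esub> verma_vec (Uhh_sl2 g) n j \<and>
        verma_act (Uhh_sl2 g) n (Xm (Uhh_sl2 g)) (verma_vec (Uhh_sl2 g) n j) =
          verma_vec (Uhh_sl2 g) n (j + 1) \<and>
        verma_act (Uhh_sl2 g) n (Xp (Uhh_sl2 g)) (verma_vec (Uhh_sl2 g) n j) =
          (if j = 0 then \<zero>\<^bsub>verma (Uhh_sl2 g) n\<^esub>
           else (qt_int g (int j) * qt_int g (n - int j + 1))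
                  \<odot>\<^bsub>verma (Uhh_sl2 g) n\<^esub> verma_vec (Uhh_sl2 g) n (j - 1)))"
    (is "?rank \<and> ?along_hh' \<and> ?along_h' \<and> ?weight \<and> ?basis \<and> (\<forall>j. ?act_H j \<and> ?act_C j \<and> ?act_Xm j \<and> ?act_Xp j)")
proof -
  interpret U: coordinatised_presentation scal "Idl\<^bsub>type_ring\<^esub> U_rels" "var Xp3" "var Xm3" "var H3"
    sc sc P3 "powers_lin Xm3" \<pi>0
    by (rule coordinatised_U)
  interpret Uh: coordinatised_presentation scal1 "adic_closure1 (Idl\<^bsub>type_ring\<^esub> Uh_rels)"
    "fps_const (var Xp3)" "fps_const (var Xm3)" "fps_const (var H3)"
    "fps_map sc" "fps_map sc" "fps_map P3" "Q3" "\<pi>3 g"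
    by (rule coordinatised_Uh)
  interpret Uhh: coordinatised_presentation scal2 "Uhh_ideal g"
    "const2 (var Xp4)" "const2 (var Xm4)" "const2 (var H4)"
    "fps_map (fps_map sc)" "fps_map (fps_map sc)" "fps_map (fps_map P4)" "Q4" "\<pi>4 g"
    by (rule coordinatised_Uhh[OF assms])
  have Udef: "U.U = U_sl2" "Uh.U = Uh_sl2" "Uhh.U = Uhh_sl2 g"
    by (simp_all add: U_sl2_def Uh_sl2_def Uhh_sl2_def)
  have C: "Uhh_C g = Uhh.cls (const2 (var C4))"
    by (simp add: Uhh_C_def Uhh.cls_def)

  \<comment> \<open>Coordinates \<open>?a\<close> of the algebras and \<open>?b\<close> of their Verma modules.\<close>
  let ?aU = "\<lambda>l. U.cls (P3 l)" and ?aUh = "\<lambda>l. Uh.cls (fps_map P3 l)"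
    and ?aUhh = "\<lambda>l. Uhh.cls (fps_map (fps_map P4) l)"
  let ?bU = "\<lambda>v. U.vcls n (powers_lin Xm3 v)" and ?bUh = "\<lambda>v. Uh.vcls n (Q3 v)"
    and ?bUhh = "\<lambda>v. Uhh.vcls n (Q4 v)"
  interpret aU: coordinates sc U_sl2 ?aU using U.algebra_coordinates by (simp only: Udef)
  interpret aUh: coordinates "fps_map sc" Uh_sl2 ?aUh using Uh.algebra_coordinates by (simp only: Udef)
  interpret aUhh: coordinates "fps_map (fps_map sc)" "Uhh_sl2 g" ?aUhh
    using Uhh.algebra_coordinates by (simp only: Udef)
  interpret bU: coordinates sc "verma U_sl2 n" ?bU using U.verma_coordinates by (simp only: Udef)
  interpret bUh: coordinates "fps_map sc" "verma Uh_sl2 n" ?bUh using Uh.verma_coordinates by (simp only: Udef)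
  interpret bUhh: coordinates "fps_map (fps_map sc)" "verma (Uhh_sl2 g) n" ?bUhh
    using Uhh.verma_coordinates by (simp only: Udef)
  interpret aU1: coordinates "fps_map sc" "series_module U_sl2" "\<lambda>F i. ?aU (F $ i)" by (rule aU.series)
  interpret bU1: coordinates "fps_map sc" "series_module (verma U_sl2 n)" "\<lambda>F i. ?bU (F $ i)" by (rule bU.series)
  interpret aU2: coordinates "fps_map (fps_map sc)" "series_module2 U_sl2" "\<lambda>F j i. ?aU (F $ j $ i)" by (rule aU1.series)
  interpret bU2: coordinates "fps_map (fps_map sc)" "series_module2 (verma U_sl2 n)" "\<lambda>F j i. ?bU (F $ j $ i)" by (rule bU1.series)
  interpret aUh1: coordinates "fps_map (fps_map sc)" "series_module Uh_sl2" "\<lambda>F j. ?aUh (F $ j)" by (rule aUh.series)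
  interpret bUh1: coordinates "fps_map (fps_map sc)" "series_module (verma Uh_sl2 n)" "\<lambda>F j. ?bUh (F $ j)" by (rule bUh.series)

  let ?e = "\<lambda>i. single i (1::complex)"
  have P3_e: "P3 (?e (a, b, c)) = var Xm3 ^ a * var H3 ^ b * var Xp3 ^ c" for a b c
    by (simp add: pbw_lin_def scal.one)
  have P4_e: "P4 (?e (a, b, c)) = var Xm4 ^ a * var H4 ^ b * var Xp4 ^ c" for a b c
    by (simp add: pbw_lin_def scal.one)
  have Q_e: "powers_lin z (?e k) = var z ^ k" for z :: 'z and k
    by (simp add: scal.one)
  have P0: "P3 0 = 0" "P4 0 = 0" "powers_lin z 0 = 0" for z
    by (simp_all add: additive.zero[OF additive_P3] additive.zero[OF additive_P4] additive.zero[OF scal.additive_linext])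
  have map_const: "fps_map P3 (fps_const l) = fps_const (P3 l)" "fps_map (fps_map P4) (const2 l) = const2 (P4 l)"
    "Q3 (fps_const v) = fps_const (powers_lin Xm3 v)"
    "Q4 (const2 v) = const2 (powers_lin Xm4 v)" for l v
    by (auto simp: fps_eq_iff P0)
  have pbwU: "pbw U_sl2 i = ?aU (?e i)" for i
    using U.U_pbw[unfolded Udef] by (cases i) (simp add: P3_e)
  have pbwUh: "pbw Uh_sl2 i = ?aUh (fps_const (?e i))" for i
    using Uh.U_pbw[unfolded Udef] by (cases i) (simp add: P3_e map_const fps_const_power)
  have pbwUhh: "pbw (Uhh_sl2 g) i = ?aUhh (const2 (?e i))" for i
    using Uhh.U_pbw[unfolded Udef] by (cases i) (simp add: P4_e map_const fps_const_power)
  have vecU: "verma_vec U_sl2 n k = ?bU (?e k)" for k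
    using U.verma_vec_eq[unfolded Udef] by (simp add: scal.one)
  have vecUh: "verma_vec Uh_sl2 n k = ?bUh (fps_const (?e k))" for k
    using Uh.verma_vec_eq[unfolded Udef] by (simp add: scal.one map_const fps_const_power)
  have vecUhh: "verma_vec (Uhh_sl2 g) n k = ?bUhh (const2 (?e k))" for k
    using Uhh.verma_vec_eq[unfolded Udef] by (simp add: scal.one map_const fps_const_power)

  have bases: "series_const2 U_sl2 (pbw U_sl2 i) = (\<lambda>j i'. ?aU (const2 (?e i) $ j $ i'))"
    "series_const2 (verma U_sl2 n) (verma_vec U_sl2 n k) = (\<lambda>j i. ?bU (const2 (?e k) $ j $ i))"
    "series_const (verma U_sl2 n) (verma_vec U_sl2 n k) = (\<lambda>i. ?bU (fps_const (?e k) $ i))"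
    "series_const Uh_sl2 (pbw Uh_sl2 i) = (\<lambda>j. ?aUh (const2 (?e i) $ j))"
    "series_const (verma Uh_sl2 n) (verma_vec Uh_sl2 n k) = (\<lambda>j. ?bUh (const2 (?e k) $ j))" for i k
    by (simp_all only: pbwU pbwUh vecU vecUh aU.series_const aU1.series_const bU.series_const
        bU1.series_const aUh.series_const bUh.series_const)

  have rep: "representation U_sl2 (verma U_sl2 n) (verma_act U_sl2 n)"
    "representation Uh_sl2 (verma Uh_sl2 n) (verma_act Uh_sl2 n)"
    "representation (Uhh_sl2 g) (verma (Uhh_sl2 g) n) (verma_act (Uhh_sl2 g) n)"
    using U.representation_verma Uh.representation_verma Uhh.representation_verma by (simp_all only: Udef)
  have actU: "verma_act U_sl2 n (?aU l) (?bU v) = ?bU (\<pi>0 n (P3 l * powers_lin Xm3 v))" for l v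
    using U.verma_act_coordinates by (simp only: Udef)
  have actUh: "verma_act Uh_sl2 n (?aUh l) (?bUh v) = ?bUh (\<pi>3 g n (fps_map P3 l * Q3 v))" for l v
    using Uh.verma_act_coordinates by (simp only: Udef)
  have actUhh: "verma_act (Uhh_sl2 g) n (Uhh.cls f) (?bUhh v) =
      ?bUhh (\<pi>4 g n (f * Q4 v))" for f v
    using Uhh.verma_act_coordinates by (simp only: Udef)

  have rank: ?rank
  proof -
    \<comment> \<open>Only the isomorphism is needed here, so the family that it matches is the trivial one.\<close>
    obtain \<theta> where "identification (series_module2 (verma U_sl2 n)) (\<lambda>i::unit. \<lambda>j i. ?bU ((0::(nat \<Rightarrow>\<^sub>0 complex) fps fps) $ j $ i))
        (verma (Uhh_sl2 g) n) (\<lambda>i. ?bUhh 0) \<theta>"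
      by (rule identification_of_coordinates[OF bU2.coordinates_axioms bUhh.coordinates_axioms, of _ "\<lambda>_. 0"]) auto
    moreover have "\<not> finite_dimensional (verma U_sl2 n)"
      by (rule not_finite_dimensional[OF bU.coordinates_axioms]) simp
    ultimately show ?thesis
      using rep bU.module by (auto simp: infinite_rank_representation_def identification_def)
  qed

  have along_hh': ?along_hh'
  proof -
    obtain \<theta> where \<theta>: "identification (series_module2 U_sl2) (\<lambda>i. series_const2 U_sl2 (pbw U_sl2 i))
        (Uhh_sl2 g) (pbw (Uhh_sl2 g)) \<theta>" "\<And>F. \<theta> (\<lambda>j i. ?aU (F $ j $ i)) = ?aUhh F"
      by (rule identification_of_coordinates[OF aU2.coordinates_axioms aUhh.coordinates_axioms bases(1) pbwUhh]) (rule that, assumption+)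
    obtain \<phi> where \<phi>: "identification (series_module2 (verma U_sl2 n)) (\<lambda>j. series_const2 (verma U_sl2 n) (verma_vec U_sl2 n j))
        (verma (Uhh_sl2 g) n) (verma_vec (Uhh_sl2 g) n) \<phi>" "\<And>F. \<phi> (\<lambda>j i. ?bU (F $ j $ i)) = ?bUhh F"
      by (rule identification_of_coordinates[OF bU2.coordinates_axioms bUhh.coordinates_axioms bases(2) vecUhh]) (rule that, assumption+)
    have "\<exists>w\<in>carrier (series_module2 (verma U_sl2 n)).
          verma_act (Uhh_sl2 g) n (\<theta> f) (\<phi> v) = \<phi> w \<and> w 0 0 = verma_act U_sl2 n (f 0 0) (v 0 0)"
      if "f \<in> carrier (series_module2 U_sl2)" "v \<in> carrier (series_module2 (verma U_sl2 n))" for f v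
    proof -
      from that(1)[unfolded aU2.carrier] obtain F where f: "f = (\<lambda>j i. ?aU (F $ j $ i))" by (rule imageE)
      from that(2)[unfolded bU2.carrier] obtain V where v: "v = (\<lambda>j i. ?bU (V $ j $ i))" by (rule imageE)
      define W where "W = \<pi>4 g n (fps_map (fps_map P4) F * Q4 V)"
      have "verma_act (Uhh_sl2 g) n (\<theta> f) (\<phi> v) = \<phi> (\<lambda>j i. ?bU (W $ j $ i))"
        unfolding f v \<theta>(2) \<phi>(2) actUhh W_def ..
      moreover have "?bU (W $ 0 $ 0) = verma_act U_sl2 n (f 0 0) (v 0 0)"
        unfolding f v actU W_def \<pi>4_nth_0 \<pi>3_nth_0 ..
      ultimately show ?thesis by (intro bexI[of _ "\<lambda>j i. ?bU (W $ j $ i)"]) simp_all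
    qed
    then have "deformation_along_hh' U_sl2 (verma U_sl2 n) (verma_act U_sl2 n)
        (Uhh_sl2 g) (verma (Uhh_sl2 g) n) (verma_act (Uhh_sl2 g) n) \<theta> \<phi>"
      unfolding deformation_along_hh'_def using rep(1,3) by (intro conjI ballI)
    then show ?thesis using \<theta>(1) \<phi>(1) by (intro exI[of _ \<theta>] exI[of _ \<phi>] conjI)
  qed

  have along_h': ?along_h'
  proof -
    obtain \<psi> where \<psi>: "identification (series_module (verma U_sl2 n)) (\<lambda>j. series_const (verma U_sl2 n) (verma_vec U_sl2 n j))
        (verma Uh_sl2 n) (verma_vec Uh_sl2 n) \<psi>"
      by (rule identification_of_coordinates[OF bU1.coordinates_axioms bUh.coordinates_axioms bases(3) vecUh]) (rule that, assumption+)
    obtain \<theta> where \<theta>: "identification (series_module Uh_sl2) (\<lambda>i. series_const Uh_sl2 (pbw Uh_sl2 i))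
        (Uhh_sl2 g) (pbw (Uhh_sl2 g)) \<theta>" "\<And>F. \<theta> (\<lambda>j. ?aUh (F $ j)) = ?aUhh F"
      by (rule identification_of_coordinates[OF aUh1.coordinates_axioms aUhh.coordinates_axioms bases(4) pbwUhh]) (rule that, assumption+)
    obtain \<phi> where \<phi>: "identification (series_module (verma Uh_sl2 n)) (\<lambda>j. series_const (verma Uh_sl2 n) (verma_vec Uh_sl2 n j))
        (verma (Uhh_sl2 g) n) (verma_vec (Uhh_sl2 g) n) \<phi>" "\<And>F. \<phi> (\<lambda>j. ?bUh (F $ j)) = ?bUhh F"
      by (rule identification_of_coordinates[OF bUh1.coordinates_axioms bUhh.coordinates_axioms bases(5) vecUhh]) (rule that, assumption+)
    have "\<exists>w\<in>carrier (series_module (verma Uh_sl2 n)).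
          verma_act (Uhh_sl2 g) n (\<theta> f) (\<phi> v) = \<phi> w \<and> w 0 = verma_act Uh_sl2 n (f 0) (v 0)"
      if "f \<in> carrier (series_module Uh_sl2)" "v \<in> carrier (series_module (verma Uh_sl2 n))" for f v
    proof -
      from that(1)[unfolded aUh1.carrier] obtain F where f: "f = (\<lambda>j. ?aUh (F $ j))" by (rule imageE)
      from that(2)[unfolded bUh1.carrier] obtain V where v: "v = (\<lambda>j. ?bUh (V $ j))" by (rule imageE)
      define W where "W = \<pi>4 g n (fps_map (fps_map P4) F * Q4 V)"
      have "verma_act (Uhh_sl2 g) n (\<theta> f) (\<phi> v) = \<phi> (\<lambda>j. ?bUh (W $ j))"
        unfolding f v \<theta>(2) \<phi>(2) actUhh W_def ..
      moreover have "?bUh (W $ 0) = verma_act Uh_sl2 n (f 0) (v 0)"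
        unfolding f v actUh W_def \<pi>4_nth_0 ..
      ultimately show ?thesis by (intro bexI[of _ "\<lambda>j. ?bUh (W $ j)"]) simp_all
    qed
    then have "deformation_along_h' Uh_sl2 (verma Uh_sl2 n) (verma_act Uh_sl2 n)
        (Uhh_sl2 g) (verma (Uhh_sl2 g) n) (verma_act (Uhh_sl2 g) n) \<theta> \<phi>"
      unfolding deformation_along_h'_def using rep(2,3) by (intro conjI ballI)
    then show ?thesis using \<psi> \<theta>(1) \<phi>(1) by (intro exI[of _ \<theta>] exI[of _ \<phi>] exI[of _ \<psi>] conjI)
  qed

  \<comment> \<open>From here on, the action of the generators is read off from the model.\<close>
  have act_var: "verma_act (Uhh_sl2 g) n (Uhh.cls (const2 (var z))) (?bUhh v) =
      ?bUhh (\<pi>4 g n (const2 (var z) * Q4 v))" for z v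
    by (rule actUhh)
  have R4_Q: "R4 g n (Q4 v) $ j $ i = raise_lin (v $ j $ i)" for v j i
    by (rule adic_ext2_constant_values[where \<sigma> = "\<lambda>j i. raise_lin (v $ j $ i)"]) (simp add: \<rho>4_powers)
  have \<pi>4_const: "\<pi>4 g n (const2 (var z) * Q4 v) $ j $ i = app T (v $ j $ i)"
    if "letter4 g n z = const2 T" for z v j i T
    by (simp add: \<pi>4_def ring_morphism.mult[OF ring_morphism_R4] R4_const that R4_Q on_highest_def
        app_raise_lin del: single_one)
  have act_const: "verma_act (Uhh_sl2 g) n (Uhh.cls (const2 (var z))) (?bUhh v) = ?bUhh (fps_map (fps_map (app T)) v)"
    if "letter4 g n z = const2 T" for z v T
    unfolding act_var by (rule arg_cong[of _ _ ?bUhh]) (simp add: fps_eq_iff \<pi>4_const[OF that])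

  have weights: ?weight
  proof (rule weight_representation_diagonal[OF bUhh.coordinates_axioms rep(3)])
    show "verma_act (Uhh_sl2 g) n (Hw (Uhh_sl2 g)) (?bUhh v) = ?bUhh (fps_map (fps_map (app (weight_op n))) v)" for v
      using Uhh.U_generators(3) act_const[of H4] by (simp only: Udef letter4.simps)
    show "lookup (app (weight_op n) p) k = of_int (n - 2 * int k) * lookup p k" for p k
      by (simp only: weight_op_def lookup_diagonal)
  qed

  have basis: ?basis
    by (rule topological_basis_single[OF bUhh.coordinates_axioms vecUhh])

  have smult_e: "c \<odot>\<^bsub>verma (Uhh_sl2 g) n\<^esub> verma_vec (Uhh_sl2 g) n k =
      ?bUhh (Abs_fps (\<lambda>j. Abs_fps (\<lambda>i. single k (c $ j $ i))))" for c k
    unfolding vecUhh bUhh.smult[symmetric]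
    by (rule arg_cong[of _ _ ?bUhh]) (simp add: fps_eq_iff)
  have const_e: "?bUhh (fps_map (fps_map (app T)) (const2 (?e k))) = of_int m \<odot>\<^bsub>verma (Uhh_sl2 g) n\<^esub> verma_vec (Uhh_sl2 g) n k"
    if "app T (?e k) = single k (of_int m)" for T k m
  proof -
    have m: "(of_int m :: complex fps fps) = const2 (of_int m)" by (simp add: fps_of_int)
    show ?thesis
      unfolding smult_e m using that
      by (intro arg_cong[of _ _ ?bUhh]) (auto simp: fps_eq_iff additive.zero[OF additive_app])
  qed
  have formulas: "?act_H j" "?act_C j" "?act_Xm j" "?act_Xp j" for j
  proof -
    show "?act_H j"
      unfolding Uhh.U_generators(3)[unfolded Udef] vecUhh[of j] act_const[of H4, OF letter4.simps(3)]
      by (rule const_e[unfolded vecUhh]) (simp add: weight_op_def)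
    show "?act_C j"
      unfolding C vecUhh[of j] act_const[of C4, OF letter4.simps(4)]
      by (rule const_e[unfolded vecUhh]) (simp only: app_scE sc_mult_single mult_1_right of_int_power)
    show "?act_Xm j"
      unfolding Uhh.U_generators(2)[unfolded Udef] vecUhh act_const[of Xm4, OF letter4.simps(2)]
      by (rule arg_cong[of _ _ ?bUhh]) (auto simp: fps_eq_iff additive.zero[OF additive_app])
    have "\<pi>4 g n (const2 (var Xp4) * Q4 (const2 (?e j))) =
        Abs_fps (\<lambda>j'. Abs_fps (\<lambda>i. if j = 0 then 0 else single (j - 1) (ladder g n j $ j' $ i)))"
    proof (intro fps_ext)
      fix j' i
      have "R4 g n (Q4 (const2 (?e j))) = const2 (raise_lin (?e j))"
        unfolding map_const R4_const by (rule \<rho>4_powers)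
      then show "\<pi>4 g n (const2 (var Xp4) * Q4 (const2 (?e j))) $ j' $ i =
          Abs_fps (\<lambda>j'. Abs_fps (\<lambda>i. if j = 0 then 0 else single (j - 1) (ladder g n j $ j' $ i))) $ j' $ i"
        by (simp add: \<pi>4_def ring_morphism.mult[OF ring_morphism_R4] R4_const on_highest_def app_raise_lin del: single_one)
    qed
    then have "verma_act (Uhh_sl2 g) n (Xp (Uhh_sl2 g)) (verma_vec (Uhh_sl2 g) n j) =
        ?bUhh (Abs_fps (\<lambda>j'. Abs_fps (\<lambda>i. if j = 0 then 0 else single (j - 1) (ladder g n j $ j' $ i))))"
      unfolding Uhh.U_generators(1)[unfolded Udef] vecUhh act_var by (rule arg_cong)
    also have "\<dots> = (if j = 0 then \<zero>\<^bsub>verma (Uhh_sl2 g) n\<^esub>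
           else ladder g n j \<odot>\<^bsub>verma (Uhh_sl2 g) n\<^esub> verma_vec (Uhh_sl2 g) n (j - 1))"
    proof (cases "j = 0")
      case True
      have "Abs_fps (\<lambda>j'. Abs_fps (\<lambda>i. 0)) = (0 :: (nat \<Rightarrow>\<^sub>0 complex) fps fps)" by (simp add: fps_eq_iff)
      then show ?thesis using True bUhh.zero by simp
    qed (simp add: smult_e)
    finally show "?act_Xp j"
      by (simp only: ladder_def)
  qed

  show ?thesis
    by (intro conjI allI rank along_hh' along_h' weights basis formulas)
qed

end
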